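(* Let $A$ be an associative unital $\mathbb K$-algebra. The unital tensor algebra $\overline T(\mathcal{NC}(A))$ over the space $\mathcal{NC}(A)$ of $A$-decorated non-crossing partitions, with concatenation product, coproduct $\Delta$ and half-coproducts $\Delta_\prec,\Delta_\succ$ described in the context, is an unshuffle bialgebra.
   Context: $\mathbb K$ is a field of characteristic zero. For $n\ge1$, $[n]=\{1,\dots,n\}$. A partition of a finite $S\subset\mathbb N$ into nonempty disjoint blocks is non-crossing if there are no $p_1<q_1<p_2<q_2$ in $S$ with $p_1,p_2$ in one block and $q_1,q_2$ in another. $NC_n$ is the set of non-crossing partitions of $[n]$ and $\mathcal{NC}_n$ its linear span. $\mathcal{NC}(A)=\bigoplus_{n\ge1}\mathcal{NC}_n\otimes A^{\otimes n}$, elements written $L\otimes(a_1\cdots a_n)$, graded by $n$. For $S=\{s_1<\dots<s_k\}\subseteq[n]$, $a_S:=a_{s_1}\cdots a_{s_k}$, and for a partition $Q$ of $S$, $a_Q:=a_S$. For blocks $B,C$ of a non-crossing partition $L$, $B<_L C$ iff $\inf C<m<\sup C$ for all $m\in B$. A decomposition $L=Q\sqcup U$ of the blocks (either part possibly empty) is admissible if there are no $B\in Q$, $C\in U$ with $B<_L C$; then $J_1,\dots,J_k$ denote the maximal sets of consecutive integers in $[n]\setminus\bigcup Q$ (left to right) and $J_i^{L,Q}$ the non-crossing partition of $J_i$ formed by the blocks of $U$ inside $J_i$; $a_{J_i^{L,Q}}:=a_{J_i}$. $st$ is the increasing bijection of a finite $S\subset\mathbb N$ onto $[|S|]$, applied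 to partitions by transport. $\overline T(\mathcal{NC}(A))=\bigoplus_{k\ge0}\mathcal{NC}(A)^{\otimes k}$ with bar notation $w_1|\cdots|w_k$, concatenation product, unit $\mathbf 1$; $T(\mathcal{NC}(A))$ is the part $k\ge1$. The coproduct is $$\Delta(L\otimes a_1\cdots a_n)=\sum_{L=Q\sqcup U\ \text{adm}}\big(st(Q)\otimes a_Q\big)\otimes\big(st(J_1^{L,Q})\otimes a_{J_1^{L,Q}}|\cdots|st(J_k^{L,Q})\otimes a_{J_k^{L,Q}}\big),$$ where the empty decorated partition and the empty bar word are both $\mathbf 1$; it is extended multiplicatively with $\Delta(\mathbf 1)=\mathbf 1\otimes\mathbf 1$. $\Delta^+_\prec(L\otimes a)$ (resp. $\Delta^+_\succ(L\otimes a)$) is the same sum restricted to admissible decompositions where the block containing $1$ lies in $Q$ (resp. in $U$); $\Delta_\prec(x)=\Delta^+_\prec(x)-x\otimes\mathbf 1$, $\Delta_\succ(x)=\Delta^+_\succ(x)-\mathbf 1\otimes x$; on bar words $\Delta^+_\prec(w_1|\cdots|w_m)=\Delta^+_\prec(w_1)\Delta(w_2)\cdots\Delta(w_m)$, $\Delta^+_\succ(w_1|\cdots|w_m)=\Delta^+_\succ(w_1)\Delta(w_2)\cdots\Delta(w_m)$, and $\Delta_\prec(w)=\Delta^+_\prec(w)-w\otimes\mathbf 1$, $\Delta_\succ(w)=\Delta^+_\succ(w)-\mathbf 1\otimes w$. An unshuffle bialgebra is a unital counital bialgebra $\overline B=B\oplus\mathbb K$ (product $\cdot$, coproduct $\Delta$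 with $\Delta(c)=\bar\Delta(c)+c\otimes\mathbf 1+\mathbf 1\otimes c$ on $B$) with maps $\Delta_\prec,\Delta_\succ:B\to B\otimes B$, $\bar\Delta=\Delta_\prec+\Delta_\succ$, satisfying $(\Delta_\prec\otimes I)\Delta_\prec=(I\otimes\bar\Delta)\Delta_\prec$, $(\Delta_\succ\otimes I)\Delta_\prec=(I\otimes\Delta_\prec)\Delta_\succ$, $(\bar\Delta\otimes I)\Delta_\succ=(I\otimes\Delta_\succ)\Delta_\succ$, $\Delta^+_\prec(a\cdot b)=\Delta^+_\prec(a)\cdot\Delta(b)$, $\Delta^+_\succ(a\cdot b)=\Delta^+_\succ(a)\cdot\Delta(b)$, with $\Delta^+_\prec(a)=\Delta_\prec(a)+a\otimes\mathbf 1$, $\Delta^+_\succ(a)=\Delta_\succ(a)+\mathbf 1\otimes a$. *)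

theory Defs
  imports Complex_Main "HOL-Library.Poly_Mapping" "HOL-Library.Disjoint_Sets"
begin

section \<open>Linear algebra over an arbitrary field\<close>

text \<open>
  A vector space is a subspace \<open>V\<close> of a type with scalar multiplication \<open>s\<close>.
  The type of finitely supported functions with values in a vector space is a direct sum;
  with values in the field it is the free vector space on the index type.
\<close>

definition pscale :: "('k \<Rightarrow> 'v \<Rightarrow> 'v) \<Rightarrow> 'k \<Rightarrow> ('i \<Rightarrow>\<^sub>0 'v::zero) \<Rightarrow> ('i \<Rightarrow>\<^sub>0 'v)"
  where "pscale s c f = Poly_Mapping.map (s c) f"

abbreviation fscale :: "'k::field \<Rightarrow> ('i \<Rightarrow>\<^sub>0 'k) \<Rightarrow> ('i \<Rightarrow>\<^sub>0 'k)"
  where "fscale \<equiv> pscale (*)"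

lemma vector_space_pscale:
  fixes s :: "'k::field \<Rightarrow> 'v::ab_group_add \<Rightarrow> 'v"
  assumes "vector_space s"
  shows "vector_space (pscale s :: 'k \<Rightarrow> ('i \<Rightarrow>\<^sub>0 'v) \<Rightarrow> _)"
proof -
  interpret vector_space s by fact
  have lk: "Poly_Mapping.lookup (pscale s c f) i = s c (Poly_Mapping.lookup f i)"
    for c i and f :: "'i \<Rightarrow>\<^sub>0 'v"
    by (simp add: pscale_def Poly_Mapping.map.rep_eq when_def)
  show ?thesis
    by unfold_locales
      (auto intro!: poly_mapping_eqI simp: lk lookup_add scale_right_distrib scale_left_distrib)
qed

lemma vector_space_fscale: "vector_space (fscale :: 'k::field \<Rightarrow> ('i \<Rightarrow>\<^sub>0 'k) \<Rightarrow> _)"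
  by (rule vector_space_pscale) (unfold_locales, auto simp: algebra_simps)

definition linear_on ::
    "('k \<Rightarrow> 'v::ab_group_add \<Rightarrow> 'v) \<Rightarrow> ('k \<Rightarrow> 'w::ab_group_add \<Rightarrow> 'w) \<Rightarrow> 'v set \<Rightarrow> ('v \<Rightarrow> 'w) \<Rightarrow> bool"
  where "linear_on s t V f \<longleftrightarrow>
    (\<forall>x\<in>V. \<forall>y\<in>V. f (x + y) = f x + f y) \<and> (\<forall>c. \<forall>x\<in>V. f (s c x) = t c (f x))"

text \<open>
  \<open>lin_ext s t g I f\<close> is the linear map, on the span of the family \<open>g i\<close> with \<open>i \<in> I\<close>, that sends
  \<open>g i\<close> to \<open>f i\<close>.  It is unique on that span.  If \<open>f\<close> does not respect the linear relations
  between the \<open>g i\<close>, there is no such map and nothing is known about \<open>lin_ext\<close>.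
\<close>

definition lin_ext ::
    "('k::field \<Rightarrow> 'v::ab_group_add \<Rightarrow> 'v) \<Rightarrow> ('k \<Rightarrow> 'w::ab_group_add \<Rightarrow> 'w) \<Rightarrow>
     ('i \<Rightarrow> 'v) \<Rightarrow> 'i set \<Rightarrow> ('i \<Rightarrow> 'w) \<Rightarrow> 'v \<Rightarrow> 'w"
  where "lin_ext s t g I f =
    (SOME D. linear_on s t (module.span s (g ` I)) D \<and> (\<forall>i\<in>I. D (g i) = f i))"

definition bilin_ext ::
    "('k::field \<Rightarrow> 'v::ab_group_add \<Rightarrow> 'v) \<Rightarrow> ('k \<Rightarrow> 'w::ab_group_add \<Rightarrow> 'w) \<Rightarrow>
     ('i \<Rightarrow> 'v) \<Rightarrow> 'i set \<Rightarrow> ('i \<Rightarrow> 'i \<Rightarrow> 'w) \<Rightarrow> 'v \<Rightarrow> 'v \<Rightarrow> 'w"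
  where "bilin_ext s t g I f x y = lin_ext s t g I (\<lambda>i. lin_ext s t g I (f i) y) x"

text \<open>
  The quotient of a vector space by a subspace \<open>R\<close> is realized as the image of a linear
  endomorphism with kernel \<open>R\<close>; \<open>quot_map s R x\<close> plays the role of the class of \<open>x\<close>.
\<close>

definition quot_map :: "('k::field \<Rightarrow> 'v::ab_group_add \<Rightarrow> 'v) \<Rightarrow> 'v set \<Rightarrow> 'v \<Rightarrow> 'v"
  where "quot_map s R = (SOME p. Vector_Spaces.linear s s p \<and> {x. p x = 0} = R)"

lemma quot_map:
  assumes "vector_space s" "module.subspace s R"
  shows "Vector_Spaces.linear s s (quot_map s R)" "quot_map s R x = 0 \<longleftrightarrow> x \<in> R"
proof -
  interpret vector_space s by fact
  interpret vector_space_pair s s by unfold_locales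
  obtain B where B: "B \<subseteq> R" "independent B" "span B = R"
    using assms(2) basis_exists[of R] span_subspace by metis
  define C where "C = extend_basis B"
  have C: "B \<subseteq> C" "independent C" "span C = UNIV"
    unfolding C_def using B(2)
    by (simp_all add: extend_basis_superset independent_extend_basis span_extend_basis)
  define p where "p = construct C (\<lambda>b. if b \<in> B then 0 else b)"
  have lin: "Vector_Spaces.linear s s p"
    unfolding p_def by (rule linear_construct[OF C(2)])
  then interpret p: Vector_Spaces.linear s s p .
  have pB: "p b = 0" if "b \<in> B" for b
    unfolding p_def using that C by (subst construct_basis) auto
  have pC: "p b = b" if "b \<in> C - B" for b
    unfolding p_def using that C by (subst construct_basis) auto
  have p0: "p x = 0" if "x \<in> R" for x
    using p.eq_0_on_span[of B x] pB that B(3) by auto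
  have pid: "p x = x" if "x \<in> span (C - B)" for x
    using linear_eq_on[OF lin linear_id that] pC by (auto simp: id_def)
  have "x \<in> R" if "p x = 0" for x
  proof -
    have "x \<in> span (B \<union> (C - B))" using C by (auto simp: Un_absorb1)
    then obtain y z where "x = y + z" "y \<in> span B" "z \<in> span (C - B)"
      unfolding span_Un by auto
    with that pid p0 B(3) show ?thesis by (auto simp: p.add)
  qed
  with p0 have "{x. p x = 0} = R" by auto
  with lin have "\<exists>p. Vector_Spaces.linear s s p \<and> {x. p x = 0} = R" by blast
  from someI_ex[OF this]
  show "Vector_Spaces.linear s s (quot_map s R)" "quot_map s R x = 0 \<longleftrightarrow> x \<in> R"
    unfolding quot_map_def by auto
qed


section \<open>Tensor powers and tensor algebra\<close>

definition multilin_rel ::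
    "('k::field \<Rightarrow> 'v::ab_group_add \<Rightarrow> 'v) \<Rightarrow> 'v set \<Rightarrow> ('v list \<Rightarrow>\<^sub>0 'k) set"
  where "multilin_rel s V = module.span fscale
    ({Poly_Mapping.single (xs @ (x + y) # ys) 1
        - Poly_Mapping.single (xs @ x # ys) 1 - Poly_Mapping.single (xs @ y # ys) 1
      | xs x y ys. xs \<in> lists V \<and> x \<in> V \<and> y \<in> V \<and> ys \<in> lists V} \<union>
     {Poly_Mapping.single (xs @ s c x # ys) 1
        - fscale c (Poly_Mapping.single (xs @ x # ys) 1)
      | xs c x ys. xs \<in> lists V \<and> x \<in> V \<and> ys \<in> lists V})"

text \<open>
  \<open>ten s V [x\<^sub>1, \<dots>, x\<^sub>n]\<close> is the pure tensor \<open>x\<^sub>1 \<otimes> \<cdots> \<otimes> x\<^sub>n\<close> of elements of \<open>V\<close>, and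
  \<open>ten s V []\<close> is the unit of the tensor algebra.  Since the relations are homogeneous in the
  length of the lists, the tensor powers of \<open>V\<close> for different exponents form a direct sum.
\<close>

definition ten :: "('k::field \<Rightarrow> 'v::ab_group_add \<Rightarrow> 'v) \<Rightarrow> 'v set \<Rightarrow> 'v list \<Rightarrow> ('v list \<Rightarrow>\<^sub>0 'k)"
  where "ten s V xs = quot_map fscale (multilin_rel s V) (Poly_Mapping.single xs 1)"

definition tpower :: "('k::field \<Rightarrow> 'v::ab_group_add \<Rightarrow> 'v) \<Rightarrow> 'v set \<Rightarrow> nat \<Rightarrow> ('v list \<Rightarrow>\<^sub>0 'k) set"
  where "tpower s V n = module.span fscale (ten s V ` {xs \<in> lists V. length xs = n})"

definition talg :: "('k::field \<Rightarrow> 'v::ab_group_add \<Rightarrow> 'v) \<Rightarrow> 'v set \<Rightarrow> ('v list \<Rightarrow>\<^sub>0 'k) set"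
  where "talg s V = module.span fscale (ten s V ` lists V)"

definition talg_plus :: "('k::field \<Rightarrow> 'v::ab_group_add \<Rightarrow> 'v) \<Rightarrow> 'v set \<Rightarrow> ('v list \<Rightarrow>\<^sub>0 'k) set"
  where "talg_plus s V = module.span fscale (ten s V ` (lists V - {[]}))"

definition multilinear_on ::
    "('k \<Rightarrow> 'v::ab_group_add \<Rightarrow> 'v) \<Rightarrow> ('k \<Rightarrow> 'w::ab_group_add \<Rightarrow> 'w) \<Rightarrow> 'v set \<Rightarrow> ('v list \<Rightarrow> 'w) \<Rightarrow> bool"
  where "multilinear_on s t V \<phi> \<longleftrightarrow>
    (\<forall>xs\<in>lists V. \<forall>ys\<in>lists V. linear_on s t V (\<lambda>x. \<phi> (xs @ x # ys)))"

lemma ten_universal: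
  fixes s :: "'k::field \<Rightarrow> 'v::ab_group_add \<Rightarrow> 'v" and t :: "'k \<Rightarrow> 'w::ab_group_add \<Rightarrow> 'w"
  assumes t: "vector_space t" and \<phi>: "multilinear_on s t V \<phi>"
  defines "D \<equiv> lin_ext fscale t (ten s V) (lists V) \<phi>"
  shows "linear_on fscale t (talg s V) D" "\<And>xs. xs \<in> lists V \<Longrightarrow> D (ten s V xs) = \<phi> xs"
proof -
  interpret t: vector_space t by fact
  interpret F: vector_space "fscale :: 'k \<Rightarrow> ('v list \<Rightarrow>\<^sub>0 'k) \<Rightarrow> _" by (rule vector_space_fscale)
  define R where "R = multilin_rel s V"
  define p where "p = quot_map fscale R"
  have subR: "F.subspace R" unfolding R_def multilin_rel_def by simp
  have "Vector_Spaces.linear fscale fscale p" unfolding p_def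
    by (rule quot_map[OF vector_space_fscale subR])
  then interpret p: Vector_Spaces.linear fscale fscale p .
  have ker: "p x = 0 \<longleftrightarrow> x \<in> R" for x
    unfolding p_def by (rule quot_map[OF vector_space_fscale subR])
  define \<Phi> where "\<Phi> f = (\<Sum>k\<in>Poly_Mapping.keys f. t (Poly_Mapping.lookup f k) (\<phi> k))" for f
  have lk: "Poly_Mapping.lookup (fscale c f) i = c * Poly_Mapping.lookup f i"
    for c i and f :: "'v list \<Rightarrow>\<^sub>0 'k"
    by (simp add: pscale_def Poly_Mapping.map.rep_eq when_def)
  have \<Phi>_sup: "\<Phi> f = (\<Sum>k\<in>K. t (Poly_Mapping.lookup f k) (\<phi> k))"
    if "finite K" "Poly_Mapping.keys f \<subseteq> K" for f K
    unfolding \<Phi>_def by (rule sum.mono_neutral_left) (use that in \<open>auto simp: in_keys_iff\<close>)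
  have add: "\<Phi> (f + g) = \<Phi> f + \<Phi> g" for f g
  proof -
    let ?K = "Poly_Mapping.keys f \<union> Poly_Mapping.keys g"
    have "Poly_Mapping.keys (f + g) \<subseteq> ?K" by (rule Poly_Mapping.keys_add)
    then show ?thesis
      by (simp add: \<Phi>_sup[of ?K] lookup_add t.scale_left_distrib sum.distrib)
  qed
  have scal: "\<Phi> (fscale c f) = t c (\<Phi> f)" for c f
  proof -
    have "Poly_Mapping.keys (fscale c f) \<subseteq> Poly_Mapping.keys f"
      by (auto simp: in_keys_iff lk)
    then show ?thesis
      by (simp add: \<Phi>_sup[of "Poly_Mapping.keys f"] lk t.scale_sum_right)
  qed
  interpret \<Phi>: Vector_Spaces.linear fscale t \<Phi>
    by unfold_locales (simp_all add: add scal)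
  have single: "\<Phi> (Poly_Mapping.single k 1) = \<phi> k" for k
    by (simp add: \<Phi>_def)
  have \<Phi>R: "\<Phi> x = 0" if "x \<in> R" for x
    using that unfolding R_def multilin_rel_def
  proof (rule \<Phi>.eq_0_on_span[rotated])
    fix g
    assume "g \<in> ({Poly_Mapping.single (xs @ (x + y) # ys) 1
        - Poly_Mapping.single (xs @ x # ys) 1 - Poly_Mapping.single (xs @ y # ys) 1
      | xs x y ys. xs \<in> lists V \<and> x \<in> V \<and> y \<in> V \<and> ys \<in> lists V} \<union>
     {Poly_Mapping.single (xs @ s c x # ys) 1
        - fscale c (Poly_Mapping.single (xs @ x # ys) 1)
      | xs c x ys. xs \<in> lists V \<and> x \<in> V \<and> ys \<in> lists V})"
    then show "\<Phi> g = 0"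
      using \<phi> unfolding multilinear_on_def linear_on_def
      by (elim UnE CollectE exE conjE) (simp_all add: \<Phi>.diff single scal)
  qed
  have ten: "ten s V xs = p (Poly_Mapping.single xs 1)" for xs
    by (simp add: ten_def p_def R_def)
  define E where "E y = \<Phi> (SOME x. p x = y)" for y
  have E: "E (p x) = \<Phi> x" for x
  proof -
    have "p (SOME x'. p x' = p x) = p x" by (rule someI) simp
    then have "(SOME x'. p x' = p x) - x \<in> R" by (simp add: ker[symmetric] p.diff)
    from \<Phi>R[OF this] show ?thesis by (simp add: E_def \<Phi>.diff)
  qed
  have "talg s V \<subseteq> range p"
    unfolding talg_def by (rule F.span_minimal) (auto simp: ten intro: p.subspace_image)
  moreover have "linear_on fscale t (range p) E"
  proof -
    have "E (p x + p y) = E (p x) + E (p y)" for x y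
      using E[of "x + y"] by (simp only: p.add add E)
    moreover have "E (fscale c (p x)) = t c (E (p x))" for c x
      using E[of "fscale c x"] by (simp only: p.scale scal E)
    ultimately show ?thesis unfolding linear_on_def by blast
  qed
  ultimately have "linear_on fscale t (talg s V) E"
    unfolding linear_on_def by blast
  moreover have "E (ten s V xs) = \<phi> xs" for xs
    by (simp add: ten E single)
  ultimately have "\<exists>D. linear_on fscale t (talg s V) D \<and> (\<forall>xs\<in>lists V. D (ten s V xs) = \<phi> xs)"
    by blast
  from someI_ex[OF this]
  show "linear_on fscale t (talg s V) D" "\<And>xs. xs \<in> lists V \<Longrightarrow> D (ten s V xs) = \<phi> xs"
    unfolding D_def lin_ext_def talg_def[symmetric] by auto
qed

lemma ten_multilinear:
  fixes s :: "'k::field \<Rightarrow> 'v::ab_group_add \<Rightarrow> 'v"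
  shows "multilinear_on s fscale V (ten s V)"
proof -
  interpret F: vector_space "fscale :: 'k \<Rightarrow> ('v list \<Rightarrow>\<^sub>0 'k) \<Rightarrow> _" by (rule vector_space_fscale)
  define R where "R = multilin_rel s V"
  define p where "p = quot_map fscale R"
  have subR: "F.subspace R" unfolding R_def multilin_rel_def by simp
  have "Vector_Spaces.linear fscale fscale p" unfolding p_def
    by (rule quot_map[OF vector_space_fscale subR])
  then interpret p: Vector_Spaces.linear fscale fscale p .
  have ker: "p x = 0 \<longleftrightarrow> x \<in> R" for x
    unfolding p_def by (rule quot_map[OF vector_space_fscale subR])
  have ten: "ten s V xs = p (Poly_Mapping.single xs 1)" for xs
    by (simp add: ten_def p_def R_def)
  have "ten s V (xs @ (x + y) # ys) = ten s V (xs @ x # ys) + ten s V (xs @ y # ys)"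
    if "xs \<in> lists V" "ys \<in> lists V" "x \<in> V" "y \<in> V" for xs ys x y
  proof -
    have "Poly_Mapping.single (xs @ (x + y) # ys) 1
        - Poly_Mapping.single (xs @ x # ys) 1 - Poly_Mapping.single (xs @ y # ys) 1 \<in> R"
      unfolding R_def multilin_rel_def using that by (intro F.span_base) blast
    then show ?thesis by (simp add: ker[symmetric] p.diff p.add ten algebra_simps)
  qed
  moreover have "ten s V (xs @ s c x # ys) = fscale c (ten s V (xs @ x # ys))"
    if "xs \<in> lists V" "ys \<in> lists V" "x \<in> V" for xs ys c x
  proof -
    have "Poly_Mapping.single (xs @ s c x # ys) 1
        - fscale c (Poly_Mapping.single (xs @ x # ys) 1) \<in> R"
      unfolding R_def multilin_rel_def using that by (intro F.span_base) blast
    then show ?thesis by (simp add: ker[symmetric] p.diff p.scale ten)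
  qed
  ultimately show ?thesis by (simp add: multilinear_on_def linear_on_def)
qed

definition tconc ::
    "('k::field \<Rightarrow> 'v::ab_group_add \<Rightarrow> 'v) \<Rightarrow> 'v set \<Rightarrow>
     ('v list \<Rightarrow>\<^sub>0 'k) \<Rightarrow> ('v list \<Rightarrow>\<^sub>0 'k) \<Rightarrow> ('v list \<Rightarrow>\<^sub>0 'k)"
  where "tconc s V =
    bilin_ext fscale fscale (ten s V) (lists V) (\<lambda>xs ys. ten s V (xs @ ys))"

text \<open>The augmentation of the tensor algebra: projection onto the component of degree \<open>0\<close>.\<close>

definition tcounit ::
    "('k::field \<Rightarrow> 'v::ab_group_add \<Rightarrow> 'v) \<Rightarrow> 'v set \<Rightarrow> ('v list \<Rightarrow>\<^sub>0 'k) \<Rightarrow> 'k"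
  where "tcounit s V = lin_ext fscale (*) (ten s V) (lists V) (\<lambda>xs. if xs = [] then 1 else 0)"

definition ten2 :: "('k::field \<Rightarrow> 'v::ab_group_add \<Rightarrow> 'v) \<Rightarrow> 'v set \<Rightarrow> 'v \<times> 'v \<Rightarrow> ('v list \<Rightarrow>\<^sub>0 'k)"
  where "ten2 s V = (\<lambda>(x, y). ten s V [x, y])"

text \<open>
  For a subspace \<open>U\<close> of \<open>V\<close>, the space \<open>U \<otimes> U\<close> is identified with its image
  \<open>tsquare s V U\<close> in \<open>V \<otimes> V\<close>.
\<close>

definition tsquare ::
    "('k::field \<Rightarrow> 'v::ab_group_add \<Rightarrow> 'v) \<Rightarrow> 'v set \<Rightarrow> 'v set \<Rightarrow> ('v list \<Rightarrow>\<^sub>0 'k) set"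
  where "tsquare s V U = module.span fscale (ten2 s V ` (U \<times> U))"

text \<open>
  The product \<open>(a \<otimes> b)(c \<otimes> d) = ac \<otimes> bd\<close> on \<open>V \<otimes> V\<close> induced by a product \<open>m\<close> on \<open>V\<close>.
\<close>

definition tsquare_mult ::
    "('k::field \<Rightarrow> 'v::ab_group_add \<Rightarrow> 'v) \<Rightarrow> 'v set \<Rightarrow> ('v \<Rightarrow> 'v \<Rightarrow> 'v) \<Rightarrow>
     ('v list \<Rightarrow>\<^sub>0 'k) \<Rightarrow> ('v list \<Rightarrow>\<^sub>0 'k) \<Rightarrow> ('v list \<Rightarrow>\<^sub>0 'k)"
  where "tsquare_mult s V m =
    bilin_ext fscale fscale (ten2 s V) (V \<times> V) (\<lambda>(a, b) (c, d). ten2 s V (m a c, m b d))"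

text \<open>
  For \<open>f : U \<rightarrow> V \<otimes> V\<close>, the maps \<open>f \<otimes> I\<close> and \<open>I \<otimes> f\<close> from \<open>U \<otimes> U\<close> to \<open>V \<otimes> V \<otimes> V\<close>;
  concatenation of tensors realizes \<open>(V \<otimes> V) \<otimes> V = V \<otimes> V \<otimes> V = V \<otimes> (V \<otimes> V)\<close>.
\<close>

definition tmap_left ::
    "('k::field \<Rightarrow> 'v::ab_group_add \<Rightarrow> 'v) \<Rightarrow> 'v set \<Rightarrow> 'v set \<Rightarrow> ('v \<Rightarrow> ('v list \<Rightarrow>\<^sub>0 'k)) \<Rightarrow>
     ('v list \<Rightarrow>\<^sub>0 'k) \<Rightarrow> ('v list \<Rightarrow>\<^sub>0 'k)"
  where "tmap_left s V U f =
    lin_ext fscale fscale (ten2 s V) (U \<times> U) (\<lambda>(x, y). tconc s V (f x) (ten s V [y]))"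

definition tmap_right ::
    "('k::field \<Rightarrow> 'v::ab_group_add \<Rightarrow> 'v) \<Rightarrow> 'v set \<Rightarrow> 'v set \<Rightarrow> ('v \<Rightarrow> ('v list \<Rightarrow>\<^sub>0 'k)) \<Rightarrow>
     ('v list \<Rightarrow>\<^sub>0 'k) \<Rightarrow> ('v list \<Rightarrow>\<^sub>0 'k)"
  where "tmap_right s V U f =
    lin_ext fscale fscale (ten2 s V) (U \<times> U) (\<lambda>(x, y). tconc s V (ten s V [x]) (f y))"


section \<open>Algebras, bialgebras and unshuffle bialgebras\<close>

text \<open>The sort \<open>{ring, monoid_mult}\<close> is that of unital rings in which \<open>0 = 1\<close> is allowed.\<close>

locale assoc_unital_algebra = vector_space s
  for s :: "'k::field \<Rightarrow> 'a::{ring, monoid_mult} \<Rightarrow> 'a" +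
  assumes scale_mult_left: "s c x * y = s c (x * y)"
    and scale_mult_right: "x * s c y = s c (x * y)"

locale unital_counital_bialgebra = vector_space s
  for s :: "'k::field \<Rightarrow> 'b::ab_group_add \<Rightarrow> 'b" +
  fixes V :: "'b set"
    and m :: "'b \<Rightarrow> 'b \<Rightarrow> 'b"
    and u :: 'b
    and \<epsilon> :: "'b \<Rightarrow> 'k"
    and \<Delta> :: "'b \<Rightarrow> ('b list \<Rightarrow>\<^sub>0 'k)"
  assumes subspace_carrier: "subspace V"
    and mult_closed: "x \<in> V \<Longrightarrow> y \<in> V \<Longrightarrow> m x y \<in> V"
    and mult_linear_left: "y \<in> V \<Longrightarrow> linear_on s s V (\<lambda>x. m x y)"
    and mult_linear_right: "x \<in> V \<Longrightarrow> linear_on s s V (m x)"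
    and mult_assoc: "x \<in> V \<Longrightarrow> y \<in> V \<Longrightarrow> z \<in> V \<Longrightarrow> m (m x y) z = m x (m y z)"
    and unit_closed: "u \<in> V"
    and unit_left: "x \<in> V \<Longrightarrow> m u x = x"
    and unit_right: "x \<in> V \<Longrightarrow> m x u = x"
    and coprod_closed: "x \<in> V \<Longrightarrow> \<Delta> x \<in> tsquare s V V"
    and coprod_linear: "linear_on s fscale V \<Delta>"
    and coprod_coassoc: "x \<in> V \<Longrightarrow> tmap_left s V V \<Delta> (\<Delta> x) = tmap_right s V V \<Delta> (\<Delta> x)"
    and counit_linear: "linear_on s (*) V \<epsilon>"
    and counit_left: "x \<in> V \<Longrightarrow>
      lin_ext fscale s (ten2 s V) (V \<times> V) (\<lambda>(y, z). s (\<epsilon> y) z) (\<Delta> x) = x"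
    and counit_right: "x \<in> V \<Longrightarrow>
      lin_ext fscale s (ten2 s V) (V \<times> V) (\<lambda>(y, z). s (\<epsilon> z) y) (\<Delta> x) = x"
    and coprod_mult: "x \<in> V \<Longrightarrow> y \<in> V \<Longrightarrow> \<Delta> (m x y) = tsquare_mult s V m (\<Delta> x) (\<Delta> y)"
    and coprod_unit: "\<Delta> u = ten2 s V (u, u)"
    and counit_mult: "x \<in> V \<Longrightarrow> y \<in> V \<Longrightarrow> \<epsilon> (m x y) = \<epsilon> x * \<epsilon> y"
    and counit_unit: "\<epsilon> u = 1"

text \<open>
  In the following, \<open>V = B \<oplus> K u\<close>, and \<open>\<lambda>x. \<Delta>\<^sub>p x + \<Delta>\<^sub>s x\<close> is the reduced coproduct on \<open>B\<close>;
  \<open>\<Delta>\<^sub>p\<close> and \<open>\<Delta>\<^sub>s\<close> are the left (prec) and right (succ) half-coproducts.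
\<close>

locale unshuffle_bialgebra = unital_counital_bialgebra s V m u \<epsilon> \<Delta>
  for s :: "'k::field \<Rightarrow> 'b::ab_group_add \<Rightarrow> 'b" and V m u \<epsilon> \<Delta> +
  fixes B :: "'b set"
    and \<Delta>\<^sub>p \<Delta>\<^sub>s :: "'b \<Rightarrow> ('b list \<Rightarrow>\<^sub>0 'k)"
  assumes subspace_B: "subspace B"
    and carrier_sum: "V = {b + s c u | b c. b \<in> B}"
    and carrier_direct: "B \<inter> span {u} = {0}"
    and counit_B: "b \<in> B \<Longrightarrow> \<epsilon> b = 0"
    and prec_closed: "b \<in> B \<Longrightarrow> \<Delta>\<^sub>p b \<in> tsquare s V B"
    and prec_linear: "linear_on s fscale B \<Delta>\<^sub>p"
    and succ_closed: "b \<in> B \<Longrightarrow> \<Delta>\<^sub>s b \<in> tsquare s V B"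
    and succ_linear: "linear_on s fscale B \<Delta>\<^sub>s"
    and coprod_split: "b \<in> B \<Longrightarrow> \<Delta> b = (\<Delta>\<^sub>p b + \<Delta>\<^sub>s b) + ten2 s V (b, u) + ten2 s V (u, b)"
    and prec_prec: "b \<in> B \<Longrightarrow>
      tmap_left s V B \<Delta>\<^sub>p (\<Delta>\<^sub>p b) = tmap_right s V B (\<lambda>x. \<Delta>\<^sub>p x + \<Delta>\<^sub>s x) (\<Delta>\<^sub>p b)"
    and succ_prec: "b \<in> B \<Longrightarrow>
      tmap_left s V B \<Delta>\<^sub>s (\<Delta>\<^sub>p b) = tmap_right s V B \<Delta>\<^sub>p (\<Delta>\<^sub>s b)"
    and succ_succ: "b \<in> B \<Longrightarrow>
      tmap_left s V B (\<lambda>x. \<Delta>\<^sub>p x + \<Delta>\<^sub>s x) (\<Delta>\<^sub>s b) = tmap_right s V B \<Delta>\<^sub>s (\<Delta>\<^sub>s b)"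
    and prec_mult: "a \<in> B \<Longrightarrow> b \<in> B \<Longrightarrow>
      \<Delta>\<^sub>p (m a b) + ten2 s V (m a b, u) =
        tsquare_mult s V m (\<Delta>\<^sub>p a + ten2 s V (a, u)) (\<Delta> b)"
    and succ_mult: "a \<in> B \<Longrightarrow> b \<in> B \<Longrightarrow>
      \<Delta>\<^sub>s (m a b) + ten2 s V (u, m a b) =
        tsquare_mult s V m (\<Delta>\<^sub>s a + ten2 s V (u, a)) (\<Delta> b)"


section \<open>Non-crossing partitions\<close>

definition noncrossing :: "nat set \<Rightarrow> nat set set \<Rightarrow> bool"
  where "noncrossing S L \<longleftrightarrow> partition_on S L \<and>
    \<not> (\<exists>B\<in>L. \<exists>C\<in>L. B \<noteq> C \<and>
        (\<exists>p\<^sub>1\<in>B. \<exists>q\<^sub>1\<in>C. \<exists>p\<^sub>2\<in>B. \<exists>q\<^sub>2\<in>C. p\<^sub>1 < q\<^sub>1 \<and> q\<^sub>1 < p\<^sub>2 \<and> p\<^sub>2 < q\<^sub>2))"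

definition NC :: "nat \<Rightarrow> nat set set set"
  where "NC n = {L. noncrossing {1..n} L}"

definition nested :: "nat set \<Rightarrow> nat set \<Rightarrow> bool"
  where "nested B C \<longleftrightarrow> (\<forall>m\<in>B. Min C < m \<and> m < Max C)"

text \<open>The sets \<open>Q\<close> of blocks for which the decomposition of \<open>L\<close> into \<open>Q\<close> and \<open>L - Q\<close> is admissible.\<close>

definition admissible :: "nat set set \<Rightarrow> nat set set set"
  where "admissible L = {Q. Q \<subseteq> L \<and> \<not> (\<exists>B\<in>Q. \<exists>C\<in>L - Q. nested B C)}"

text \<open>
  The maximal sets of consecutive integers in \<open>X\<close>, from left to right: each one is determined by
  its least element, which is an element of \<open>X\<close> whose predecessor is not in \<open>X\<close>.
\<close>

definition intervals :: "nat set \<Rightarrow> nat set list"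
  where "intervals X =
    map (\<lambda>i. {j. i \<le> j \<and> {i..j} \<subseteq> X}) (sorted_list_of_set {i \<in> X. \<forall>j\<in>X. i \<noteq> Suc j})"

text \<open>Transport of a partition along the increasing bijection of \<open>\<Union>P\<close> onto \<open>{1..card (\<Union>P)}\<close>.\<close>

definition st :: "nat set set \<Rightarrow> nat set set"
  where "st P = (\<lambda>B. (\<lambda>x. card {y \<in> \<Union>P. y \<le> x}) ` B) ` P"

text \<open>The subword \<open>a\<^sub>S\<close> of \<open>a\<^sub>1 \<cdots> a\<^sub>n\<close>; positions count from \<open>1\<close>, list indices from \<open>0\<close>.\<close>

definition subword :: "'a list \<Rightarrow> nat set \<Rightarrow> 'a list"
  where "subword as S = nths as {i. Suc i \<in> S}"


section \<open>The tensor algebra over decorated non-crossing partitions\<close>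

type_synonym ('k, 'a) nca = "nat set set \<Rightarrow>\<^sub>0 ('a list \<Rightarrow>\<^sub>0 'k)"
type_synonym ('k, 'a) tnc = "('k, 'a) nca list \<Rightarrow>\<^sub>0 'k"

abbreviation nscale :: "'k::field \<Rightarrow> ('k, 'a) nca \<Rightarrow> ('k, 'a) nca"
  where "nscale \<equiv> pscale fscale"

text \<open>
  As the set \<open>NC n\<close> is a basis of its linear span, the tensor product of this span with the
  \<open>n\<close>-th tensor power of \<open>A\<close> is a direct sum of copies of that tensor power indexed by \<open>NC n\<close>.
\<close>

definition NCA :: "('k::field \<Rightarrow> 'a::ab_group_add \<Rightarrow> 'a) \<Rightarrow> ('k, 'a) nca set"
  where "NCA sc = {f. \<forall>L \<in> Poly_Mapping.keys f.
    \<exists>n\<ge>1. L \<in> NC n \<and> Poly_Mapping.lookup f L \<in> tpower sc UNIV n}"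

text \<open>The decorated partition \<open>L \<otimes> a\<^sub>1 \<cdots> a\<^sub>n\<close>.\<close>

definition dec ::
    "('k::field \<Rightarrow> 'a::ab_group_add \<Rightarrow> 'a) \<Rightarrow> nat set set \<times> 'a list \<Rightarrow> ('k, 'a) nca"
  where "dec sc = (\<lambda>(L, as). Poly_Mapping.single L (ten sc UNIV as))"

definition dec_index :: "(nat set set \<times> 'a list) set"
  where "dec_index = {(L, as). length as \<ge> 1 \<and> L \<in> NC (length as)}"

text \<open>The bar word \<open>w\<^sub>1 | \<cdots> | w\<^sub>k\<close>.\<close>

abbreviation bar ::
    "('k::field \<Rightarrow> 'a::ab_group_add \<Rightarrow> 'a) \<Rightarrow> ('k, 'a) nca list \<Rightarrow> ('k, 'a) tnc"
  where "bar sc \<equiv> ten nscale (NCA sc)"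

definition TNC :: "('k::field \<Rightarrow> 'a::ab_group_add \<Rightarrow> 'a) \<Rightarrow> ('k, 'a) tnc set"
  where "TNC sc = talg nscale (NCA sc)"

definition TNC_plus :: "('k::field \<Rightarrow> 'a::ab_group_add \<Rightarrow> 'a) \<Rightarrow> ('k, 'a) tnc set"
  where "TNC_plus sc = talg_plus nscale (NCA sc)"

definition TNC_mult ::
    "('k::field \<Rightarrow> 'a::ab_group_add \<Rightarrow> 'a) \<Rightarrow> ('k, 'a) tnc \<Rightarrow> ('k, 'a) tnc \<Rightarrow> ('k, 'a) tnc"
  where "TNC_mult sc = tconc nscale (NCA sc)"

definition TNC_one :: "('k::field \<Rightarrow> 'a::ab_group_add \<Rightarrow> 'a) \<Rightarrow> ('k, 'a) tnc"
  where "TNC_one sc = bar sc []"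

definition TNC_counit :: "('k::field \<Rightarrow> 'a::ab_group_add \<Rightarrow> 'a) \<Rightarrow> ('k, 'a) tnc \<Rightarrow> 'k"
  where "TNC_counit sc = tcounit nscale (NCA sc)"

abbreviation TNC_ten2 ::
    "('k::field \<Rightarrow> 'a::ab_group_add \<Rightarrow> 'a) \<Rightarrow> ('k, 'a) tnc \<times> ('k, 'a) tnc \<Rightarrow> (('k, 'a) tnc list \<Rightarrow>\<^sub>0 'k)"
  where "TNC_ten2 sc \<equiv> ten2 fscale (TNC sc)"

abbreviation TNC_mult2 ::
    "('k::field \<Rightarrow> 'a::ab_group_add \<Rightarrow> 'a) \<Rightarrow>
     (('k, 'a) tnc list \<Rightarrow>\<^sub>0 'k) \<Rightarrow> (('k, 'a) tnc list \<Rightarrow>\<^sub>0 'k) \<Rightarrow> (('k, 'a) tnc list \<Rightarrow>\<^sub>0 'k)"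
  where "TNC_mult2 sc \<equiv> tsquare_mult fscale (TNC sc) (TNC_mult sc)"

text \<open>The summand of the coproduct of \<open>L \<otimes> as\<close> for the decomposition of \<open>L\<close> into \<open>Q\<close> and \<open>L - Q\<close>.\<close>

definition coprod_term ::
    "('k::field \<Rightarrow> 'a::ab_group_add \<Rightarrow> 'a) \<Rightarrow> nat set set \<Rightarrow> 'a list \<Rightarrow> nat set set \<Rightarrow>
     (('k, 'a) tnc list \<Rightarrow>\<^sub>0 'k)"
  where "coprod_term sc L as Q = TNC_ten2 sc
    (if Q = {} then TNC_one sc else bar sc [dec sc (st Q, subword as (\<Union>Q))],
     bar sc (map (\<lambda>J. dec sc (st {B \<in> L - Q. B \<subseteq> J}, subword as J))
       (intervals ({1..length as} - \<Union>Q))))"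

definition coprod_gen ::
    "('k::field \<Rightarrow> 'a::ab_group_add \<Rightarrow> 'a) \<Rightarrow> ('k, 'a) nca \<Rightarrow> (('k, 'a) tnc list \<Rightarrow>\<^sub>0 'k)"
  where "coprod_gen sc = lin_ext nscale fscale (dec sc) dec_index
    (\<lambda>(L, as). \<Sum>Q\<in>admissible L. coprod_term sc L as Q)"

definition prec_plus_gen ::
    "('k::field \<Rightarrow> 'a::ab_group_add \<Rightarrow> 'a) \<Rightarrow> ('k, 'a) nca \<Rightarrow> (('k, 'a) tnc list \<Rightarrow>\<^sub>0 'k)"
  where "prec_plus_gen sc = lin_ext nscale fscale (dec sc) dec_index
    (\<lambda>(L, as). \<Sum>Q | Q \<in> admissible L \<and> 1 \<in> \<Union>Q. coprod_term sc L as Q)"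

definition succ_plus_gen ::
    "('k::field \<Rightarrow> 'a::ab_group_add \<Rightarrow> 'a) \<Rightarrow> ('k, 'a) nca \<Rightarrow> (('k, 'a) tnc list \<Rightarrow>\<^sub>0 'k)"
  where "succ_plus_gen sc = lin_ext nscale fscale (dec sc) dec_index
    (\<lambda>(L, as). \<Sum>Q | Q \<in> admissible L \<and> 1 \<in> \<Union>(L - Q). coprod_term sc L as Q)"

definition coprod_word ::
    "('k::field \<Rightarrow> 'a::ab_group_add \<Rightarrow> 'a) \<Rightarrow> ('k, 'a) nca list \<Rightarrow> (('k, 'a) tnc list \<Rightarrow>\<^sub>0 'k)"
  where "coprod_word sc ws =
    foldr (\<lambda>w. TNC_mult2 sc (coprod_gen sc w)) ws (TNC_ten2 sc (TNC_one sc, TNC_one sc))"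

definition coprod ::
    "('k::field \<Rightarrow> 'a::ab_group_add \<Rightarrow> 'a) \<Rightarrow> ('k, 'a) tnc \<Rightarrow> (('k, 'a) tnc list \<Rightarrow>\<^sub>0 'k)"
  where "coprod sc = lin_ext fscale fscale (bar sc) (lists (NCA sc)) (coprod_word sc)"

definition prec_plus ::
    "('k::field \<Rightarrow> 'a::ab_group_add \<Rightarrow> 'a) \<Rightarrow> ('k, 'a) tnc \<Rightarrow> (('k, 'a) tnc list \<Rightarrow>\<^sub>0 'k)"
  where "prec_plus sc = lin_ext fscale fscale (bar sc) (lists (NCA sc) - {[]})
    (\<lambda>ws. TNC_mult2 sc (prec_plus_gen sc (hd ws)) (coprod_word sc (tl ws)))"

definition succ_plus ::
    "('k::field \<Rightarrow> 'a::ab_group_add \<Rightarrow> 'a) \<Rightarrow> ('k, 'a) tnc \<Rightarrow> (('k, 'a) tnc list \<Rightarrow>\<^sub>0 'k)"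
  where "succ_plus sc = lin_ext fscale fscale (bar sc) (lists (NCA sc) - {[]})
    (\<lambda>ws. TNC_mult2 sc (succ_plus_gen sc (hd ws)) (coprod_word sc (tl ws)))"

definition half_prec ::
    "('k::field \<Rightarrow> 'a::ab_group_add \<Rightarrow> 'a) \<Rightarrow> ('k, 'a) tnc \<Rightarrow> (('k, 'a) tnc list \<Rightarrow>\<^sub>0 'k)"
  where "half_prec sc x = prec_plus sc x - TNC_ten2 sc (x, TNC_one sc)"

definition half_succ ::
    "('k::field \<Rightarrow> 'a::ab_group_add \<Rightarrow> 'a) \<Rightarrow> ('k, 'a) tnc \<Rightarrow> (('k, 'a) tnc list \<Rightarrow>\<^sub>0 'k)"
  where "half_succ sc x = succ_plus sc x - TNC_ten2 sc (TNC_one sc, x)"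

end

theory Submission
  imports Defs "HOL-Library.Multiset"
begin

text \<open>
  On a single partition \<open>L\<close>, both iterated coproducts are sums over pairs \<open>Q' \<subseteq> Q\<close> of admissible
  sets of blocks: given \<open>Q'\<close>, the sets \<open>Q\<close> correspond to families of admissible subsets, one for
  each interval of the complement of \<open>Q'\<close>, because a block outside \<open>Q'\<close> lies in one interval.
  The intervals of the complement of \<open>Q'\<close> inside \<open>Q\<close> are the nonempty traces of \<open>Q\<close> on these
  intervals, and the intervals of the complement of \<open>Q\<close> are obtained by cutting them further.
  Which of \<open>Q'\<close>, \<open>Q - Q'\<close>, \<open>L - Q\<close> contains the first point decides to which half-coproducts a
  term belongs, so one bijection that keeps track of the first point yields coassociativity and,
      after
  discarding the terms with a trivial factor, the three half-coproduct identities.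
  Multiplicativity extends everything to bar words, and linearity to the tensor algebra.
\<close>

text \<open>All coefficients in the coproduct of a decorated partition are natural numbers. A
  coproduct is therefore stored as a multiset of pairs of words, and its identities become
  equalities of multisets, free of scalars and tensors. The way back to linear algebra has one real
  obstacle. The vectors \<open>dec sc (L, as)\<close> span the decorated partitions but are not
  independent, because pure tensors of decorations satisfy linear relations. A map prescribed on
  them exists only if the prescription respects these relations, and otherwise nothing is known
  about \<open>lin_ext\<close>. Respecting them rests on one observation: in a term of the coproduct
  each decoration occurs in exactly one letter of exactly one factor. Once existence is settled, no
  independence is ever used: two linear maps are compared on words, which span.\<close>

lemma sum_mset_sum_mset:
  fixes f :: "'a \<Rightarrow> 'b::comm_monoid_add multiset"
  shows "\<Sum>\<^sub># (\<Sum>x\<in>#M. f x) = (\<Sum>x\<in>#M. \<Sum>\<^sub># (f x))"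
  by (induction M) simp_all

lemma image_mset_bind:
  fixes f :: "'a \<Rightarrow> 'b multiset"
  shows "image_mset h (\<Sum>x\<in>#M. f x) = (\<Sum>x\<in>#M. image_mset h (f x))"
  by (induction M) simp_all

lemma filter_mset_bind:
  fixes f :: "'a \<Rightarrow> 'b multiset"
  shows "filter_mset P (\<Sum>x\<in>#M. f x) = (\<Sum>x\<in>#M. filter_mset P (f x))"
  by (induction M) simp_all

lemma filter_mset_image:
  "filter_mset P (image_mset f M) = image_mset f (filter_mset (\<lambda>x. P (f x)) M)"
  by (induction M) simp_all

lemma sum_mset_filter:
  fixes f :: "'a \<Rightarrow> 'b::comm_monoid_add"
  assumes "\<And>x. x \<in># M \<Longrightarrow> \<not> P x \<Longrightarrow> f x = 0"
  shows "(\<Sum>x\<in>#filter_mset P M. f x) = (\<Sum>x\<in>#M. f x)"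
  using assms by (induction M) auto

lemma sum_mset_cong:
  "(\<And>x. x \<in># M \<Longrightarrow> f x = g x) \<Longrightarrow> (\<Sum>x\<in>#M. f x) = (\<Sum>x\<in>#M. g x)"
  by (rule arg_cong[where f = sum_mset]) (rule image_mset_cong)

lemma in_bind_mset:
  fixes f :: "'a \<Rightarrow> 'b multiset"
  shows "y \<in># (\<Sum>x\<in>#M. f x) \<longleftrightarrow> (\<exists>x\<in>#M. y \<in># f x)"
  by (induction M) auto

section \<open>Coproducts on words\<close>

text \<open>
  A coproduct of a word, as the multiset of its terms; the tag of a term records whether the
  first point of the first letter goes to the left factor.
\<close>

type_synonym 'g tagged_cop = "(bool \<times> 'g list \<times> 'g list) multiset"

abbreviation lft :: "'a \<times> 'b \<times> 'c \<Rightarrow> 'b" where "lft x \<equiv> fst (snd x)"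
abbreviation rgt :: "'a \<times> 'b \<times> 'c \<Rightarrow> 'c" where "rgt x \<equiv> snd (snd x)"

fun word_cop :: "('g \<Rightarrow> 'g tagged_cop) \<Rightarrow> 'g list \<Rightarrow> 'g tagged_cop"
  where "word_cop C [] = {#(False, [], [])#}"
  | "word_cop C (g # gs) = (\<Sum>x\<in>#C g. image_mset
      (\<lambda>y. (fst x, lft x @ lft y, rgt x @ rgt y)) (word_cop C gs))"

text \<open>The factor, \<open>0\<close>, \<open>1\<close> or \<open>2\<close>, of an iterated coproduct that receives the first point.\<close>

definition tag_left :: "bool \<Rightarrow> bool \<Rightarrow> nat"
  where "tag_left t t' = (if \<not> t then 2 else if \<not> t' then 1 else 0)"

definition tag_right :: "bool \<Rightarrow> bool \<Rightarrow> nat"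
  where "tag_right t t' = (if t then 0 else if t' then 1 else 2)"

text \<open>\<open>D\<close> is a parameter because full, reduced and tag-filtered coproducts all
  get iterated. The last three components are the factors of the threefold tensor product in their
  order.\<close>

definition cop_left :: "('g list \<Rightarrow> 'g tagged_cop) \<Rightarrow> 'g tagged_cop \<Rightarrow> (nat \<times> 'g list \<times> 'g list \<times> 'g
    list) multiset"
  where "cop_left D M = (\<Sum>x\<in>#M. image_mset
    (\<lambda>y. (tag_left (fst x) (fst y), lft y, rgt y, rgt x)) (D (lft x)))"

definition cop_right :: "('g list \<Rightarrow> 'g tagged_cop) \<Rightarrow> 'g tagged_cop \<Rightarrow> (nat \<times> 'g list \<times> 'g list \<times> 'g
    list) multiset"
  where "cop_right D M = (\<Sum>x\<in>#M. image_mset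
    (\<lambda>y. (tag_right (fst x) (fst y), lft x, lft y, rgt y)) (D (rgt x)))"

lemmas bind_simps = sum_mset_sum_mset image_mset_bind filter_mset_bind
  image_mset.compositionality comp_def

text \<open>The case distinction arises because the empty word carries the conventional tag
  \<open>False\<close>, while the tag of a nonempty word is that of its first letter.\<close>

lemma word_cop_append:
  "word_cop C (a @ b) = (\<Sum>x\<in>#word_cop C a. image_mset
    (\<lambda>y. (if a = [] then fst y else fst x, lft x @ lft y, rgt x @ rgt y))
    (word_cop C b))"
  by (induction a) (simp_all add: bind_simps)

lemma word_cop_single: "word_cop C [g] = C g"
  by (simp add: bind_simps)

definition reduced :: "'g tagged_cop \<Rightarrow> 'g tagged_cop"
  where "reduced M = filter_mset (\<lambda>x. lft x \<noteq> [] \<and> rgt x \<noteq> []) M"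

text \<open>The properties of letters from which everything about words follows by multiplicativity.
  \<open>left_trivial\<close> and \<open>right_trivial\<close> are the counit laws, and
  \<open>tag_leg\<close> says that the factor receiving the first point is not the unit.\<close>

locale letter_coproduct =
  fixes G :: "'g set" and C :: "'g \<Rightarrow> 'g tagged_cop"
  assumes legs_closed: "g \<in> G \<Longrightarrow> (t, l, r) \<in># C g \<Longrightarrow> l \<in> lists G \<and> r \<in> lists G"
    and tag_leg: "g \<in> G \<Longrightarrow> (t, l, r) \<in># C g \<Longrightarrow> (if t then l else r) \<noteq> []"
    and left_trivial: "g \<in> G \<Longrightarrow> filter_mset (\<lambda>x. lft x = []) (C g) = {#(False, [], [g])#}"
    and right_trivial: "g \<in> G \<Longrightarrow> filter_mset (\<lambda>x. rgt x = []) (C g) = {#(True, [g], [])#}"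
    and letter_coassoc: "g \<in> G \<Longrightarrow>
      cop_left (word_cop C) (C g) = cop_right (word_cop C) (C g)"
begin

lemma word_legs_closed:
  "w \<in> lists G \<Longrightarrow> x \<in># word_cop C w \<Longrightarrow> lft x \<in> lists G \<and> rgt x \<in> lists G"
proof (induction w arbitrary: x)
  case (Cons g w)
  then obtain y z where "y \<in># C g" "z \<in># word_cop C w"
    "x = (fst y, lft y @ lft z, rgt y @ rgt z)"
    by (auto simp: in_bind_mset)
  with Cons.IH[of z] Cons.prems legs_closed[of g "fst y" "lft y" "rgt y"]
  show ?case by simp
qed simp

lemma word_tag_leg:
  assumes "w \<in> lists G" "w \<noteq> []" "x \<in># word_cop C w"
  shows "(if fst x then lft x else rgt x) \<noteq> []"
proof -
  obtain g v where "w = g # v" using assms(2) by (cases w) auto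
  with assms obtain y z where "y \<in># C g" "z \<in># word_cop C v" "g \<in> G"
    "x = (fst y, lft y @ lft z, rgt y @ rgt z)"
    by (auto simp: in_bind_mset)
  with tag_leg[of g "fst y" "lft y" "rgt y"] show ?thesis by (auto split: if_splits)
qed

text \<open>Iterated coproducts inherit multiplicativity, and the tag is supplied by the letter
  \<open>g\<close> alone. This reduces coassociativity on words to coassociativity on
  letters.\<close>

lemma cop_left_Cons:
  assumes "g \<in> G"
  shows "cop_left (word_cop C) (word_cop C (g # w)) =
    (\<Sum>x\<in>#cop_left (word_cop C) (C g). image_mset
      (\<lambda>y. (fst x, lft x @ lft y, fst (rgt x) @ fst (rgt y),
         snd (rgt x) @ snd (rgt y))) (cop_left (word_cop C) (word_cop C w)))"
proof -
  \<comment> \<open>An empty left leg forces the tag of the letter to be \<open>False\<close> by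
    \<open>tag_leg\<close>, and then \<open>tag_left\<close> ignores the inner tag. The case split
    of \<open>word_cop_append\<close> thus has no effect.\<close>
  have tag: "tag_left (fst x) (if lft x = [] then a else b) = tag_left (fst x) b"
    if "x \<in># C g" for x a b
    using tag_leg[OF assms, of "fst x" "lft x" "rgt x"] that
    by (auto simp: tag_left_def)
  show ?thesis
    unfolding cop_left_def bind_simps word_cop_append word_cop.simps fst_conv snd_conv
    \<comment> \<open>For a fixed term of \<open>g\<close>, one side picks a term of
      \<open>w\<close> before splitting the left leg of \<open>g\<close>, the other side after
      it.\<close>
    by (rule sum_mset_cong) (simp only: tag, rule sum_mset.swap)
qed

lemma cop_right_Cons:
  assumes "g \<in> G"
  shows "cop_right (word_cop C) (word_cop C (g # w)) =
    (\<Sum>x\<in>#cop_right (word_cop C) (C g). image_mset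
      (\<lambda>y. (fst x, lft x @ lft y, fst (rgt x) @ fst (rgt y),
         snd (rgt x) @ snd (rgt y))) (cop_right (word_cop C) (word_cop C w)))"
proof -
  \<comment> \<open>Mirror image: an empty right leg forces the tag \<open>True\<close>, and then
    \<open>tag_right\<close> is \<open>0\<close> whatever the inner tag is.\<close>
  have tag: "tag_right (fst x) (if rgt x = [] then a else b) = tag_right (fst x) b"
    if "x \<in># C g" for x a b
    using tag_leg[OF assms, of "fst x" "lft x" "rgt x"] that
    by (auto simp: tag_right_def split: if_splits)
  show ?thesis
    unfolding cop_right_def bind_simps word_cop_append word_cop.simps fst_conv snd_conv
    by (rule sum_mset_cong) (simp only: tag, rule sum_mset.swap)
qed

lemma word_coassoc:
  "w \<in> lists G \<Longrightarrow>
    cop_left (word_cop C) (word_cop C w) = cop_right (word_cop C) (word_cop C w)"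
proof (induction w)
  case Nil
  show ?case by (simp add: cop_left_def cop_right_def tag_left_def tag_right_def)
next
  case (Cons g w)
  then show ?case
    by (simp only: cop_left_Cons cop_right_Cons letter_coassoc Cons_in_lists_iff)
qed

text \<open>A left leg of a word is a concatenation of left legs of its letters, so it is empty only
  if all of them are, and each letter has exactly one such term.\<close>

lemma word_left_trivial:
  "w \<in> lists G \<Longrightarrow> filter_mset (\<lambda>x. lft x = []) (word_cop C w) = {#(False, [], w)#}"
proof (induction w)
  case (Cons g w)
  have "filter_mset (\<lambda>x. lft x = []) (word_cop C (g # w)) =
    (\<Sum>x\<in>#C g. image_mset (\<lambda>y. (fst x, lft x @ lft y, rgt x @ rgt y))
      (filter_mset (\<lambda>y. lft x = [] \<and> lft y = []) (word_cop C w)))"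
    by (simp add: filter_mset_bind filter_mset_image)
  also have "\<dots> = (\<Sum>x\<in>#filter_mset (\<lambda>x. lft x = []) (C g).
    image_mset (\<lambda>y. (fst x, lft x @ lft y, rgt x @ rgt y))
      (filter_mset (\<lambda>y. lft x = [] \<and> lft y = []) (word_cop C w)))"
    by (rule sum_mset_filter[symmetric]) simp
  finally show ?case using Cons left_trivial[of g] by simp
qed simp

lemma word_right_trivial:
  "w \<in> lists G \<Longrightarrow> filter_mset (\<lambda>x. rgt x = []) (word_cop C w) = {#(w \<noteq> [], w, [])#}"
proof (induction w)
  case (Cons g w)
  have "filter_mset (\<lambda>x. rgt x = []) (word_cop C (g # w)) =
    (\<Sum>x\<in>#C g. image_mset (\<lambda>y. (fst x, lft x @ lft y, rgt x @ rgt y))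
      (filter_mset (\<lambda>y. rgt x = [] \<and> rgt y = []) (word_cop C w)))"
    by (simp add: filter_mset_bind filter_mset_image)
  also have "\<dots> = (\<Sum>x\<in>#filter_mset (\<lambda>x. rgt x = []) (C g).
    image_mset (\<lambda>y. (fst x, lft x @ lft y, rgt x @ rgt y))
      (filter_mset (\<lambda>y. rgt x = [] \<and> rgt y = []) (word_cop C w)))"
    by (rule sum_mset_filter[symmetric]) simp
  finally show ?case using Cons right_trivial[of g] by simp
qed simp

text \<open>The empty word splits into empty words only. Three nonempty factors therefore come from
  a leg that was nonempty before it was split, and filtering at the end amounts to reduced
  coproducts at both stages.\<close>

lemma reduced_cop_left:
  "filter_mset (\<lambda>x. lft x \<noteq> [] \<and> fst (rgt x) \<noteq> [] \<and> snd (rgt x) \<noteq> [])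
     (cop_left (word_cop C) M) = cop_left (\<lambda>w. reduced (word_cop C w)) (reduced M)"
proof -
  have *: "filter_mset (\<lambda>y. lft y \<noteq> [] \<and> rgt y \<noteq> [] \<and> r \<noteq> []) (word_cop C l) =
    (if l \<noteq> [] \<and> r \<noteq> [] then reduced (word_cop C l) else {#})" for l r
    by (auto simp: reduced_def)
  show ?thesis
    unfolding cop_left_def reduced_def[of M] filter_mset_bind filter_mset_image
    by (subst sum_mset_filter[symmetric, where P = "\<lambda>x. lft x \<noteq> [] \<and> rgt x \<noteq> []"])
      (auto simp: * intro!: sum_mset_cong)
qed

lemma reduced_cop_right:
  "filter_mset (\<lambda>x. lft x \<noteq> [] \<and> fst (rgt x) \<noteq> [] \<and> snd (rgt x) \<noteq> [])
     (cop_right (word_cop C) M) = cop_right (\<lambda>w. reduced (word_cop C w)) (reduced M)"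
proof -
  have *: "filter_mset (\<lambda>y. l \<noteq> [] \<and> lft y \<noteq> [] \<and> rgt y \<noteq> []) (word_cop C r) =
    (if l \<noteq> [] \<and> r \<noteq> [] then reduced (word_cop C r) else {#})" for l r
    by (auto simp: reduced_def)
  show ?thesis
    unfolding cop_right_def reduced_def[of M] filter_mset_bind filter_mset_image
    by (subst sum_mset_filter[symmetric, where P = "\<lambda>x. lft x \<noteq> [] \<and> rgt x \<noteq> []"])
      (auto simp: * intro!: sum_mset_cong)
qed

lemma reduced_coassoc:
  "w \<in> lists G \<Longrightarrow> cop_left (\<lambda>w. reduced (word_cop C w)) (reduced (word_cop C w)) =
    cop_right (\<lambda>w. reduced (word_cop C w)) (reduced (word_cop C w))"
  by (simp only: reduced_cop_left[symmetric] reduced_cop_right[symmetric] word_coassoc)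

text \<open>Combinatorial form of the passage from the left half-coproduct to its completion by w
  \<otimes> 1. A term tagged \<open>True\<close> has a nonempty left leg, so the only unreduced one
  among these is the trivial term.\<close>

lemma word_cop_prec:
  assumes "w \<in> lists G" "w \<noteq> []"
  shows "filter_mset fst (word_cop C w) = add_mset (True, w, [])
      (filter_mset fst (reduced (word_cop C w)))"
proof -
  have "filter_mset fst (word_cop C w) =
    filter_mset fst (filter_mset (\<lambda>x. rgt x = []) (word_cop C w)) +
    filter_mset fst (filter_mset (\<lambda>x. rgt x \<noteq> []) (word_cop C w))"
    by (metis filter_union_mset multiset_partition)
  also have "filter_mset fst (filter_mset (\<lambda>x. rgt x \<noteq> []) (word_cop C w)) =
    filter_mset fst (reduced (word_cop C w))"
    unfolding reduced_def filter_filter_mset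
  proof (rule filter_mset_cong)
    fix x assume "x \<in># word_cop C w"
    from word_tag_leg[OF assms this]
    show "(rgt x \<noteq> [] \<and> fst x) = ((lft x \<noteq> [] \<and> rgt x \<noteq> []) \<and> fst x)" by (cases "fst x") auto
  qed simp
  finally show ?thesis by (simp add: word_right_trivial assms)
qed

text \<open>As for \<open>word_cop_prec\<close>, but with the tag \<open>False\<close>, which makes
  the right leg nonempty.\<close>

lemma word_cop_succ:
  assumes "w \<in> lists G" "w \<noteq> []"
  shows "filter_mset (\<lambda>x. \<not> fst x) (word_cop C w) =
    add_mset (False, [], w) (filter_mset (\<lambda>x. \<not> fst x) (reduced (word_cop C w)))"
proof -
  have "filter_mset (\<lambda>x. \<not> fst x) (word_cop C w) =
    filter_mset (\<lambda>x. \<not> fst x) (filter_mset (\<lambda>x. lft x = []) (word_cop C w)) +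
    filter_mset (\<lambda>x. \<not> fst x) (filter_mset (\<lambda>x. lft x \<noteq> []) (word_cop C w))"
    by (metis filter_union_mset multiset_partition)
  also have "filter_mset (\<lambda>x. \<not> fst x) (filter_mset (\<lambda>x. lft x \<noteq> []) (word_cop C w)) =
    filter_mset (\<lambda>x. \<not> fst x) (reduced (word_cop C w))"
    unfolding reduced_def filter_filter_mset
  proof (rule filter_mset_cong)
    fix x assume "x \<in># word_cop C w"
    from word_tag_leg[OF assms this]
    show "(lft x \<noteq> [] \<and> \<not> fst x) = ((lft x \<noteq> [] \<and> rgt x \<noteq> []) \<and> \<not> fst x)" by (cases "fst x") auto
  qed simp
  finally show ?thesis by (simp add: word_left_trivial assms)
qed

end

section \<open>Maximal runs in a list\<close>

text \<open>Adjacency refers to positions in the list and not to integers. In this form the cutting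
  can be repeated inside an arbitrary union of blocks; on \<open>[1..<Suc n]\<close> it agrees with
  \<open>intervals\<close>.\<close>

function runs :: "('a \<Rightarrow> bool) \<Rightarrow> 'a list \<Rightarrow> 'a list list"
  where "runs P [] = []"
  | "runs P (x # xs) =
      (if P x then (x # takeWhile P xs) # runs P (dropWhile P xs) else runs P xs)"
  by pat_completeness auto
termination
  by (relation "measure (\<lambda>(P, xs). length xs)") (simp_all add: le_imp_less_Suc length_dropWhile_le)

lemma runs_cong: "(\<And>x. x \<in> set xs \<Longrightarrow> P x = Q x) \<Longrightarrow> runs P xs = runs Q xs"
proof (induction P xs rule: runs.induct)
  case (2 P x xs)
  have "takeWhile P xs = takeWhile Q xs" "dropWhile P xs = dropWhile Q xs"
    using 2(3) by (auto intro!: takeWhile_cong dropWhile_cong)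
  moreover have "runs P (dropWhile P xs) = runs Q (dropWhile P xs)" if "P x"
    using that 2(3) by (intro 2(1)) (auto dest: set_dropWhileD)
  ultimately show ?case using 2 by auto
qed simp

text \<open>The hypothesis keeps a run of \<open>xs\<close> from continuing into
  \<open>ys\<close>.\<close>

lemma runs_append:
  "ys = [] \<or> \<not> P (hd ys) \<Longrightarrow> runs P (xs @ ys) = runs P xs @ runs P ys"
proof (induction P xs rule: runs.induct)
  case (2 P x xs)
  show ?case
  proof (cases "\<forall>y\<in>set xs. P y")
    case True
    with 2(3) have 1: "takeWhile P (xs @ ys) = xs" "dropWhile P (xs @ ys) = ys"
      by (cases ys; simp)+
    from True have "takeWhile P xs = xs" "dropWhile P xs = []" by auto
    note [simp] = 1 this
    show ?thesis using 2(2,3) by simp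
  next
    case False
    then have "takeWhile P (xs @ ys) = takeWhile P xs"
      "dropWhile P (xs @ ys) = dropWhile P xs @ ys"
      by (auto simp: takeWhile_append dropWhile_append)
    then show ?thesis using 2 by simp
  qed
qed simp

lemma runs_all: "(\<And>x. x \<in> set xs \<Longrightarrow> P x) \<Longrightarrow> runs P xs = (if xs = [] then [] else [xs])"
  by (cases xs) (auto simp: takeWhile_eq_all_conv[THEN iffD2] dropWhile_eq_Nil_conv[THEN iffD2])

lemma dropWhile_Nil_or_hd: "dropWhile P xs = [] \<or> \<not> P (hd (dropWhile P xs))"
  by (metis hd_dropWhile)

text \<open>Inside a run of \<open>P\<close> the conjunction reduces to \<open>Q\<close>, and a
  point violating \<open>P\<close> separates runs on both sides. This yields the agreement of the
  last factors of the two iterated coproducts.\<close>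

lemma runs_conj: "runs (\<lambda>x. P x \<and> Q x) xs = concat (map (runs Q) (runs P xs))"
proof (induction P xs rule: runs.induct)
  case (2 P x xs)
  show ?case
  proof (cases "P x")
    case True
    have "runs (\<lambda>x. P x \<and> Q x) ((x # takeWhile P xs) @ dropWhile P xs) =
      runs (\<lambda>x. P x \<and> Q x) (x # takeWhile P xs) @ runs (\<lambda>x. P x \<and> Q x) (dropWhile P xs)"
      by (rule runs_append) (use dropWhile_Nil_or_hd[of P xs] in auto)
    moreover have "runs (\<lambda>x. P x \<and> Q x) (x # takeWhile P xs) = runs Q (x # takeWhile P xs)"
      by (rule runs_cong) (use True in \<open>auto dest: set_takeWhileD\<close>)
    ultimately show ?thesis using 2(1)[OF True] True by (simp del: runs.simps(2) add:
        runs.simps(2)[of P])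
  qed (use 2 in simp)
qed simp

text \<open>Only points satisfying \<open>P\<close> may be deleted, so every separator survives and
  no two runs merge. A run can only shrink, possibly to nothing. This describes the middle factor of
  an iterated coproduct.\<close>

lemma runs_filter:
  "(\<And>x. x \<in> set xs \<Longrightarrow> \<not> P x \<Longrightarrow> R x) \<Longrightarrow>
    runs P (filter R xs) = filter (\<lambda>ys. ys \<noteq> []) (map (filter R) (runs P xs))"
proof (induction P xs rule: runs.induct)
  case (2 P x xs)
  show ?case
  proof (cases "P x")
    case True
    define t d where "t = x # takeWhile P xs" and "d = dropWhile P xs"
    have td: "x # xs = t @ d" by (simp add: t_def d_def)
    have d: "d = [] \<or> \<not> P (hd d)" unfolding d_def by (rule dropWhile_Nil_or_hd)
    have "filter R d = [] \<or> \<not> P (hd (filter R d))"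
    proof (cases d)
      case (Cons y ys)
      moreover have "y \<in> set (x # xs)" unfolding td Cons by simp
      ultimately show ?thesis using d 2(3)[of y] by simp
    qed simp
    then have "runs P (filter R (x # xs)) = runs P (filter R t) @ runs P (filter R d)"
      unfolding td filter_append by (rule runs_append)
    also have "runs P (filter R t) = filter (\<lambda>ys. ys \<noteq> []) [filter R t]"
      by (subst runs_all) (auto simp: t_def True dest: set_takeWhileD split: if_splits)
    also have "runs P (filter R d) = filter (\<lambda>ys. ys \<noteq> []) (map (filter R) (runs P d))"
      unfolding d_def by (rule 2(1)[OF True]) (use 2(3) in \<open>auto dest: set_dropWhileD\<close>)
    finally show ?thesis using True by (simp add: t_def d_def del: filter.simps(2)) simp
  qed (use 2 in simp)
qed simp

lemma runs_map: "runs P (map f xs) = map (map f) (runs (\<lambda>x. P (f x)) xs)"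
proof (induction "\<lambda>x. P (f x)" xs rule: runs.induct)
  case (2 x xs)
  then show ?case by (simp add: takeWhile_map dropWhile_map comp_def)
qed simp

lemma concat_runs: "concat (runs P xs) = filter P xs"
proof (induction P xs rule: runs.induct)
  case (2 P x xs)
  have "filter P xs = takeWhile P xs @ filter P (dropWhile P xs)"
    by (metis filter_append filter_True takeWhile_dropWhile_id set_takeWhileD)
  with 2 show ?case by simp
qed simp

lemma in_runs:
  "K \<in> set (runs P xs) \<Longrightarrow> K \<noteq> [] \<and> (\<forall>x\<in>set K. P x) \<and>
    (\<exists>us vs. xs = us @ K @ vs \<and> (us = [] \<or> \<not> P (last us)) \<and> (vs = [] \<or> \<not> P (hd vs)))"
proof (induction P xs rule: runs.induct)
  case (2 P x xs)
  show ?case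
  proof (cases "P x")
    case True
    with 2(3) consider "K = x # takeWhile P xs" | "K \<in> set (runs P (dropWhile P xs))" by auto
    then show ?thesis
    proof cases
      case 1
      have "x # xs = [] @ K @ dropWhile P xs" by (simp add: 1)
      moreover have "K \<noteq> []" "\<forall>x\<in>set K. P x" using 1 True by (auto dest: set_takeWhileD)
      ultimately show ?thesis using dropWhile_Nil_or_hd[of P xs] by blast
    next
      case 2
      from "2.IH"(1)[OF True this] obtain us vs where *: "K \<noteq> []" "\<forall>x\<in>set K. P x"
        "dropWhile P xs = us @ K @ vs" "us = [] \<or> \<not> P (last us)" "vs = [] \<or> \<not> P (hd vs)"
        by blast
      \<comment> \<open>If \<open>us\<close> were empty, the remainder would start with
        \<open>K\<close>, but its head violates \<open>P\<close>. Hence \<open>last us\<close> stays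
        the point before \<open>K\<close> when the prefix is enlarged.\<close>
      have "us \<noteq> []" using *(1,2,3) dropWhile_Nil_or_hd[of P xs] by (cases K) auto
      moreover have "x # xs = ((x # takeWhile P xs) @ us) @ K @ vs"
        using *(3) takeWhile_dropWhile_id[of P xs] by simp
      ultimately show ?thesis using * by (metis last_append)
    qed
  next
    case False
    with "2.IH"(2)[OF False] 2(3) obtain us vs where *: "K \<noteq> []" "\<forall>x\<in>set K. P x"
        "xs = us @ K @ vs" "us = [] \<or> \<not> P (last us)" "vs = [] \<or> \<not> P (hd vs)"
        by auto
    then have "x # xs = (x # us) @ K @ vs" "\<not> P (last (x # us))" using False by auto
    with * show ?thesis by blast
  qed
qed simp

lemma runs_contiguous:
  assumes "sorted_wrt (<) (xs :: nat list)" "K \<in> set (runs P xs)" "a \<in> set K" "b \<in> set K"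
    "c \<in> set xs" "a \<le> c" "c \<le> b"
  shows "c \<in> set K"
proof -
  from in_runs[OF assms(2)] obtain us vs where "xs = us @ K @ vs" by blast
  with assms(1,3,4,5) consider "c < a" | "b < c" | "c \<in> set K"
    by (auto simp: sorted_wrt_append)
  then show ?thesis using assms(6,7) by cases auto
qed

text \<open>If \<open>b\<close> lay outside \<open>K\<close>, the neighbour of \<open>K\<close> on
  the side of \<open>b\<close> would lie between \<open>a\<close> and \<open>b\<close>, but by
  maximality this neighbour violates \<open>P\<close>.\<close>

lemma runs_maximal:
  assumes "sorted_wrt (<) (xs :: nat list)" "K \<in> set (runs P xs)" "a \<in> set K" "b \<in> set xs"
    "\<And>c. c \<in> set xs \<Longrightarrow> a < c \<and> c \<le> b \<or> b \<le> c \<and> c < a \<Longrightarrow> P c"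
  shows "b \<in> set K"
proof (rule ccontr)
  assume b: "b \<notin> set K"
  from in_runs[OF assms(2)] obtain us vs where *: "xs = us @ K @ vs"
    "us = [] \<or> \<not> P (last us)" "vs = [] \<or> \<not> P (hd vs)" by blast
  from b assms(4) *(1) consider "b \<in> set us" | "b \<in> set vs" by auto
  then show False
  proof cases
    case 1
    then have "us \<noteq> []" by auto
    then have us: "us = butlast us @ [last us]" by simp
    have "sorted_wrt (<) us" using assms(1) *(1) by (simp add: sorted_wrt_append)
    then have "\<forall>x\<in>set (butlast us). x < last us" by (subst (asm) us) (simp add: sorted_wrt_append)
    moreover have "b \<in> set (butlast us) \<or> b = last us"
      using 1 by (subst (asm) us) auto
    ultimately have "b \<le> last us" by auto
    moreover have "last us < a" using assms(1,3) * \<open>us \<noteq> []\<close> by (simp add: sorted_wrt_append)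
    ultimately show False using assms(5)[of "last us"] * \<open>us \<noteq> []\<close> by auto
  next
    case 2
    then obtain v ws where vs: "vs = v # ws" by (cases vs) auto
    with assms(1,3) *(1) 2 have "a < v" "v \<le> b" by (auto simp: sorted_wrt_append)
    then show False using assms(5)[of v] * vs by auto
  qed
qed

lemma runs_subset: "K \<in> set (runs P xs) \<Longrightarrow> set K \<subseteq> set xs"
  using in_runs[of K P xs] by auto

lemma filter_in_run:
  assumes "distinct xs" "K \<in> set (runs P xs)"
  shows "filter (\<lambda>x. x \<in> set K) xs = K"
proof -
  from in_runs[OF assms(2)] obtain us vs where "xs = us @ K @ vs" by blast
  moreover from this assms(1)
  have "filter (\<lambda>x. x \<in> set K) us = []" "filter (\<lambda>x. x \<in> set K) vs = []"
    by (auto simp: filter_empty_conv)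
  ultimately show ?thesis by simp
qed

lemma runs_disjoint:
  assumes "distinct xs" "runs P xs = Ks @ K # Ks'" "K' \<in> set Ks \<union> set Ks'"
  shows "set K \<inter> set K' = {}"
proof -
  have "distinct (concat (Ks @ K # Ks'))"
    using assms(1) concat_runs[of P xs] by (simp add: assms(2)[symmetric])
  then show ?thesis using assms(3) by auto
qed

lemma hd_runs: "xs \<noteq> [] \<Longrightarrow> P (hd xs) \<Longrightarrow> runs P xs \<noteq> [] \<and> hd (hd (runs P xs)) = hd xs"
  by (cases xs) auto

lemma sorted_map_hd:
  "[] \<notin> set Ks \<Longrightarrow> sorted_wrt (<) (concat Ks :: nat list) \<Longrightarrow> sorted_wrt (<) (map hd Ks)"
proof (induction Ks)
  case (Cons K Ks)
  then have "hd K \<in> set K" "\<And>K'. K' \<in> set Ks \<Longrightarrow> hd K' \<in> set (concat Ks)"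
    by (auto, metis list.set_sel(1))
  with Cons show ?case by (auto simp: sorted_wrt_append)
qed simp

text \<open>The heads of the runs increase, and they are exactly the points of the set without a
  predecessor in it. So \<open>sorted_list_of_set\<close> enumerates the intervals in the order of
  the runs.\<close>

lemma intervals_eq_runs:
  "intervals {i \<in> {1..n}. P i} = map set (runs P [1..<Suc n])"
proof -
  define X where "X = {i \<in> {1..n}. P i}"
  define Ks where "Ks = runs P [1..<Suc n]"
  have ne: "[] \<notin> set Ks" using in_runs unfolding Ks_def by blast
  have "sorted_wrt (<) (concat Ks)"
    unfolding Ks_def concat_runs by (rule sorted_wrt_filter) (simp del: upt_Suc)
  then have sorted: "sorted_wrt (<) (map hd Ks)" by (rule sorted_map_hd[OF ne])
  have *: "hd K \<in> X \<and> (\<forall>j\<in>X. hd K \<noteq> Suc j) \<and> set K = {j. hd K \<le> j \<and> {hd K..j} \<subseteq> X}"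
    if K: "K \<in> set Ks" for K
  proof -
    from in_runs[OF K[unfolded Ks_def]] obtain us vs where
      **: "K \<noteq> []" "\<forall>x\<in>set K. P x" "[1..<Suc n] = us @ K @ vs"
        "us = [] \<or> \<not> P (last us)" "vs = [] \<or> \<not> P (hd vs)" by blast
    \<comment> \<open>The list starts at \<open>1\<close>, so a prefix of length l ends with the
      point l; \<open>q\<close> is the point after the run.\<close>
    define p q where "p = Suc (length us)" and "q = p + length K"
    have len: "n = length us + length K + length vs"
      using arg_cong[OF **(3), of length] by (simp del: upt_Suc)
    have us: "us = [1..<p]"
      using arg_cong[OF **(3), of "take (length us)"] len by (simp add: p_def del: upt_Suc)
    have KK: "K = [p..<q]"
      using arg_cong[OF **(3), of "\<lambda>x. take (length K) (drop (length us) x)"] len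
      by (simp add: p_def q_def del: upt_Suc)
    have vs: "vs = [q..<Suc n]"
      using arg_cong[OF **(3), of "\<lambda>x. drop (length K) (drop (length us) x)"] len
      by (simp add: p_def q_def add.commute add.left_commute del: upt_Suc)
    have pq: "p < q" using **(1) by (simp add: q_def)
    have hdK: "hd K = p" using pq by (subst KK) simp
    have "set K \<subseteq> set [1..<Suc n]" unfolding **(3) by auto
    then have "set K \<subseteq> X" using **(2) by (auto simp: X_def)
    then have KX: "{p..<q} \<subseteq> X" by (subst (asm) KK) simp
    \<comment> \<open>For \<open>j = 0\<close> the point is outside \<open>{1..n}\<close>; otherwise
      \<open>j\<close> is the last point of the prefix and violates \<open>P\<close>.\<close>
    have p1: "j \<notin> X" if "p = Suc j" for j
      using **(4) unfolding us that by (cases "j = 0") (auto simp: X_def)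
    have q: "q \<notin> X"
      using **(5) unfolding vs by (cases "q \<le> n") (simp_all add: X_def upt_conv_Cons del: upt_Suc)
    have "set K = {j. p \<le> j \<and> {p..j} \<subseteq> X}"
    proof (intro set_eqI iffI)
      fix j assume "j \<in> {j. p \<le> j \<and> {p..j} \<subseteq> X}"
      moreover have "j < q"
      proof (rule ccontr)
        assume "\<not> j < q"
        then have "q \<in> {p..j}" using pq by simp
        then show False using calculation q by blast
      qed
      ultimately show "j \<in> set K" by (subst KK) simp
    next
      fix j assume "j \<in> set K"
      then have "p \<le> j" "j < q" by (subst (asm) KK, simp)+
      then have "{p..j} \<subseteq> {p..<q}" by auto
      with KX \<open>p \<le> j\<close> show "j \<in> {j. p \<le> j \<and> {p..j} \<subseteq> X}" by blast
    qed
    then show ?thesis using p1 KX pq by (auto simp: hdK)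
  qed
  have "set (map hd Ks) = {i \<in> X. \<forall>j\<in>X. i \<noteq> Suc j}"
  proof (intro set_eqI iffI)
    fix i assume "i \<in> set (map hd Ks)"
    then show "i \<in> {i \<in> X. \<forall>j\<in>X. i \<noteq> Suc j}" using * by auto
  next
    fix i assume i: "i \<in> {i \<in> X. \<forall>j\<in>X. i \<noteq> Suc j}"
    then have "i \<in> set (concat Ks)" unfolding Ks_def concat_runs
      by (auto simp: X_def simp del: upt_Suc)
    then obtain K where K: "K \<in> set Ks" "i \<in> set K" by auto
    with *[OF K(1)] have hk: "hd K \<le> i" "{hd K..i} \<subseteq> X" by auto
    have "hd K = i"
    proof (rule ccontr)
      assume "hd K \<noteq> i"
      with hk have "i - 1 \<in> X" "i = Suc (i - 1)" by auto
      with i show False by blast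
    qed
    with K(1) show "i \<in> set (map hd Ks)" by auto
  qed
  then have "sorted_list_of_set {i \<in> X. \<forall>j\<in>X. i \<noteq> Suc j} = map hd Ks"
    using sorted by (metis sorted_list_of_set.idem_if_sorted_distinct strict_sorted_iff)
  then have "intervals X = map (\<lambda>K. {j. hd K \<le> j \<and> {hd K..j} \<subseteq> X}) Ks"
    unfolding intervals_def by simp
  also have "\<dots> = map set Ks" using * by simp
  finally show ?thesis by (simp only: X_def Ks_def)
qed

section \<open>Coassociativity on non-crossing partitions\<close>

lemma image_mset_sum: "image_mset h (sum f S) = (\<Sum>x\<in>S. image_mset h (f x))"
  by (induction S rule: infinite_finite_induct) simp_all

lemma sum_mset_sum_single:
  fixes h :: "'a \<Rightarrow> 'b::comm_monoid_add"
  shows "(\<Sum>x\<in>#(\<Sum>Q\<in>S. {#f Q#}). h x) = (\<Sum>Q\<in>S. h (f Q))"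
  by (induction S rule: infinite_finite_induct) simp_all

lemma filter_mset_sum_single:
  assumes "finite I"
  shows "filter_mset P (\<Sum>i\<in>I. {#f i#}) = (\<Sum>i | i \<in> I \<and> P (f i). {#f i#})"
  using assms
proof (induction I rule: finite_induct)
  case (insert i I)
  have "{j. j \<in> insert i I \<and> P (f j)} =
    (if P (f i) then insert i {j. j \<in> I \<and> P (f j)} else {j. j \<in> I \<and> P (f j)})" by auto
  with insert show ?case by simp
qed simp

text \<open>Expanding the product, a term of a word is a choice of one index for each letter.
  Collecting the choices in lists gives the index set needed to compare with families of admissible
  subsets.\<close>

lemma word_cop_eq_sum:
  assumes "\<And>g. g \<in> set gs \<Longrightarrow> C g = (\<Sum>Q\<in>A g. {#(t g Q, l g Q, r g Q)#})"
    "\<And>g. g \<in> set gs \<Longrightarrow> finite (A g)"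
  shows "finite {Qs. list_all2 (\<lambda>g Q. Q \<in> A g) gs Qs} \<and>
    word_cop C gs = (\<Sum>Qs | list_all2 (\<lambda>g Q. Q \<in> A g) gs Qs.
      {#(gs \<noteq> [] \<and> t (hd gs) (hd Qs), concat (map2 l gs Qs), concat (map2 r gs Qs))#})"
  using assms
proof (induction gs)
  case (Cons g gs)
  define T where "T = {Qs. list_all2 (\<lambda>g Q. Q \<in> A g) gs Qs}"
  have IH: "finite T" "word_cop C gs = (\<Sum>Qs\<in>T.
      {#(gs \<noteq> [] \<and> t (hd gs) (hd Qs), concat (map2 l gs Qs), concat (map2 r gs Qs))#})"
    using Cons unfolding T_def by auto
  have eq: "{Qs. list_all2 (\<lambda>g Q. Q \<in> A g) (g # gs) Qs} = (\<lambda>(Q, Qs). Q # Qs) ` (A g \<times> T)"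
    by (auto simp: T_def list_all2_Cons1)
  have fin: "finite (A g)" using Cons.prems by simp
  have "word_cop C (g # gs) = (\<Sum>Q\<in>A g. \<Sum>Qs\<in>T.
      {#(t g Q, concat (map2 l (g # gs) (Q # Qs)), concat (map2 r (g # gs) (Q # Qs)))#})"
    using Cons.prems(1)[of g] by (simp add: sum_mset_sum_single) (simp add: IH(2) image_mset_sum)
  also have "\<dots> = (\<Sum>Qs | list_all2 (\<lambda>g Q. Q \<in> A g) (g # gs) Qs.
      {#(t g (hd Qs), concat (map2 l (g # gs) Qs), concat (map2 r (g # gs) Qs))#})"
    unfolding eq
    by (subst sum.reindex) (auto simp: inj_on_def sum.cartesian_product case_prod_unfold)
  finally show ?case using fin IH(1) by (simp add: eq)
next
  case Nil
  have "{Qs. list_all2 (\<lambda>g Q. Q \<in> A g) [] Qs} = {[]}" by auto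
  then show ?case by simp
qed

lemma noncrossingD:
  assumes "noncrossing S L" "B \<in> L" "C \<in> L" "p \<in> B" "q \<in> C" "p' \<in> B" "q' \<in> C"
    "p < q" "q < p'" "p' < q'"
  shows "B = C"
proof (rule ccontr)
  assume "B \<noteq> C"
  with assms have "\<exists>B\<in>L. \<exists>C\<in>L. B \<noteq> C \<and>
        (\<exists>p\<^sub>1\<in>B. \<exists>q\<^sub>1\<in>C. \<exists>p\<^sub>2\<in>B. \<exists>q\<^sub>2\<in>C. p\<^sub>1 < q\<^sub>1 \<and> q\<^sub>1 < p\<^sub>2 \<and> p\<^sub>2 < q\<^sub>2)"
    by (intro bexI[of _ B] bexI[of _ C] conjI bexI[of _ p] bexI[of _ q] bexI[of _ p'] bexI[of _ q'])
  then show False using assms(1) by (simp add: noncrossing_def)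
qed

lemma noncrossingI:
  assumes "partition_on S L"
    and "\<And>B C p q p' q'. B \<in> L \<Longrightarrow> C \<in> L \<Longrightarrow> p \<in> B \<Longrightarrow> q \<in> C \<Longrightarrow> p' \<in> B \<Longrightarrow> q' \<in> C \<Longrightarrow>
      p < q \<Longrightarrow> q < p' \<Longrightarrow> p' < q' \<Longrightarrow> B = C"
  shows "noncrossing S L"
  unfolding noncrossing_def
proof (intro conjI notI assms(1))
  assume "\<exists>B\<in>L. \<exists>C\<in>L. B \<noteq> C \<and>
        (\<exists>p\<^sub>1\<in>B. \<exists>q\<^sub>1\<in>C. \<exists>p\<^sub>2\<in>B. \<exists>q\<^sub>2\<in>C. p\<^sub>1 < q\<^sub>1 \<and> q\<^sub>1 < p\<^sub>2 \<and> p\<^sub>2 < q\<^sub>2)"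
  then obtain B C p q p' q' where "B \<in> L" "C \<in> L" "B \<noteq> C" "p \<in> B" "q \<in> C" "p' \<in> B" "q' \<in> C"
    "p < q" "q < p'" "p' < q'" by (elim bexE conjE)
  then show False using assms(2)[of B C p q p' q'] by simp
qed

text \<open>
  Iterated coproducts of one decorated partition only involve unions of its blocks.  Representing
  these by lists of points of the original partition \<open>L0\<close> (with decoration \<open>a\<close>) postpones the
  standardization, which \<open>code\<close> performs, to the very end.
\<close>

locale raw_partition =
  fixes X0 :: "nat set" and L0 :: "nat set set" and a :: "nat \<Rightarrow> 'a"
  assumes finite_X0: "finite X0" and nc: "noncrossing X0 L0"
begin

definition blocks_in :: "nat list \<Rightarrow> nat set set"
  where "blocks_in J = {B \<in> L0. B \<subseteq> set J}"

text \<open>The equation says that \<open>J\<close> stays inside the ground set and that a block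
  meeting \<open>J\<close> is contained in it.\<close>

definition saturated :: "nat list \<Rightarrow> bool"
  where "saturated J \<longleftrightarrow> sorted_wrt (<) J \<and> set J = \<Union>(blocks_in J)"

text \<open>Filtering the singleton makes \<open>Q = {}\<close> give the empty word, that is the
  unit, and not a word with an empty letter.\<close>

definition left_leg :: "nat list \<Rightarrow> nat set set \<Rightarrow> nat list list"
  where "left_leg J Q = filter (\<lambda>K. K \<noteq> []) [filter (\<lambda>x. x \<in> \<Union>Q) J]"

definition right_leg :: "nat list \<Rightarrow> nat set set \<Rightarrow> nat list list"
  where "right_leg J Q = runs (\<lambda>x. x \<notin> \<Union>Q) J"

definition raw_cop :: "nat list \<Rightarrow> nat list tagged_cop"
  where "raw_cop J = (\<Sum>Q\<in>admissible (blocks_in J). {#(hd J \<in> \<Union>Q, left_leg J Q, right_leg J Q)#})"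

definition code :: "nat list \<Rightarrow> nat set set \<times> 'a list"
  where "code J = (st (blocks_in J), map a J)"

lemma part: "partition_on X0 L0"
  using nc by (simp add: noncrossing_def)

lemma block_unique: "B \<in> L0 \<Longrightarrow> C \<in> L0 \<Longrightarrow> x \<in> B \<Longrightarrow> x \<in> C \<Longrightarrow> B = C"
  using partition_onD2[OF part] by (meson disjointD disjoint_iff)

lemma block_nonempty: "B \<in> L0 \<Longrightarrow> B \<noteq> {}"
  using partition_onD3[OF part] by blast

lemma block_subset: "B \<in> L0 \<Longrightarrow> B \<subseteq> X0"
  using partition_onD1[OF part] by blast

lemma block_finite: "B \<in> L0 \<Longrightarrow> finite B"
  using block_subset finite_X0 finite_subset by blast

lemmas no_crossing = noncrossingD[OF nc]

lemma finite_L0: "finite L0"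
  using finite_elements[OF finite_X0 part] .

lemma blocks_in_subset: "blocks_in J \<subseteq> L0" by (auto simp: blocks_in_def)

lemma finite_blocks_in: "finite (blocks_in J)"
  by (rule finite_subset[OF blocks_in_subset finite_L0])

lemma finite_admissible_blocks: "finite (admissible (blocks_in J))"
proof (rule finite_subset)
  show "admissible (blocks_in J) \<subseteq> Pow (blocks_in J)" by (auto simp: admissible_def)
qed (simp add: finite_blocks_in)

text \<open>The non-crossing condition in the form that admissibility needs: one point of
  \<open>D\<close> strictly between two points of \<open>B\<close> traps all of \<open>D\<close>
  there, since leaving the gap on either side would produce a crossing.\<close>

lemma nested_between:
  assumes "B \<in> L0" "D \<in> L0" "B \<noteq> D" "x \<in> B" "y \<in> B" "c \<in> D" "x < c" "c < y"
  shows "nested D B"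
  unfolding nested_def
proof
  fix m assume m: "m \<in> D"
  have "m \<noteq> x" "m \<noteq> y" using block_unique assms m by blast+
  moreover have "\<not> m < x" using no_crossing[of D B m x c y] assms m by auto
  moreover have "\<not> y < m" using no_crossing[of B D x c y m] assms m by auto
  ultimately have "x < m" "m < y" by auto
  moreover have "Min B \<le> x" "y \<le> Max B" using assms block_finite[of B] by auto
  ultimately show "Min B < m \<and> m < Max B" by linarith
qed

text \<open>A block inside the union of \<open>Q\<close> is nonempty, so it shares a point with a
  member of \<open>Q\<close> and hence equals it.\<close>

lemma blocks_in_filter:
  assumes "Q \<subseteq> blocks_in J"
  shows "blocks_in (filter (\<lambda>x. x \<in> \<Union>Q) J) = Q"
proof -
  have "B \<in> Q" if B: "B \<in> L0" "B \<subseteq> \<Union>Q" for B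
  proof -
    obtain x where "x \<in> B" using block_nonempty B(1) by blast
    then obtain C where "C \<in> Q" "x \<in> C" using B by blast
    then show ?thesis using block_unique[of B C x] B \<open>x \<in> B\<close> assms blocks_in_subset by auto
  qed
  then show ?thesis using assms unfolding blocks_in_def set_filter by blast
qed

lemma set_filter_Union: "Q \<subseteq> blocks_in J \<Longrightarrow> set (filter (\<lambda>x. x \<in> \<Union>Q) J) = \<Union>Q"
  by (auto simp: blocks_in_def)

lemma saturated_filter:
  assumes "saturated J" "Q \<subseteq> blocks_in J"
  shows "saturated (filter (\<lambda>x. x \<in> \<Union>Q) J)"
  unfolding saturated_def blocks_in_filter[OF assms(2)] set_filter_Union[OF assms(2)]
  using assms(1) by (auto simp: saturated_def sorted_wrt_filter)

text \<open>Here admissibility is decisive. If a block outside \<open>Q\<close> left the interval, a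
  block \<open>D\<close> of \<open>Q\<close> would have a point between two of its points. By
  \<open>nested_between\<close>, \<open>D\<close> would be nested in it, which admissibility
  forbids.\<close>

lemma saturated_run:
  assumes J: "saturated J" and Q: "Q \<in> admissible (blocks_in J)" and K: "K \<in> set (right_leg J Q)"
  shows "saturated K"
proof -
  have sorted: "sorted_wrt (<) J" using J by (simp add: saturated_def)
  from in_runs[OF K[unfolded right_leg_def]] obtain us vs where KP: "\<forall>x\<in>set K. x \<notin> \<Union>Q" and
    KJ: "J = us @ K @ vs" by blast
  have "\<exists>B\<in>blocks_in K. x \<in> B" if x: "x \<in> set K" for x
  proof -
    have "x \<in> set J" using KJ x by simp
    then obtain B where B: "B \<in> blocks_in J" "x \<in> B" using J by (auto simp: saturated_def)
    have BQ: "B \<notin> Q" using KP x B(2) by blast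
    have "B \<subseteq> set K"
    proof
      fix y assume y: "y \<in> B"
      show "y \<in> set K"
      proof (rule runs_maximal[OF sorted K[unfolded right_leg_def] x])
        show "y \<in> set J" using B(1) y by (auto simp: blocks_in_def)
        fix c assume c: "c \<in> set J" "x < c \<and> c \<le> y \<or> y \<le> c \<and> c < x"
        show "c \<notin> \<Union>Q"
        proof
          assume "c \<in> \<Union>Q"
          then obtain D where D: "D \<in> Q" "c \<in> D" by blast
          then have DL: "D \<in> L0" "B \<in> L0" using Q B(1) blocks_in_subset by (auto simp:
              admissible_def)
          have "c \<noteq> y" using block_unique[OF DL(2,1), of c] D BQ y by blast
          then consider "x < c" "c < y" | "y < c" "c < x" using c(2) by linarith
          moreover have "B \<noteq> D" using D(1) BQ by blast
          ultimately have "nested D B"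
            by cases (use nested_between[OF DL(2,1)] B(2) y D(2) in blast)+
          then show False using Q D(1) B(1) BQ by (auto simp: admissible_def)
        qed
      qed
    qed
    with B show ?thesis by (auto simp: blocks_in_def)
  qed
  moreover have "sorted_wrt (<) K" using sorted KJ by (simp add: sorted_wrt_append)
  ultimately show ?thesis by (auto simp: saturated_def blocks_in_def)
qed

lemma mem_restrict:
  assumes "saturated K" "Q \<subseteq> L0" "x \<in> set K"
  shows "x \<in> \<Union>{B \<in> Q. B \<subseteq> set K} \<longleftrightarrow> x \<in> \<Union>Q"
proof -
  obtain B where "B \<in> L0" "B \<subseteq> set K" "x \<in> B" using assms(1,3) by (auto simp: saturated_def
      blocks_in_def)
  then show ?thesis using block_unique[of B _ x] assms(2) by blast
qed

text \<open>A block of \<open>P - Q'\<close> that encloses a block of \<open>Q'\<close> lies either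
  in \<open>Q - Q'\<close> or in \<open>P - Q\<close>. The first is excluded by admissibility inside
  \<open>Q\<close>, the second by that of \<open>Q\<close>. So iterating on the left leg sums over
  nested pairs of admissible sets of the original partition.\<close>

lemma admissible_mono:
  assumes "Q \<in> admissible P"
  shows "admissible Q = {Q' \<in> admissible P. Q' \<subseteq> Q}"
  using assms unfolding admissible_def by blast

text \<open>Restriction to the intervals is inverted by gluing the pieces onto \<open>Q'\<close>.
  The delicate point is admissibility of the glued set, where blocks from different intervals have
  to be compared.\<close>

lemma refinement_bij:
  assumes J: "saturated J" and Q': "Q' \<in> admissible (blocks_in J)"
  defines "Ks \<equiv> right_leg J Q'"
  shows "bij_betw (\<lambda>Q. map (\<lambda>K. {B \<in> Q. B \<subseteq> set K}) Ks)
    {Q \<in> admissible (blocks_in J). Q' \<subseteq> Q} {Rs. list_all2 (\<lambda>K R. R \<in> admissible (blocks_in K)) Ks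
        Rs}"
proof (rule bij_betw_byWitness[where f' = "\<lambda>Rs. Q' \<union> \<Union>(set Rs)"])
  let ?Rs = "{Rs. list_all2 (\<lambda>K R. R \<in> admissible (blocks_in K)) Ks Rs}"
  let ?res = "\<lambda>Q. map (\<lambda>K. {B \<in> Q. B \<subseteq> set K}) Ks"
  have satK: "saturated K" if "K \<in> set Ks" for K using saturated_run[OF J Q'] that by (simp add:
      Ks_def)
  have sorted: "sorted_wrt (<) J" using J by (simp add: saturated_def)
  then have dist: "distinct J" using strict_sorted_iff by blast
  have QL: "Q' \<subseteq> blocks_in J" using Q' by (simp add: admissible_def)
  \<comment> \<open>A block outside \<open>Q'\<close> has a point in some interval, and as the
    interval is saturated it contains the whole block.\<close>
  have cover: "B \<in> Q' \<or> (\<exists>K\<in>set Ks. B \<in> blocks_in K)" if B: "B \<in> blocks_in J" for B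
  proof (cases "B \<in> Q'")
    case False
    have BL: "B \<in> L0" "B \<subseteq> set J" using B by (auto simp: blocks_in_def)
    obtain x where x: "x \<in> B" using block_nonempty[OF BL(1)] by blast
    have "x \<notin> \<Union>Q'" using block_unique[of B _ x] x BL(1) QL blocks_in_subset False by blast
    then have "x \<in> set (concat Ks)" unfolding Ks_def right_leg_def concat_runs using x BL by auto
    then obtain K where K: "K \<in> set Ks" "x \<in> set K" by auto
    then obtain C where "C \<in> blocks_in K" "x \<in> C" using satK by (auto simp: saturated_def)
    then have "C = B" using block_unique[of B C x] x BL by (auto simp: blocks_in_def)
    then show ?thesis using K \<open>C \<in> blocks_in K\<close> by blast
  qed simp
  have KJ: "set K \<subseteq> set J" if "K \<in> set Ks" for K
    using runs_subset[of K _ J] that unfolding Ks_def right_leg_def by blast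
  have blK: "blocks_in K \<subseteq> blocks_in J - Q'" if K: "K \<in> set Ks" for K
  proof
    fix B assume B: "B \<in> blocks_in K"
    then obtain x where "x \<in> B" "x \<in> set K" using block_nonempty[of B] by (auto simp: blocks_in_def)
    then have "B \<notin> Q'" using in_runs[OF K[unfolded Ks_def right_leg_def]] by blast
    then show "B \<in> blocks_in J - Q'" using B KJ[OF K] by (auto simp: blocks_in_def)
  qed
  show "\<forall>Q\<in>{Q \<in> admissible (blocks_in J). Q' \<subseteq> Q}.
      Q' \<union> \<Union>(set (?res Q)) = Q"
  proof
    fix Q assume "Q \<in> {Q \<in> admissible (blocks_in J). Q' \<subseteq> Q}"
    then have Q: "Q \<subseteq> blocks_in J" "Q' \<subseteq> Q" by (auto simp: admissible_def)
    have "B \<in> Q' \<union> \<Union>(set (?res Q))" if "B \<in> Q" for B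
      using cover[of B] Q that by (auto simp: blocks_in_def)
    then have "Q \<subseteq> Q' \<union> \<Union>(set (?res Q))" by (rule subsetI)
    moreover have "Q' \<union> \<Union>(set (?res Q)) \<subseteq> Q" using Q by auto
    ultimately show "Q' \<union> \<Union>(set (?res Q)) = Q" by (rule equalityI[rotated])
  qed
  show "\<forall>Rs\<in>?Rs.
      ?res (Q' \<union> \<Union>(set Rs)) = Rs"
  proof (intro ballI nth_equalityI)
    fix Rs assume Rs: "Rs \<in> ?Rs"
    then show len: "length (?res (Q' \<union> \<Union>(set Rs))) = length Rs"
      by (auto simp: list_all2_lengthD)
    fix i assume "i < length (?res (Q' \<union> \<Union>(set Rs)))"
    then have i: "i < length Ks" "i < length Rs" using len by auto
    have Rn: "Rs ! j \<subseteq> blocks_in (Ks ! j)" if "j < length Ks" for j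
      using Rs that by (auto simp: list_all2_conv_all_nth admissible_def)
    have "B \<in> Rs ! i" if B: "B \<in> Q' \<union> \<Union>(set Rs)" "B \<subseteq> set (Ks ! i)" for B
    proof -
      have BL: "B \<in> L0"
      proof (cases "B \<in> Q'")
        case False
        then obtain j where "j < length Rs" "B \<in> Rs ! j" using B(1) by (auto simp: in_set_conv_nth)
        then show ?thesis using Rn[of j] len blocks_in_subset[of "Ks ! j"] by auto
      qed (use QL blocks_in_subset in blast)
      then have Bi: "B \<in> blocks_in (Ks ! i)" using B by (simp add: blocks_in_def)
      then have "B \<notin> Q'" using blK[of "Ks ! i"] i by auto
      then obtain j where j: "j < length Rs" "B \<in> Rs ! j" using B(1) by (auto simp: in_set_conv_nth)
      then have "B \<subseteq> set (Ks ! j)" using Rn[of j] len by (auto simp: blocks_in_def)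
      moreover obtain x where "x \<in> B" using block_nonempty[OF BL] by blast
      ultimately have x: "x \<in> set (Ks ! i) \<inter> set (Ks ! j)" using B by auto
      \<comment> \<open>Intervals at different positions are disjoint, so the common point
        \<open>x\<close> determines the position.\<close>
      have "i = j"
      proof (rule ccontr)
        assume "i \<noteq> j"
        have Ki: "Ks = take i Ks @ Ks ! i # drop (Suc i) Ks" using i by (simp add: id_take_nth_drop)
        have "Ks ! j \<in> set (take i Ks) \<union> set (drop (Suc i) Ks)"
        proof (cases "j < i")
          case True
          then have "take i Ks ! j = Ks ! j" "j < length (take i Ks)" using i by auto
          then show ?thesis by (metis UnI1 nth_mem)
        next
          case False
          then have "drop (Suc i) Ks ! (j - Suc i) = Ks ! j" "j - Suc i < length (drop (Suc i) Ks)"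
            using \<open>i \<noteq> j\<close> j len by auto
          then show ?thesis by (metis UnI2 nth_mem)
        qed
        from runs_disjoint[OF dist Ki[unfolded Ks_def right_leg_def] this[unfolded Ks_def
            right_leg_def]] x
        show False by (simp add: Ks_def right_leg_def)
      qed
      with j show ?thesis by simp
    qed
    then show "?res (Q' \<union> \<Union>(set Rs)) ! i = Rs ! i"
      using i Rn[OF i(1)] by (auto simp: blocks_in_def)
  qed
  show "?res ` {Q \<in> admissible (blocks_in J). Q' \<subseteq> Q}
      \<subseteq> ?Rs"
  proof clarify
    fix Q assume Q: "Q \<in> admissible (blocks_in J)" "Q' \<subseteq> Q"
    have "{B \<in> Q. B \<subseteq> set K} \<in> admissible (blocks_in K)" if "K \<in> set Ks" for K
      using Q(1) KJ[OF that] unfolding admissible_def blocks_in_def by blast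
    then show "list_all2 (\<lambda>K R. R \<in> admissible (blocks_in K)) Ks (?res Q)"
      by (simp add: list_all2_conv_all_nth)
  qed
  show "(\<lambda>Rs. Q' \<union> \<Union>(set Rs)) ` ?Rs
      \<subseteq> {Q \<in> admissible (blocks_in J). Q' \<subseteq> Q}"
  proof clarify
    fix Rs assume Rs: "list_all2 (\<lambda>K R. R \<in> admissible (blocks_in K)) Ks Rs"
    have R: "\<exists>K\<in>set Ks. R \<in> admissible (blocks_in K)" if "R \<in> set Rs" for R
      using that Rs by (metis in_set_conv_nth list_all2_conv_all_nth)
    have "R \<subseteq> blocks_in J" if "R \<in> set Rs" for R
      using R[OF that] blK unfolding admissible_def by blast
    then have sub: "Q' \<union> \<Union>(set Rs) \<subseteq> blocks_in J" using QL by blast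
    moreover have False
      if B: "B \<in> Q' \<union> \<Union>(set Rs)" and C: "C \<in> blocks_in J - (Q' \<union> \<Union>(set Rs))" and n: "nested B C"
          for B C
    proof (cases "B \<in> Q'")
      case True
      then show False using Q' C n by (auto simp: admissible_def)
    next
      case False
      then obtain R where R': "R \<in> set Rs" "B \<in> R" using B by auto
      then obtain K where K: "K \<in> set Ks" "R \<in> admissible (blocks_in K)" using R by blast
      obtain K' where K': "K' \<in> set Ks" "C \<in> blocks_in K'" using cover[of C] C by auto
      have CL: "C \<in> L0" using C blocks_in_subset by auto
      then have M: "Min C \<in> C" "Max C \<in> C" using block_finite[of C] block_nonempty[of C] by auto
      have BK: "B \<subseteq> set K" "B \<in> L0" using K(2) R' by (auto simp: admissible_def blocks_in_def)
      obtain b where b: "b \<in> B" using block_nonempty[OF BK(2)] by blast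
      \<comment> \<open>Nesting places \<open>b\<close> between the extreme points of
        \<open>C\<close>, which both lie in \<open>K'\<close>. Runs have no holes, so
        \<open>b\<close> lies in \<open>K'\<close> too, and disjointness leaves a single interval. A
        nested pair thus never involves two intervals.\<close>
      have "Min C \<le> b" "b \<le> Max C" using n b by (simp_all add: nested_def less_imp_le)
      moreover have "Min C \<in> set K'" "Max C \<in> set K'" using K'(2) M by (auto simp: blocks_in_def)
      moreover have "b \<in> set J" using b BK(1) KJ[OF K(1)] by blast
      ultimately have "b \<in> set K'"
        using runs_contiguous[OF sorted K'(1)[unfolded Ks_def right_leg_def]] by blast
      then have "K' = K"
      proof -
        obtain Ks1 Ks2 where KK: "Ks = Ks1 @ K # Ks2" using K(1) by (meson split_list)
        show ?thesis
          using runs_disjoint[OF dist KK[unfolded Ks_def right_leg_def], of K'] K'(1) b BK(1)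
            \<open>b \<in> set K'\<close> unfolding KK by auto
      qed
      then have "C \<in> blocks_in K - R" using K' C R' by auto
      then show False using K(2) R'(2) n by (auto simp: admissible_def)
    qed
    ultimately show "Q' \<union> \<Union>(set Rs) \<in> admissible (blocks_in J) \<and> Q' \<subseteq> Q' \<union> \<Union>(set Rs)"
      unfolding admissible_def by blast
  qed
qed

end

section \<open>Coassociativity of the raw coproduct\<close>

context raw_partition
begin

text \<open>Saturated nonempty lists are closed under splitting, so that coproducts can be iterated
  without leaving this class.\<close>

lemma saturated_leg:
  assumes "saturated J" "x \<in># raw_cop J"
  shows "K \<in> set (lft x) \<union> set (rgt x) \<Longrightarrow> saturated K \<and> K \<noteq> []"
proof -
  assume K: "K \<in> set (lft x) \<union> set (rgt x)"
  have "\<exists>Q\<in>admissible (blocks_in J). x = (hd J \<in> \<Union>Q, left_leg J Q, right_leg J Q)"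
    using assms(2) unfolding raw_cop_def by (simp add: finite_admissible_blocks set_mset_sum)
  then obtain Q where Q: "Q \<in> admissible (blocks_in J)" "x =
      (hd J \<in> \<Union>Q, left_leg J Q, right_leg J Q)" by blast
  from K Q(2) consider "K \<in> set (left_leg J Q)" | "K \<in> set (right_leg J Q)" by auto
  then show ?thesis
  proof cases
    case 1
    then have "K = filter (\<lambda>x. x \<in> \<Union>Q) J" "K \<noteq> []" by (auto simp: left_leg_def split: if_splits)
    then show ?thesis using saturated_filter[OF assms(1)] Q(1) by (auto simp: admissible_def)
  next
    case 2
    then show ?thesis using saturated_run[OF assms(1) Q(1)] in_runs[of K] by (auto simp:
        right_leg_def)
  qed
qed

lemma word_cop_left_leg:
  assumes J: "saturated J" and Q: "Q \<in> admissible (blocks_in J)"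
  defines "K \<equiv> filter (\<lambda>x. x \<in> \<Union>Q) J"
  shows "word_cop raw_cop (left_leg J Q) = (\<Sum>Q'\<in>admissible Q. {#(K \<noteq> [] \<and>
      hd K \<in> \<Union>Q', left_leg K Q', right_leg K Q')#})"
proof (cases "K = []")
  \<comment> \<open>Here \<open>Q = {}\<close>, whose only admissible subset is \<open>{}\<close>.
    Both sides are the single term of the empty word, and the guard \<open>K \<noteq> []\<close>
    produces its tag \<open>False\<close>.\<close>
  case True
  have QJ: "Q \<subseteq> blocks_in J" using Q by (simp add: admissible_def)
  have "blocks_in K = Q" unfolding K_def by (rule blocks_in_filter[OF QJ])
  then have "Q = {}" using block_nonempty True by (auto simp: blocks_in_def)
  moreover have "admissible {} = {{}}" by (auto simp: admissible_def)
  ultimately show ?thesis using True by (simp add: left_leg_def right_leg_def K_def)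
next
  case False
  have QJ: "Q \<subseteq> blocks_in J" using Q by (simp add: admissible_def)
  have "blocks_in K = Q" unfolding K_def by (rule blocks_in_filter[OF QJ])
  moreover have "left_leg J Q = [K]" using False by (simp add: left_leg_def K_def)
  ultimately show ?thesis using False by (simp only: word_cop_single raw_cop_def) simp
qed

lemma left_leg_restrict:
  assumes "Q' \<subseteq> Q"
  shows "left_leg (filter (\<lambda>x. x \<in> \<Union>Q) J) Q' = left_leg J Q'"
proof -
  have "filter (\<lambda>x. x \<in> \<Union>Q') (filter (\<lambda>x. x \<in> \<Union>Q) J) = filter (\<lambda>x. x \<in> \<Union>Q') J"
    unfolding filter_filter by (rule filter_cong) (use assms in auto)
  then show ?thesis by (simp only: left_leg_def)
qed

lemma concat_map2_map: "concat (map2 f Ks (map g Ks)) = concat (map (\<lambda>K. f K (g K)) Ks)"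
  by (induction Ks) auto

lemma concat_map_left_leg:
  "concat (map (\<lambda>K. left_leg K Q) Ks) = filter (\<lambda>K. K \<noteq> []) (map (filter (\<lambda>x. x \<in> \<Union>Q)) Ks)"
  by (induction Ks) (auto simp: left_leg_def)

lemma raw_cop_coassoc:
  assumes J: "saturated J" "J \<noteq> []"
  shows "cop_left (word_cop raw_cop) (raw_cop J) = cop_right (word_cop raw_cop) (raw_cop J)"
proof -
  define A where "A = admissible (blocks_in J)"
  define tg :: "nat set set \<Rightarrow> nat set set \<Rightarrow> nat"
    where "tg Q Q' = (if hd J \<notin> \<Union>Q then 2 else if hd J \<notin> \<Union>Q' then 1 else 0)" for Q Q'
  define mid where "mid Q Q' = filter (\<lambda>K. K \<noteq> []) (map (filter (\<lambda>x. x \<in> \<Union>Q)) (right_leg J Q'))"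
      for Q Q'
  \<comment> \<open>The summand common to both iterated coproducts for a pair
    \<open>Q' \<subseteq> Q\<close>: the points of \<open>Q'\<close>, the nonempty traces of
    \<open>Q\<close> on the gaps of \<open>Q'\<close>, and the gaps of \<open>Q\<close>.\<close>
  define E where "E Q Q' = {#(tg Q Q', left_leg J Q', mid Q Q', right_leg J Q)#}" for Q Q'
  have finA: "finite A" unfolding A_def by (rule finite_admissible_blocks)
  have left: "image_mset (\<lambda>y. (tag_left (hd J \<in> \<Union>Q) (fst y), lft y, rgt y, right_leg J Q))
      (word_cop raw_cop (left_leg J Q)) = (\<Sum>Q' | Q' \<in> A \<and> Q' \<subseteq> Q. E Q Q')" if Q: "Q \<in> A" for Q
  proof -
    define K where "K = filter (\<lambda>x. x \<in> \<Union>Q) J"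
    \<comment> \<open>If the first point of \<open>J\<close> belongs to \<open>Q\<close>, it
      survives as the head of \<open>K\<close>; otherwise the outer tag alone gives
      \<open>2\<close>.\<close>
    have 1: "tag_left (hd J \<in> \<Union>Q) (K \<noteq> [] \<and> hd K \<in> \<Union>Q') = tg Q Q'" for Q'
      using J(2) by (cases J) (auto simp: tag_left_def tg_def K_def)
    \<comment> \<open>Passing from \<open>J\<close> to \<open>K\<close> deletes only points outside
      \<open>Q\<close>, hence outside \<open>Q'\<close>; these satisfy the predicate defining the
      gaps, as \<open>runs_filter\<close> requires.\<close>
    have 2: "right_leg K Q' = mid Q Q'" if "Q' \<subseteq> Q" for Q'
      unfolding right_leg_def mid_def K_def by (rule runs_filter) (use that in auto)
    have 3: "left_leg K Q' = left_leg J Q'" if "Q' \<subseteq> Q" for Q'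
      unfolding K_def using that by (rule left_leg_restrict)
    show ?thesis
      unfolding word_cop_left_leg[OF J(1) Q[unfolded A_def]] admissible_mono[OF Q[unfolded A_def]]
        K_def[symmetric] A_def[symmetric] image_mset_sum image_mset_single
      by (rule sum.cong[OF refl]) (simp only: fst_conv snd_conv mem_Collect_eq 1 2 3 E_def)
  qed
  have right: "image_mset (\<lambda>y. (tag_right (hd J \<in> \<Union>Q') (fst y), left_leg J Q', lft y, rgt y))
      (word_cop raw_cop (right_leg J Q')) = (\<Sum>Q | Q \<in> A \<and> Q' \<subseteq> Q. E Q Q')" if Q': "Q' \<in> A" for Q'
  proof -
    define Ks where "Ks = right_leg J Q'"
    define g where "g Q = map (\<lambda>K. {B \<in> Q. B \<subseteq> set K}) Ks" for Q
    have satK: "saturated K" if "K \<in> set Ks" for K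
      using saturated_run[OF J(1) Q'[unfolded A_def]] that by (simp add: Ks_def)
    have "word_cop raw_cop Ks = (\<Sum>Qs | list_all2 (\<lambda>K R. R \<in> admissible (blocks_in K)) Ks Qs.
      {#(Ks \<noteq> [] \<and> hd (hd Ks) \<in> \<Union>(hd Qs), concat (map2 left_leg Ks Qs),
          concat (map2 right_leg Ks Qs))#})"
      by (rule conjunct2[OF word_cop_eq_sum[where t = "\<lambda>K Q. hd K \<in> \<Union>Q"]])
          (simp_all add: raw_cop_def finite_admissible_blocks)
    also have "\<dots> = (\<Sum>Q | Q \<in> A \<and> Q' \<subseteq> Q.
      {#(Ks \<noteq> [] \<and> hd (hd Ks) \<in> \<Union>(hd (g Q)), concat (map2 left_leg Ks (g Q)),
          concat (map2 right_leg Ks (g Q)))#})"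
      using sum.reindex_bij_betw[OF refinement_bij[OF J(1) Q'[unfolded A_def]], symmetric]
      unfolding Ks_def A_def g_def by simp
    finally have *: "image_mset (\<lambda>y. (tag_right (hd J \<in> \<Union>Q') (fst y), left_leg J Q', lft y, rgt y))
      (word_cop raw_cop Ks) = (\<Sum>Q | Q \<in> A \<and> Q' \<subseteq> Q.
      {#(tag_right (hd J \<in> \<Union>Q') (Ks \<noteq> [] \<and> hd (hd Ks) \<in> \<Union>(hd (g Q))), left_leg J Q',
        concat (map2 left_leg Ks (g Q)), concat (map2 right_leg Ks (g Q)))#})"
      by (simp add: image_mset_sum)
    show ?thesis unfolding Ks_def[symmetric] *
    proof (rule sum.cong[OF refl])
      fix Q assume Q: "Q \<in> {Q. Q \<in> A \<and> Q' \<subseteq> Q}"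
      then have QL: "Q \<subseteq> L0" using blocks_in_subset by (auto simp: A_def admissible_def)
      have mem: "x \<in> \<Union>{B \<in> Q. B \<subseteq> set K} \<longleftrightarrow> x \<in> \<Union>Q" if "K \<in> set Ks" "x \<in> set K" for K x
        by (rule mem_restrict[OF satK QL]) (use that in auto)
      have "concat (map2 left_leg Ks (g Q)) = concat (map (\<lambda>K. left_leg K Q) Ks)"
        unfolding g_def concat_map2_map
        by (rule arg_cong[where f = concat], rule map_cong[OF refl])
          (simp only: left_leg_def mem cong: filter_cong)
      then have l: "concat (map2 left_leg Ks (g Q)) = mid Q Q'"
        unfolding concat_map_left_leg mid_def Ks_def .
      have "concat (map2 right_leg Ks (g Q)) = concat (map (\<lambda>K. right_leg K Q) Ks)"
        unfolding g_def concat_map2_map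
        by (rule arg_cong[where f = concat], rule map_cong[OF refl])
          (unfold right_leg_def, rule runs_cong, simp only: mem)
      \<comment> \<open>Cutting the gaps of \<open>Q'\<close> at the points of \<open>Q\<close>
        gives the gaps of \<open>Q\<close>, because \<open>Q' \<subseteq> Q\<close>.\<close>
      also have "\<dots> = runs (\<lambda>x. x \<notin> \<Union>Q' \<and> x \<notin> \<Union>Q) J"
        unfolding runs_conj Ks_def right_leg_def ..
      also have "\<dots> = right_leg J Q" unfolding right_leg_def by (rule runs_cong) (use Q in blast)
      finally have r: "concat (map2 right_leg Ks (g Q)) = right_leg J Q" .
      have "tag_right (hd J \<in> \<Union>Q') (Ks \<noteq> [] \<and> hd (hd Ks) \<in> \<Union>(hd (g Q))) = tg Q Q'"
      proof (cases "hd J \<in> \<Union>Q'")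
        case True
        then have "hd J \<in> \<Union>Q" using Q by blast
        with True show ?thesis by (simp add: tag_right_def tg_def)
      next
        \<comment> \<open>The first gap then starts at the first point of \<open>J\<close>, so the
          inner tag asks whether this point lies in \<open>Q\<close>.\<close>
        case False
        then have Ks: "Ks \<noteq> []" "hd (hd Ks) = hd J"
          using hd_runs[OF J(2), of "\<lambda>x. x \<notin> \<Union>Q'"] unfolding Ks_def right_leg_def by blast+
        have "hd Ks \<noteq> []"
          using in_runs[of "hd Ks" "\<lambda>x. x \<notin> \<Union>Q'" J] hd_in_set[OF Ks(1)] unfolding Ks_def
              right_leg_def by blast
        then have "hd (hd Ks) \<in> set (hd Ks)" by simp
        then have "hd (hd Ks) \<in> \<Union>(hd (g Q)) \<longleftrightarrow> hd J \<in> \<Union>Q"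
          using mem[of "hd Ks" "hd (hd Ks)"] Ks unfolding g_def by (simp add: hd_map)
        with False Ks show ?thesis by (auto simp: tag_right_def tg_def)
      qed
      with l r show "{#(tag_right (hd J \<in> \<Union>Q') (Ks \<noteq> [] \<and> hd (hd Ks) \<in> \<Union>(hd (g Q))), left_leg J Q',
        concat (map2 left_leg Ks (g Q)), concat (map2 right_leg Ks (g Q)))#} = E Q Q'"
        by (simp only: E_def)
    qed
  qed
  have "cop_left (word_cop raw_cop) (raw_cop J) = (\<Sum>Q\<in>A. \<Sum>Q' | Q' \<in> A \<and> Q' \<subseteq> Q. E Q Q')"
    unfolding cop_left_def raw_cop_def[of J] sum_mset_sum_single fst_conv snd_conv A_def[symmetric]
    by (rule sum.cong[OF refl]) (rule left)
  also have "\<dots> = (\<Sum>Q'\<in>A. \<Sum>Q | Q \<in> A \<and> Q' \<subseteq> Q. E Q Q')"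
    by (rule sum.swap_restrict[OF finA finA])
  also have "\<dots> = cop_right (word_cop raw_cop) (raw_cop J)"
    unfolding cop_right_def raw_cop_def[of J] sum_mset_sum_single fst_conv snd_conv A_def[symmetric]
    by (rule sum.cong[OF refl]) (rule right[symmetric])
  finally show ?thesis .
qed

end

section \<open>Standardization and increasing relabellings\<close>

lemma nths_cong: "(\<And>i. i < length xs \<Longrightarrow> i \<in> A \<longleftrightarrow> i \<in> B) \<Longrightarrow> nths xs A = nths xs B"
  unfolding nths_def by (rule arg_cong[where f = "map fst"], rule filter_cong) (auto simp: set_zip)

lemma Union_image_image: "\<Union>((`) f ` P) = f ` \<Union>P"
  by auto

text \<open>Ranks depend only on the relative order of the points, which an increasing map
  preserves. Hence repeated standardization collapses to a single one.\<close>

lemma st_image: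
  assumes "strict_mono_on (\<Union>P) f"
  shows "st ((`) f ` P) = st (P :: nat set set)"
proof -
  have "card {y \<in> f ` \<Union>P. y \<le> f x} = card {y \<in> \<Union>P. y \<le> x}" if x: "x \<in> \<Union>P" for x
  proof -
    have "f y \<le> f x \<longleftrightarrow> y \<le> x" if "y \<in> \<Union>P" for y
      using strict_mono_on_leD[OF assms, of y x] strict_mono_onD[OF assms, of x y] x that
      by (meson linorder_not_le order_le_less)
    then have "{y \<in> f ` \<Union>P. y \<le> f x} = f ` {y \<in> \<Union>P. y \<le> x}" by blast
    moreover have "inj_on f {y \<in> \<Union>P. y \<le> x}"
      using strict_mono_on_imp_inj_on[OF assms] by (rule inj_on_subset) blast
    ultimately show ?thesis by (simp add: card_image)
  qed
  then have "(\<lambda>x. card {y \<in> f ` \<Union>P. y \<le> x}) ` f ` B = (\<lambda>x. card {y \<in> \<Union>P. y \<le> x}) ` B"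
    if "B \<in> P" for B
    unfolding image_image using that by (intro image_cong) auto
  then show ?thesis unfolding st_def Union_image_image
    by (subst image_image) (rule image_cong[OF refl])
qed

lemma nested_iff:
  "finite C \<Longrightarrow> C \<noteq> {} \<Longrightarrow> nested B C \<longleftrightarrow> (\<forall>m\<in>B. (\<exists>c\<in>C. c < m) \<and> (\<exists>c\<in>C. m < c))"
  by (simp add: nested_def Min_less_iff Max_gr_iff)

lemma strict_mono_on_less_iff:
  fixes f :: "nat \<Rightarrow> nat"
  assumes "strict_mono_on D f" "x \<in> D" "y \<in> D"
  shows "f x < f y \<longleftrightarrow> x < y"
  using strict_mono_onD[OF assms] strict_mono_onD[OF assms(1,3,2)]
  by (cases x y rule: linorder_cases) auto

lemma nested_image:
  assumes f: "strict_mono_on D f" and "B \<subseteq> D" "C \<subseteq> D" "finite C" "C \<noteq> {}"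
  shows "nested (f ` B) (f ` C) \<longleftrightarrow> nested B C"
proof -
  have "f c < f b \<longleftrightarrow> c < b" "f b < f c \<longleftrightarrow> b < c" if "b \<in> B" "c \<in> C" for b c
    using strict_mono_on_less_iff[OF f] assms that by blast+
  then show ?thesis using assms(4,5) by (simp add: nested_iff)
qed

text \<open>Increasing maps preserve and reflect nesting. The injectivity statement makes the
  correspondence usable for reindexing sums over admissible sets.\<close>

lemma admissible_image:
  assumes f: "strict_mono_on D f" and P: "\<And>B. B \<in> P \<Longrightarrow> B \<subseteq> D \<and> finite B \<and> B \<noteq> {}"
  shows "admissible ((`) f ` P) = (`) ((`) f) ` admissible P" "inj_on ((`) ((`) f)) (Pow P)"
proof -
  have inj: "inj_on ((`) f) P"
    using inj_on_image_Pow[OF strict_mono_on_imp_inj_on[OF f]] by (rule inj_on_subset)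
        (use P in auto)
  then show "inj_on ((`) ((`) f)) (Pow P)" by (rule inj_on_image_Pow)
  have adm: "(`) f ` Q \<in> admissible ((`) f ` P) \<longleftrightarrow> Q \<in> admissible P" if Q: "Q \<subseteq> P" for Q
  proof -
    have 1: "(`) f ` P - (`) f ` Q = (`) f ` (P - Q)"
      using inj_on_image_set_diff[OF inj, of P Q] Q by auto
    have "nested (f ` B) (f ` C) \<longleftrightarrow> nested B C" if "B \<in> Q" "C \<in> P - Q" for B C
      using nested_image[OF f, of B C] P[of B] P[of C] Q that by blast
    then have "(\<exists>B\<in>(`) f ` Q. \<exists>C\<in>(`) f ` (P - Q). nested B C) \<longleftrightarrow> (\<exists>B\<in>Q. \<exists>C\<in>P - Q. nested B C)"
      by auto
    then show ?thesis unfolding admissible_def mem_Collect_eq 1 using Q by (simp add: image_mono)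
  qed
  show "admissible ((`) f ` P) = (`) ((`) f) ` admissible P"
  proof (intro set_eqI iffI)
    fix R assume R: "R \<in> admissible ((`) f ` P)"
    then have "R \<subseteq> (`) f ` P" by (simp add: admissible_def)
    then obtain Q where "Q \<subseteq> P" "R = (`) f ` Q" by (auto simp: subset_image_iff)
    then show "R \<in> (`) ((`) f) ` admissible P" using adm R by blast
  next
    fix R assume "R \<in> (`) ((`) f) ` admissible P"
    then obtain Q where "Q \<in> admissible P" "R = (`) f ` Q" by blast
    moreover from this have "Q \<subseteq> P" by (simp add: admissible_def)
    ultimately show "R \<in> admissible ((`) f ` P)" using adm by blast
  qed
qed

lemma noncrossing_image:
  assumes f: "strict_mono_on D f" and nc: "noncrossing D P"
  shows "noncrossing (f ` D) ((`) f ` P)"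
proof -
  have part: "partition_on D P" using nc by (simp add: noncrossing_def)
  then have "B \<subseteq> D" if "B \<in> P" for B using partition_onD1[OF part] that by blast
  then have less: "f x < f y \<longleftrightarrow> x < y" if "B \<in> P" "C \<in> P" "x \<in> B" "y \<in> C" for B C x y
    using strict_mono_on_less_iff[OF f] that by blast
  have "partition_on (f ` D) ((`) f ` P - {{}})"
    using part strict_mono_on_imp_inj_on[OF f] by (rule partition_on_inj_image)
  moreover have "{} \<notin> (`) f ` P" using partition_onD3[OF part] by auto
  ultimately have "partition_on (f ` D) ((`) f ` P)" by simp
  then show ?thesis
  proof (rule noncrossingI)
    fix X Y p q p' q'
    assume "X \<in> (`) f ` P" "Y \<in> (`) f ` P" and *: "p \<in> X" "q \<in> Y" "p' \<in> X" "q' \<in> Y" "p < q"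
        "q < p'" "p' < q'"
    then obtain B C where BC: "B \<in> P" "C \<in> P" "X = f ` B" "Y = f ` C" by blast
    with * obtain x y x' y' where
      xy: "x \<in> B" "y \<in> C" "x' \<in> B" "y' \<in> C" "f x = p" "f y = q" "f x' = p'" "f y' = q'" by blast
    with BC * have "x < y" "y < x'" "x' < y'"
      using less[OF BC(1) BC(2) xy(1,2)] less[OF BC(2) BC(1) xy(2,3)] less[OF BC(1) BC(2) xy(3,4)]
          by simp_all
    from noncrossingD[OF nc BC(1,2) xy(1-4) this] show "X = Y" by (simp add: BC)
  qed
qed

lemma rank_nth:
  assumes "sorted_wrt (<) (J :: nat list)" "i < length J"
  shows "card {y \<in> set J. y \<le> J ! i} = Suc i"
proof -
  have "{y \<in> set J. y \<le> J ! i} = (\<lambda>j. J ! j) ` {..i}"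
  proof (intro set_eqI iffI)
    fix y assume "y \<in> {y \<in> set J. y \<le> J ! i}"
    then obtain j where j: "j < length J" "y = J ! j" "J ! j \<le> J ! i" by (auto simp:
        in_set_conv_nth)
    then have "\<not> i < j" using sorted_wrt_nth_less[OF assms(1), of i j] by auto
    then show "y \<in> (\<lambda>j. J ! j) ` {..i}" using j by auto
  next
    fix y assume "y \<in> (\<lambda>j. J ! j) ` {..i}"
    then obtain j where j: "j \<le> i" "y = J ! j" by auto
    then show "y \<in> {y \<in> set J. y \<le> J ! i}"
      using sorted_wrt_nth_less[OF assms(1), of j i] assms(2) by (cases "j = i") auto
  qed
  moreover have "inj_on (\<lambda>j. J ! j) {..i}"
    using assms strict_sorted_iff[of J] by (auto simp: inj_on_def nth_eq_iff_index_eq)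
  ultimately show ?thesis by (simp add: card_image)
qed

lemma map_rank:
  assumes "sorted_wrt (<) (J :: nat list)"
  shows "map (\<lambda>x. card {y \<in> set J. y \<le> x}) J = [1..<Suc (length J)]"
  by (rule nth_equalityI) (simp_all add: rank_nth[OF assms] del: upt_Suc)

lemma rank_strict_mono:
  assumes "finite S"
  shows "strict_mono_on S (\<lambda>x::nat. card {y \<in> S. y \<le> x})"
proof (intro strict_mono_onI psubset_card_mono)
  fix x y assume "x \<in> S" "y \<in> S" "x < y"
  then have "{z \<in> S. z \<le> x} \<subseteq> {z \<in> S. z \<le> y}" "y \<in> {z \<in> S. z \<le> y} - {z \<in> S. z \<le> x}" by auto
  then show "{z \<in> S. z \<le> x} \<subset> {z \<in> S. z \<le> y}" by blast
qed (use assms in simp)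

text \<open>\<open>subword\<close> reads positions while a raw list consists of points; the rank in
  \<open>J\<close> translates one into the other. Ranks start at \<open>1\<close>, matching the
  shift by one in \<open>subword\<close>.\<close>

lemma subword_rank:
  assumes "sorted_wrt (<) (J :: nat list)" "S \<subseteq> set J"
  shows "subword (map a J) ((\<lambda>x. card {y \<in> set J. y \<le> x}) ` S) = map a (filter (\<lambda>x. x \<in> S) J)"
proof -
  let ?r = "\<lambda>x. card {y \<in> set J. y \<le> x}"
  have inj: "inj_on ?r (set J)"
    by (rule strict_mono_on_imp_inj_on[OF rank_strict_mono]) simp
  have "Suc i \<in> ?r ` S \<longleftrightarrow> J ! i \<in> S" if "i < length J" for i
    using inj_on_image_mem_iff[OF inj, of "J ! i" S] rank_nth[OF assms(1) that] that assms(2) by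
        simp
  then show ?thesis
    unfolding subword_def filter_eq_nths nths_map by (intro arg_cong[where f =
        "map a"] nths_cong) auto
qed

text \<open>Together with \<open>nc_right\<close>, the two factors of \<open>coprod_term\<close> as
  words of index pairs, before \<open>dec\<close> and \<open>bar\<close> turn them into
  vectors.\<close>

definition nc_left :: "'a list \<Rightarrow> nat set set \<Rightarrow> (nat set set \<times> 'a list) list"
  where "nc_left as Q = (if Q = {} then [] else [(st Q, subword as (\<Union>Q))])"

definition nc_right :: "nat set set \<Rightarrow> 'a list \<Rightarrow> nat set set \<Rightarrow> (nat set set \<times> 'a list) list"
  where "nc_right L as Q = map (\<lambda>J. (st {B \<in> L - Q. B \<subseteq> J}, subword as J))
    (intervals ({1..length as} - \<Union>Q))"

definition nc_cop :: "nat set set \<times> 'a list \<Rightarrow> (nat set set \<times> 'a list) tagged_cop"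
  where "nc_cop w = (\<Sum>Q\<in>admissible (fst w).
    {#(1 \<in> \<Union>Q, nc_left (snd w) Q, nc_right (fst w) (snd w) Q)#})"

context raw_partition
begin

abbreviation "coded \<equiv> \<lambda>x. (fst x, map code (lft x), map code (rgt x))"

text \<open>The rank function \<open>r\<close> identifies \<open>J\<close> with
  \<open>{1..length J}\<close> and its blocks with the standardized partition. Admissible sets, legs
  and gaps correspond under \<open>r\<close>, and \<open>st_image\<close> absorbs the additional
  standardization of each factor.\<close>

lemma nc_cop_code:
  assumes J: "saturated J" "J \<noteq> []"
  shows "nc_cop (code J) = image_mset coded (raw_cop J)"
proof -
  define r where "r x = card {y \<in> set J. y \<le> x}" for x
  have sorted: "sorted_wrt (<) J" and UJ: "\<Union>(blocks_in J) =
      set J" using J by (auto simp: saturated_def)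
  then have dist: "distinct J" using strict_sorted_iff by blast
  have mono: "strict_mono_on (set J) r" unfolding r_def by (rule rank_strict_mono) simp
  have inj: "inj_on r (set J)" by (rule strict_mono_on_imp_inj_on[OF mono])
  have mapr: "map r J = [1..<Suc (length J)]" unfolding r_def by (rule map_rank[OF sorted])
  have rJ: "r ` set J = {1..length J}" using arg_cong[OF mapr, of set] by auto
  have stJ: "st (blocks_in J) = (`) r ` blocks_in J" unfolding st_def UJ r_def ..
  have P: "B \<subseteq> set J \<and> finite B \<and> B \<noteq> {}" if "B \<in> blocks_in J" for B
    using that block_finite block_nonempty by (auto simp: blocks_in_def)
  have st: "st ((`) r ` Q) = st Q" if "Q \<subseteq> blocks_in J" for Q
    by (rule st_image) (rule monotone_on_subset[OF mono], use that P in blast)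
  have r1: "r (hd J) = 1" using J(2) rank_nth[OF sorted, of 0] by (simp add: r_def hd_conv_nth)
  have main: "1 \<in> \<Union>((`) r ` Q) \<longleftrightarrow> hd J \<in> \<Union>Q"
    "nc_left (map a J) ((`) r ` Q) = map code (left_leg J Q)"
    "nc_right ((`) r ` blocks_in J) (map a J) ((`) r ` Q) = map code (right_leg J Q)"
    if Q: "Q \<in> admissible (blocks_in J)" for Q
  proof -
    have QJ: "Q \<subseteq> blocks_in J" and UQ: "\<Union>Q \<subseteq> set J" using Q P by (auto simp: admissible_def)
    show "1 \<in> \<Union>((`) r ` Q) \<longleftrightarrow> hd J \<in> \<Union>Q"
      unfolding Union_image_image r1[symmetric]
      by (rule inj_on_image_mem_iff[OF inj _ UQ]) (simp add: J)
    define F where "F = filter (\<lambda>x. x \<in> \<Union>Q) J"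
    have setF: "set F = \<Union>Q" unfolding F_def by (rule set_filter_Union[OF QJ])
    have "Q = {} \<longleftrightarrow> F = []"
    proof
      assume "F = []"
      then have "\<Union>Q = {}" using setF by simp
      then show "Q = {}" using QJ P by blast
    qed (simp add: F_def)
    moreover have "code F = (st Q, map a F)" by (simp add: code_def F_def blocks_in_filter[OF QJ]
        del: Union_iff)
    moreover have "subword (map a J) (r ` \<Union>Q) = map a F"
      unfolding r_def F_def by (rule subword_rank[OF sorted UQ])
    ultimately show "nc_left (map a J) ((`) r ` Q) = map code (left_leg J Q)"
      by (simp add: nc_left_def left_leg_def F_def[symmetric] Union_image_image st[OF QJ] del:
          Union_iff)
    \<comment> \<open>By \<open>mapr\<close> the list of positions is \<open>map r J\<close>, so
      intervals of positions become runs of \<open>J\<close>, whose neighbours need not be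
      consecutive integers.\<close>
    have "{1..length J} - r ` \<Union>Q = {i \<in> {1..length J}. i \<notin> r ` \<Union>Q}" by auto
    then have "intervals ({1..length J} - r ` \<Union>Q) =
        map set (runs (\<lambda>i. i \<notin> r ` \<Union>Q) (map r J))"
      unfolding mapr by (simp only: intervals_eq_runs)
    also have "\<dots> = map (\<lambda>K. r ` set K) (runs (\<lambda>x. r x \<notin> r ` \<Union>Q) J)"
      by (simp add: runs_map)
    also have "runs (\<lambda>x. r x \<notin> r ` \<Union>Q) J = right_leg J Q"
      unfolding right_leg_def by (rule runs_cong) (simp only: inj_on_image_mem_iff[OF inj _ UQ])
    finally have int: "intervals ({1..length J} - r ` \<Union>Q) = map (\<lambda>K. r ` set K) (right_leg J Q)" .
    have "(st {B \<in> (`) r ` blocks_in J - (`) r ` Q. B \<subseteq> r ` set K}, subword (map a J)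
        (r ` set K)) = code K"
      if K: "K \<in> set (right_leg J Q)" for K
    proof -
      have KJ: "set K \<subseteq> set J" using runs_subset K unfolding right_leg_def by blast
      have KQ: "set K \<inter> \<Union>Q = {}" using in_runs[OF K[unfolded right_leg_def]] by blast
      have injP: "inj_on ((`) r) (blocks_in J)"
        using inj_on_image_Pow[OF inj] by (rule inj_on_subset) (use P in auto)
      \<comment> \<open>Removing the images of \<open>Q\<close> costs nothing inside
        \<open>K\<close>: a nonempty block contained in \<open>K\<close> is not in \<open>Q\<close>,
        since \<open>K\<close> avoids the points of \<open>Q\<close>.\<close>
      have "{B \<in> (`) r ` blocks_in J - (`) r ` Q. B \<subseteq> r ` set K} = (`) r ` blocks_in K"
      proof (intro set_eqI iffI)
        fix X assume "X \<in> {B \<in> (`) r ` blocks_in J - (`) r ` Q. B \<subseteq> r ` set K}"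
        then obtain B where B: "B \<in> blocks_in J" "X = r ` B" "r ` B \<subseteq> r ` set K" by auto
        have "B \<subseteq> set K"
        proof
          fix x assume x: "x \<in> B"
          then have "r x \<in> r ` set K" using B(3) by blast
          moreover have "x \<in> set J" using x P[OF B(1)] by blast
          ultimately show "x \<in> set K" using inj_on_image_mem_iff[OF inj _ KJ] by simp
        qed
        then show "X \<in> (`) r ` blocks_in K" using B by (auto simp: blocks_in_def)
      next
        fix X assume "X \<in> (`) r ` blocks_in K"
        then obtain B where B: "B \<in> blocks_in K" "X = r ` B" by blast
        then have BJ: "B \<in> blocks_in J" "B \<subseteq> set K" using KJ by (auto simp: blocks_in_def)
        have "B \<noteq> {}" using P[OF BJ(1)] by simp
        then have "B \<notin> Q" using BJ(2) KQ by blast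
        then have "r ` B \<notin> (`) r ` Q"
          using inj_on_image_mem_iff[OF injP BJ(1) QJ] by simp
        then show "X \<in> {B \<in> (`) r ` blocks_in J - (`) r ` Q. B \<subseteq> r ` set K}" using B(2) BJ by (simp
            add: image_mono)
      qed
      moreover have "blocks_in K \<subseteq> blocks_in J" using KJ by (auto simp: blocks_in_def)
      moreover have "subword (map a J) (r ` set K) = map a K"
        unfolding r_def subword_rank[OF sorted KJ] filter_in_run[OF dist K[unfolded right_leg_def]]
            ..
      ultimately show ?thesis by (simp add: st code_def)
    qed
    then show "nc_right ((`) r ` blocks_in J) (map a J) ((`) r ` Q) = map code (right_leg J Q)"
      unfolding nc_right_def Union_image_image length_map int map_map comp_def
      by (intro map_cong refl)
  qed
  have adm: "admissible ((`) r ` blocks_in J) = (`) ((`) r) ` admissible (blocks_in J)"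
    "inj_on ((`) ((`) r)) (admissible (blocks_in J))"
  proof -
    show "admissible ((`) r ` blocks_in J) = (`) ((`) r) ` admissible (blocks_in J)"
      by (rule admissible_image(1)[OF mono]) (rule P)
    have "inj_on ((`) ((`) r)) (Pow (blocks_in J))" by (rule admissible_image(2)[OF mono]) (rule P)
    then show "inj_on ((`) ((`) r)) (admissible (blocks_in J))"
      by (rule inj_on_subset) (auto simp: admissible_def)
  qed
  have "nc_cop (code J) = (\<Sum>Q\<in>admissible (blocks_in J). {#(1 \<in> \<Union>((`) r ` Q), nc_left (map a J)
      ((`) r ` Q),
     nc_right ((`) r ` blocks_in J) (map a J) ((`) r ` Q))#})"
    unfolding nc_cop_def code_def fst_conv snd_conv stJ adm(1)
    by (subst sum.reindex[OF adm(2)]) (simp only: comp_def)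
  also have "\<dots> = image_mset coded (raw_cop J)"
    unfolding raw_cop_def image_mset_sum
    by (rule sum.cong[OF refl]) (simp only: main image_mset_single fst_conv snd_conv)
  finally show ?thesis .
qed

lemma word_cop_code:
  assumes "\<And>J. J \<in> set Js \<Longrightarrow> saturated J \<and> J \<noteq> []"
  shows "word_cop nc_cop (map code Js) = image_mset coded (word_cop raw_cop Js)"
  using assms by (induction Js) (simp_all add: nc_cop_code bind_simps)

lemma code_dec_index:
  assumes J: "saturated J" "J \<noteq> []"
  shows "code J \<in> dec_index"
proof -
  define r where "r x = card {y \<in> set J. y \<le> x}" for x
  have sorted: "sorted_wrt (<) J" and UJ: "\<Union>(blocks_in J) =
      set J" using J by (auto simp: saturated_def)
  have mono: "strict_mono_on (set J) r" unfolding r_def by (rule rank_strict_mono) simp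
  have mapr: "map r J = [1..<Suc (length J)]" unfolding r_def by (rule map_rank[OF sorted])
  have rJ: "r ` set J = {1..length J}" using arg_cong[OF mapr, of set] by auto
  have stJ: "st (blocks_in J) = (`) r ` blocks_in J" unfolding st_def UJ r_def ..
  have "partition_on (set J) (blocks_in J)"
  proof (rule partition_onI)
    fix B C assume "B \<in> blocks_in J" "C \<in> blocks_in J" "B \<noteq> C"
    then show "disjnt B C" using block_unique[of B C] blocks_in_subset unfolding disjnt_def by blast
  qed (use UJ block_nonempty blocks_in_subset in blast)+
  then have "noncrossing (set J) (blocks_in J)"
    by (rule noncrossingI) (rule no_crossing[OF subsetD[OF blocks_in_subset] subsetD[OF
        blocks_in_subset]])
  from noncrossing_image[OF mono this] show ?thesis
    using J(2) unfolding rJ stJ[symmetric] by (simp add: dec_index_def code_def NC_def Suc_le_eq)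
qed

text \<open>The legs of a saturated list are again saturated and nonempty, so coding commutes with
  both stages of an iterated coproduct. The raw identity is then pushed forward along
  \<open>h\<close>.\<close>

lemma nc_coassoc:
  assumes J: "saturated J" "J \<noteq> []"
  shows "cop_left (word_cop nc_cop) (nc_cop (code J)) = cop_right (word_cop nc_cop)
      (nc_cop (code J))"
proof -
  define h where "h = (\<lambda>x::nat \<times> nat list list \<times> nat list list \<times> nat list list.
    (fst x, map code (lft x), map code (fst (rgt x)), map code (snd (rgt x))))"
  have legs: "word_cop nc_cop (map code (lft x)) = image_mset coded (word_cop raw_cop (lft x))"
    "word_cop nc_cop (map code (rgt x)) = image_mset coded (word_cop raw_cop (rgt x))"
    if "x \<in># raw_cop J" for x
    by (intro word_cop_code saturated_leg[OF J(1) that]; simp)+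
  have "cop_left (word_cop nc_cop) (nc_cop (code J)) = image_mset h (cop_left (word_cop raw_cop)
      (raw_cop J))"
    unfolding nc_cop_code[OF J] cop_left_def h_def bind_simps fst_conv snd_conv
    by (rule sum_mset_cong) (simp only: legs image_mset.compositionality comp_def fst_conv snd_conv)
  moreover have "cop_right (word_cop nc_cop) (nc_cop (code J)) =
      image_mset h (cop_right (word_cop raw_cop) (raw_cop J))"
    unfolding nc_cop_code[OF J] cop_right_def h_def bind_simps fst_conv snd_conv
    by (rule sum_mset_cong) (simp only: legs image_mset.compositionality comp_def fst_conv snd_conv)
  ultimately show ?thesis by (simp only: raw_cop_coassoc[OF J])
qed

lemma filter_raw_cop:
  "filter_mset P (raw_cop J) =
    (\<Sum>Q | Q \<in> admissible (blocks_in J) \<and> P (hd J \<in> \<Union>Q, left_leg J Q, right_leg J Q).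
      {#(hd J \<in> \<Union>Q, left_leg J Q, right_leg J Q)#})"
  unfolding raw_cop_def by (rule filter_mset_sum_single[OF finite_admissible_blocks])

lemma left_leg_Nil_iff: "Q \<subseteq> blocks_in J \<Longrightarrow> left_leg J Q = [] \<longleftrightarrow> Q = {}"
  using set_filter_Union[of Q J] block_nonempty blocks_in_subset[of J]
  by (auto simp: left_leg_def simp del: set_filter) (metis empty_set Union_empty_conv subsetD
      equals0D)

lemma raw_cop_left_trivial:
  assumes "J \<noteq> []"
  shows "filter_mset (\<lambda>x. lft x = []) (raw_cop J) = {#(False, [], [J])#}"
proof -
  have "{Q. Q \<in> admissible (blocks_in J) \<and> left_leg J Q = []} = {{}}"
    using left_leg_Nil_iff[of _ J] by (auto simp: admissible_def)
  moreover have "left_leg J {} = []" "right_leg J {} = [J]" using assms by (simp_all add: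
      left_leg_def right_leg_def runs_all)
  ultimately show ?thesis by (simp add: filter_raw_cop)
qed

lemma raw_cop_right_trivial:
  assumes "saturated J" "J \<noteq> []"
  shows "filter_mset (\<lambda>x. rgt x = []) (raw_cop J) = {#(True, [J], [])#}"
proof -
  have UJ: "\<Union>(blocks_in J) = set J" using assms by (simp add: saturated_def)
  have "Q = blocks_in J" if Q: "Q \<in> admissible (blocks_in J)" "right_leg J Q = []" for Q
  proof -
    have "filter (\<lambda>x. x \<notin> \<Union>Q) J = []"
      using concat_runs[of "\<lambda>x. x \<notin> \<Union>Q" J] Q(2) by (simp add: right_leg_def)
    then have "filter (\<lambda>x. x \<in> \<Union>Q) J = J" by (auto simp: filter_empty_conv filter_id_conv)
    then show ?thesis using blocks_in_filter[of Q J] Q(1) by (simp add: admissible_def)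
  qed
  moreover have rtJ: "right_leg J (blocks_in J) = []"
  proof -
    have "concat (right_leg J (blocks_in J)) = []" unfolding right_leg_def concat_runs UJ by simp
    then show ?thesis using in_runs[of _ _ J] unfolding right_leg_def by (metis concat_eq_Nil_conv
        list.set_sel(1))
  qed
  moreover have "blocks_in J \<in> admissible (blocks_in J)" by (auto simp: admissible_def)
  ultimately have "{Q. Q \<in> admissible (blocks_in J) \<and> right_leg J Q = []} = {blocks_in J}" by auto
  moreover have "left_leg J (blocks_in J) = [J]" using assms(2) unfolding left_leg_def UJ by simp
  moreover have "hd J \<in> \<Union>(blocks_in J)" unfolding UJ using assms(2) by simp
  ultimately show ?thesis using rtJ by (simp add: filter_raw_cop del: Union_iff)
qed

lemma raw_cop_tag_leg:
  assumes "J \<noteq> []" "x \<in># raw_cop J"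
  shows "(if fst x then lft x else rgt x) \<noteq> []"
proof -
  have "\<exists>Q\<in>admissible (blocks_in J). x = (hd J \<in> \<Union>Q, left_leg J Q, right_leg J Q)"
    using assms(2) unfolding raw_cop_def by (simp add: finite_admissible_blocks set_mset_sum)
  then obtain Q where Q: "x = (hd J \<in> \<Union>Q, left_leg J Q, right_leg J Q)" by blast
  have "left_leg J Q \<noteq> []" if "hd J \<in> \<Union>Q"
    using that assms(1) by (cases J) (auto simp: left_leg_def)
  moreover have "right_leg J Q \<noteq> []" if "hd J \<notin> \<Union>Q"
    using hd_runs[OF assms(1), of "\<lambda>x. x \<notin> \<Union>Q"] that unfolding right_leg_def by blast
  ultimately show ?thesis by (simp add: Q)
qed

end

text \<open>The rank of a point in \<open>{1..n}\<close> is the point itself, so every index pair is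
  the code of the full list of points of its own partition. In this way all letters inherit the
  properties of raw lists. The decoration of the point i sits at list index i - 1.\<close>

lemma dec_index_code:
  assumes "(L, as) \<in> dec_index"
  defines "n \<equiv> length as" and "a \<equiv> \<lambda>i. as ! (i - 1)"
  shows "raw_partition {1..n} L" "raw_partition.saturated L [1..<Suc n]" "[1..<Suc n] \<noteq> []"
    "raw_partition.blocks_in L [1..<Suc n] = L" "raw_partition.code L a [1..<Suc n] = (L, as)"
proof -
  have n: "n \<ge> 1" and L: "noncrossing {1..n} L" using assms by (auto simp: dec_index_def NC_def)
  interpret raw_partition "{1..n}" L a by unfold_locales (simp, rule L)
  show "raw_partition {1..n} L" by unfold_locales
  have J: "set [1..<Suc n] = {1..n}" by auto
  have U: "\<Union>L = {1..n}" using partition_onD1[OF part] by simp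
  show blocks_in: "blocks_in [1..<Suc n] = L" unfolding blocks_in_def J using U by blast
  show "saturated [1..<Suc n]" unfolding saturated_def blocks_in J U by (simp del: upt_Suc)
  show "[1..<Suc n] \<noteq> []" using n by simp
  have rank: "card {y \<in> {1..n}. y \<le> x} = x" if "x \<in> {1..n}" for x
  proof -
    have "{y \<in> {1..n}. y \<le> x} = {1..x}" using that by auto
    then show ?thesis by simp
  qed
  have "(\<lambda>x. card {y \<in> {1..n}. y \<le> x}) ` B = B" if "B \<in> L" for B
  proof -
    have "(\<lambda>x. card {y \<in> {1..n}. y \<le> x}) ` B = (\<lambda>x. x) ` B"
      by (rule image_cong[OF refl], rule rank) (use block_subset[OF that] in blast)
    then show ?thesis by simp
  qed
  then have "st L = (\<lambda>B. B) ` L" unfolding st_def U by (intro image_cong refl)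
  then have "st L = L" by simp
  moreover have "map a [1..<Suc n] = as"
    by (rule nth_equalityI) (simp_all add: a_def n_def del: upt_Suc)
  ultimately show "code [1..<Suc n] = (L, as)" unfolding code_def blocks_in by simp
qed

lemma nc_letter_coproduct: "letter_coproduct (dec_index :: (nat set set \<times> 'a list) set) nc_cop"
proof
  fix g :: "nat set set \<times> 'a list" and t l r
  assume g: "g \<in> dec_index"
  obtain L as where gL: "g = (L, as)" by (cases g)
  define n where "n = length as"
  define a where "a = (\<lambda>i. as ! (i - 1))"
  note dic = dec_index_code[OF g[unfolded gL], folded n_def a_def]
  interpret raw_partition "{1..n}" L a by (rule dic(1))
  define J where "J = [1..<Suc n]"
  have J: "saturated J" "J \<noteq> []" and code: "g = code J" using dic(2,3,5) by (simp_all only: J_def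
      gL not_False_eq_True)
  show "filter_mset (\<lambda>x. lft x = []) (nc_cop g) = {#(False, [], [g])#}"
    by (simp add: code nc_cop_code[OF J] filter_mset_image raw_cop_left_trivial[OF J(2)])
  show "filter_mset (\<lambda>x. rgt x = []) (nc_cop g) = {#(True, [g], [])#}"
    by (simp add: code nc_cop_code[OF J] filter_mset_image raw_cop_right_trivial[OF J])
  show "cop_left (word_cop nc_cop) (nc_cop g) = cop_right (word_cop nc_cop) (nc_cop g)"
    unfolding code by (rule nc_coassoc[OF J])
  assume "(t, l, r) \<in># nc_cop g"
  then obtain y where y: "y \<in># raw_cop J" "t = fst y" "l = map code (lft y)" "r = map code (rgt y)"
    by (auto simp: code nc_cop_code[OF J])
  have "code K \<in> dec_index" if "K \<in> set (lft y) \<union> set (rgt y)" for K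
    using code_dec_index saturated_leg[OF J(1) y(1) that] by simp
  then show "l \<in> lists dec_index \<and> r \<in> lists dec_index"
    unfolding y by (auto simp: in_lists_conv_set)
  from raw_cop_tag_leg[OF J(2) y(1)] show "(if t then l else r) \<noteq> []"
    unfolding y by (cases "fst y") simp_all
qed

section \<open>Linear maps on spans and tensor products\<close>

lemma linear_onI:
  "(\<And>x y. x \<in> V \<Longrightarrow> y \<in> V \<Longrightarrow> f (x + y) = f x + f y) \<Longrightarrow>
    (\<And>c x. x \<in> V \<Longrightarrow> f (s c x) = t c (f x)) \<Longrightarrow> linear_on s t V f"
  by (simp add: linear_on_def)

lemma linear_on_addD: "linear_on s t V f \<Longrightarrow> x \<in> V \<Longrightarrow> y \<in> V \<Longrightarrow> f (x + y) = f x + f y"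
  by (simp add: linear_on_def)

lemma linear_on_scaleD: "linear_on s t V f \<Longrightarrow> x \<in> V \<Longrightarrow> f (s c x) = t c (f x)"
  by (simp add: linear_on_def)

lemma linear_on_subset: "linear_on s t V f \<Longrightarrow> U \<subseteq> V \<Longrightarrow> linear_on s t U f"
  unfolding linear_on_def by blast

lemma linear_on_compose:
  assumes "linear_on s t V f" "linear_on t r W g" "\<And>x. x \<in> V \<Longrightarrow> f x \<in> W"
  shows "linear_on s r V (\<lambda>x. g (f x))"
  using assms unfolding linear_on_def by simp

lemma linear_on_plus:
  assumes "vector_space t" "linear_on s t V f" "linear_on s t V g"
  shows "linear_on s t V (\<lambda>x. f x + g x)"
proof -
  interpret vector_space t by fact
  show ?thesis using assms(2,3) by (simp add: linear_on_def scale_right_distrib add_ac)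
qed

lemma linear_on_minus:
  assumes "vector_space t" "linear_on s t V f" "linear_on s t V g"
  shows "linear_on s t V (\<lambda>x. f x - g x)"
proof -
  interpret vector_space t by fact
  show ?thesis using assms(2,3) by (simp add: linear_on_def scale_right_diff_distrib algebra_simps)
qed

lemma linear_on_scaled:
  assumes "vector_space t" "linear_on s t V f"
  shows "linear_on s t V (\<lambda>x. t c (f x))"
proof -
  interpret vector_space t by fact
  show ?thesis using assms(2) by (simp add: linear_on_def scale_right_distrib mult.commute)
qed

lemma linear_on_zero:
  assumes "vector_space t"
  shows "linear_on s t V (\<lambda>x. 0)"
proof -
  interpret vector_space t by fact
  show ?thesis by (simp add: linear_on_def)
qed

context vector_space
begin

lemma linear_on_0: "linear_on scale t V f \<Longrightarrow> subspace V \<Longrightarrow> f 0 = 0"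
  using linear_on_addD[of scale t V f 0 0] subspace_0 by simp

lemma subspace_sum_mset: "subspace V \<Longrightarrow> (\<And>x. x \<in># M \<Longrightarrow> g x \<in> V) \<Longrightarrow> (\<Sum>x\<in>#M. g x) \<in> V"
  by (induction M) (simp_all add: subspace_0 subspace_add)

lemma linear_on_sum_mset:
  assumes "linear_on scale t V f" "subspace V" "\<And>x. x \<in># M \<Longrightarrow> g x \<in> V"
  shows "f (\<Sum>x\<in>#M. g x) = (\<Sum>x\<in>#M. f (g x))"
  using assms(3)
proof (induction M)
  case (add x M)
  then show ?case
    using linear_on_addD[OF assms(1), of "g x" "\<Sum>x\<in>#M. g x"] subspace_sum_mset[OF assms(2),
        of M g] by simp
qed (simp add: linear_on_0[OF assms(1,2)])

lemma linear_on_span_eq: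
  assumes "linear_on scale t (span S) f" "linear_on scale t (span S) g"
    "\<And>x. x \<in> S \<Longrightarrow> f x = g x" "x \<in> span S"
  shows "f x = g x"
proof -
  \<comment> \<open>Membership is carried through the induction because \<open>f\<close> and
    \<open>g\<close> are additive on the span only.\<close>
  have "x \<in> span S \<and> f x = g x"
    using assms(4)
  proof (induction rule: span_induct_alt)
    case base
    then show ?case using linear_on_0[OF assms(1)] linear_on_0[OF assms(2)] by (simp add: span_zero)
  next
    case (step c x y)
    then have "scale c x \<in> span S" "x \<in> span S" by (simp_all add: span_scale span_base)
    with step show ?case
      using linear_on_addD[OF assms(1)] linear_on_addD[OF assms(2)] linear_on_scaleD[OF assms(1)]
        linear_on_scaleD[OF assms(2)] assms(3) by (simp add: span_add)
  qed
  then show ?thesis ..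
qed

lemma linear_on_span_into:
  assumes "vector_space t" "linear_on scale t (span S) f" "\<And>x. x \<in> S \<Longrightarrow>
      f x \<in> W" "module.subspace t W" "x \<in> span S"
  shows "f x \<in> W"
proof -
  interpret t: vector_space t by fact
  have "x \<in> span S \<and> f x \<in> W"
    using assms(5)
  proof (induction rule: span_induct_alt)
    case base
    then show ?case using linear_on_0[OF assms(2)] t.subspace_0[OF assms(4)] by (simp add:
        span_zero)
  next
    case (step c x y)
    then have "scale c x \<in> span S" "x \<in> span S" by (simp_all add: span_scale span_base)
    with step show ?case
      using linear_on_addD[OF assms(2)] linear_on_scaleD[OF assms(2)] assms(3)
      by (simp add: span_add t.subspace_add[OF assms(4)] t.subspace_scale[OF assms(4)])
  qed
  then show ?thesis ..
qed

end

text \<open>The condition under which \<open>lin_ext\<close> is not a junk value.\<close>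

definition extendable ::
    "('k::field \<Rightarrow> 'v::ab_group_add \<Rightarrow> 'v) \<Rightarrow> ('k \<Rightarrow> 'w::ab_group_add \<Rightarrow> 'w) \<Rightarrow>
     ('i \<Rightarrow> 'v) \<Rightarrow> 'i set \<Rightarrow> ('i \<Rightarrow> 'w) \<Rightarrow> bool"
  where "extendable s t g I f \<longleftrightarrow>
    (\<exists>D. linear_on s t (module.span s (g ` I)) D \<and> (\<forall>i\<in>I. D (g i) = f i))"

lemma lin_ext:
  assumes "extendable s t g I f"
  shows "linear_on s t (module.span s (g ` I)) (lin_ext s t g I f)"
    "i \<in> I \<Longrightarrow> lin_ext s t g I f (g i) = f i"
  using someI_ex[OF assms[unfolded extendable_def]] unfolding lin_ext_def by blast+

lemma extendableI:
  "linear_on s t (module.span s (g ` I)) D \<Longrightarrow> (\<And>i. i \<in> I \<Longrightarrow> D (g i) = f i) \<Longrightarrow> extendable s t g I f"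
  unfolding extendable_def by blast

text \<open>The outer extension must be legitimate for every \<open>y\<close> in the span. For
  \<open>y = g j\<close> this is hypothesis \<open>2\<close>, and extendability survives linear
  combinations, hence the induction for \<open>ext\<close>. Linearity in \<open>y\<close> is then
  tested at \<open>x = g i\<close>, where the value is the inner extension of
  \<open>f i\<close>.\<close>

lemma bilin_ext:
  assumes s: "vector_space s" and t: "vector_space t"
    and 1: "\<And>i. i \<in> I \<Longrightarrow> extendable s t g I (f i)" and 2: "\<And>j. j \<in> I \<Longrightarrow>
        extendable s t g I (\<lambda>i. f i j)"
  defines "V \<equiv> module.span s (g ` I)"
  shows "y \<in> V \<Longrightarrow> linear_on s t V (\<lambda>x. bilin_ext s t g I f x y)"
    "x \<in> V \<Longrightarrow> linear_on s t V (bilin_ext s t g I f x)"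
    "i \<in> I \<Longrightarrow> j \<in> I \<Longrightarrow> bilin_ext s t g I f (g i) (g j) = f i j"
proof -
  let ?b = "bilin_ext s t g I f"
  interpret s: vector_space s by fact
  interpret t: vector_space t by fact
  define h where "h y = (\<lambda>i. lin_ext s t g I (f i) y)" for y
  have h: "linear_on s t V (\<lambda>y. h y i)" "j \<in> I \<Longrightarrow> h (g j) i = f i j" if "i \<in> I" for i j
    using lin_ext[OF 1[OF that]] unfolding V_def h_def by auto
  have ext: "extendable s t g I (h y)" if "y \<in> V" for y
  proof -
    have "y \<in> V \<and> extendable s t g I (h y)"
      using that unfolding V_def
    proof (induction rule: s.span_induct_alt)
      case base
      have "h 0 i = 0" if "i \<in> I" for i
        using s.linear_on_0[OF h(1)[OF that]] by (simp add: V_def)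
      then have "extendable s t g I (h 0)"
        by (intro extendableI[where D = "\<lambda>x. 0"] linear_on_zero t) simp
      then show ?case by (simp add: s.span_zero)
    next
      case (step c x y)
      then obtain j where j: "j \<in> I" "x = g j" by blast
      have x: "x \<in> V" "y \<in> V" "s c x \<in> V"
        using step(1) step(2) by (auto simp: V_def s.span_base s.span_scale)
      obtain D where D: "linear_on s t V D" "\<forall>i\<in>I. D (g i) = f i j"
        using 2[OF j(1)] unfolding extendable_def V_def by blast
      obtain E where E: "linear_on s t V E" "\<forall>i\<in>I. E (g i) = h y i"
        using step(2) unfolding extendable_def V_def by blast
      have "h (s c x + y) i = t c (D (g i)) + E (g i)" if "i \<in> I" for i
        using linear_on_addD[OF h(1)[OF that] x(3,2)] linear_on_scaleD[OF h(1)[OF that] x(1)]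
          h(2)[OF that j(1)] D(2) E(2) that j(2) by simp
      then have "extendable s t g I (h (s c x + y))"
        by (intro extendableI[where D = "\<lambda>x. t c (D x) + E x"])
          (simp_all add: V_def[symmetric] D(1) E(1) linear_on_plus[OF t] linear_on_scaled[OF t])
      then show ?case using x by (simp add: V_def s.span_add)
    qed
    then show ?thesis ..
  qed
  have B: "?b x y = lin_ext s t g I (h y) x" for x y
    by (simp add: bilin_ext_def h_def)
  have lin1: "linear_on s t V (\<lambda>x. ?b x y)" if "y \<in> V" for y
    using lin_ext(1)[OF ext[OF that]] unfolding B V_def .
  have val: "?b (g i) y = h y i" if "y \<in> V" "i \<in> I" for y i
    unfolding B by (rule lin_ext(2)[OF ext[OF that(1)] that(2)])
  show "linear_on s t V (\<lambda>x. ?b x y)" if "y \<in> V" using lin1 that .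
  show "linear_on s t V (?b x)" if x: "x \<in> V"
  proof (rule linear_onI)
    fix y z assume yz: "y \<in> V" "z \<in> V"
    then have yz': "y + z \<in> V" by (simp add: V_def s.span_add)
    show "?b x (y + z) = ?b x y + ?b x z"
    proof (rule s.linear_on_span_eq[OF _ _ _ x[unfolded V_def]])
      show "linear_on s t (s.span (g ` I)) (\<lambda>x. ?b x (y + z))"
        using lin1[OF yz'] by (simp add: V_def)
      show "linear_on s t (s.span (g ` I)) (\<lambda>x. ?b x y + ?b x z)"
        using lin1[OF yz(1)] lin1[OF yz(2)] by (simp add: V_def linear_on_plus[OF t])
      fix v assume "v \<in> g ` I"
      then obtain i where i: "i \<in> I" "v = g i" by blast
      then show "?b v (y + z) = ?b v y + ?b v z"
        using linear_on_addD[OF h(1)[OF i(1)] yz] by (simp add: val yz yz')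
    qed
  next
    fix c y assume y: "y \<in> V"
    then have y': "s c y \<in> V" by (simp add: V_def s.span_scale)
    show "?b x (s c y) = t c (?b x y)"
    proof (rule s.linear_on_span_eq[OF _ _ _ x[unfolded V_def]])
      show "linear_on s t (s.span (g ` I)) (\<lambda>x. ?b x (s c y))"
        using lin1[OF y'] by (simp add: V_def)
      show "linear_on s t (s.span (g ` I)) (\<lambda>x. t c (?b x y))"
        using lin1[OF y] by (simp add: V_def linear_on_scaled[OF t])
      fix v assume "v \<in> g ` I"
      then obtain i where i: "i \<in> I" "v = g i" by blast
      then show "?b v (s c y) = t c (?b v y)"
        using linear_on_scaleD[OF h(1)[OF i(1)] y] by (simp add: val y y')
    qed
  qed
  show "?b (g i) (g j) = f i j" if "i \<in> I" "j \<in> I"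
    using val[of "g j" i] that h(2)[OF that] by (simp add: V_def s.span_base)
qed

section \<open>Extension of multilinear maps to tensor powers\<close>

lemma extendable_ten:
  assumes "vector_space t" "multilinear_on s t V \<phi>"
  shows "extendable fscale t (ten s V) (lists V) \<phi>"
  using ten_universal[OF assms] unfolding talg_def by (intro extendableI)

lemma tconc:
  shows "y \<in> talg s V \<Longrightarrow> linear_on fscale fscale (talg s V) (\<lambda>x. tconc s V x y)"
    "x \<in> talg s V \<Longrightarrow> linear_on fscale fscale (talg s V) (tconc s V x)"
    "xs \<in> lists V \<Longrightarrow> ys \<in> lists V \<Longrightarrow> tconc s V (ten s V xs) (ten s V ys) = ten s V (xs @ ys)"
proof -
  have ml: "linear_on s fscale V (\<lambda>x. ten s V (xs @ x # ys))" if "xs \<in> lists V"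
      "ys \<in> lists V" for xs ys
    using ten_multilinear[of s V] that unfolding multilinear_on_def by blast
  have 1: "extendable fscale fscale (ten s V) (lists V) (\<lambda>ys. ten s V (xs @ ys))" if "xs \<in> lists V"
      for xs
  proof (rule extendable_ten[OF vector_space_fscale], unfold multilinear_on_def, intro ballI)
    fix as bs assume "as \<in> lists V" "bs \<in> lists V"
    then show "linear_on s fscale V (\<lambda>x. ten s V (xs @ as @ x # bs))"
      using ml[of "xs @ as" bs] that by simp
  qed
  have 2: "extendable fscale fscale (ten s V) (lists V) (\<lambda>xs. ten s V (xs @ ys))" if "ys \<in> lists V"
      for ys
  proof (rule extendable_ten[OF vector_space_fscale], unfold multilinear_on_def, intro ballI)
    fix as bs assume "as \<in> lists V" "bs \<in> lists V"
    then show "linear_on s fscale V (\<lambda>x. ten s V ((as @ x # bs) @ ys))"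
      using ml[of as "bs @ ys"] that by simp
  qed
  note B = bilin_ext[OF vector_space_fscale vector_space_fscale, where g = "ten s V"
      and I = "lists V"
    and f = "\<lambda>xs ys. ten s V (xs @ ys)", OF 1 2, folded talg_def tconc_def]
  show "y \<in> talg s V \<Longrightarrow> linear_on fscale fscale (talg s V) (\<lambda>x. tconc s V x y)"
    "x \<in> talg s V \<Longrightarrow> linear_on fscale fscale (talg s V) (tconc s V x)"
    "xs \<in> lists V \<Longrightarrow> ys \<in> lists V \<Longrightarrow> tconc s V (ten s V xs) (ten s V ys) = ten s V (xs @ ys)"
    using B by blast+
qed

definition bilinear_on ::
    "('k \<Rightarrow> 'v::ab_group_add \<Rightarrow> 'v) \<Rightarrow> ('k \<Rightarrow> 'w::ab_group_add \<Rightarrow> 'w) \<Rightarrow> 'v set \<Rightarrow> ('v \<Rightarrow> 'v \<Rightarrow> 'w) \<Rightarrow> bool"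
  where "bilinear_on s t V f \<longleftrightarrow>
    (\<forall>y\<in>V. linear_on s t V (\<lambda>x. f x y)) \<and> (\<forall>x\<in>V. linear_on s t V (f x))"

lemma ten2_bilinear: "bilinear_on s fscale V (\<lambda>x y. ten2 s V (x, y))"
proof -
  have ml: "linear_on s fscale V (\<lambda>x. ten s V (xs @ x # ys))" if "xs \<in> lists V"
      "ys \<in> lists V" for xs ys
    using ten_multilinear[of s V] that unfolding multilinear_on_def by blast
  have "linear_on s fscale V (\<lambda>x. ten s V [x, y])" "linear_on s fscale V (\<lambda>x. ten s V [y, x])"
    if "y \<in> V" for y
    using ml[of "[]" "[y]"] ml[of "[y]" "[]"] that by simp_all
  then show ?thesis unfolding bilinear_on_def ten2_def by simp
qed

lemma ten2_in_talg:
  fixes s :: "'k::field \<Rightarrow> 'v::ab_group_add \<Rightarrow> 'v"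
  shows "x \<in> V \<Longrightarrow> y \<in> V \<Longrightarrow> ten2 s V (x, y) \<in> talg s V"
proof -
  interpret vector_space "fscale :: 'k \<Rightarrow> ('v list \<Rightarrow>\<^sub>0 'k) \<Rightarrow> _" by (rule vector_space_fscale)
  show "x \<in> V \<Longrightarrow> y \<in> V \<Longrightarrow> ten2 s V (x, y) \<in> talg s V"
    unfolding talg_def ten2_def prod.case by (intro span_base imageI) simp
qed

lemma tsquare_subset_talg:
  fixes s :: "'k::field \<Rightarrow> 'v::ab_group_add \<Rightarrow> 'v"
  assumes "U \<subseteq> V"
  shows "tsquare s V U \<subseteq> talg s V"
proof -
  interpret vector_space "fscale :: 'k \<Rightarrow> ('v list \<Rightarrow>\<^sub>0 'k) \<Rightarrow> _" by (rule vector_space_fscale)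
  have "ten2 s V ` (U \<times> U) \<subseteq> talg s V"
  proof clarify
    fix x y assume "x \<in> U" "y \<in> U"
    with assms show "ten2 s V (x, y) \<in> talg s V" by (intro ten2_in_talg) auto
  qed
  then show ?thesis unfolding tsquare_def by (rule span_minimal) (simp add: talg_def)
qed

text \<open>The projection onto \<open>U\<close> extends maps on \<open>U \<otimes> U\<close> to all of \<open>V \<otimes> V\<close>, so that no injectivity of
  \<open>U \<otimes> U \<rightarrow> V \<otimes> V\<close> is needed.\<close>

lemma extendable_ten2:
  assumes t: "vector_space t" and f: "bilinear_on s t U f" and UV: "U \<subseteq> V"
    and p: "linear_on s s V p" "\<And>x. x \<in> V \<Longrightarrow> p x \<in> U" "\<And>x. x \<in> U \<Longrightarrow> p x = x"
  shows "extendable fscale t (ten2 s V) (U \<times> U) (\<lambda>(x, y). f x y)"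
proof -
  \<comment> \<open>\<open>ten_universal\<close> asks for multilinearity on lists of every length;
    the value \<open>0\<close> off length two provides it without affecting pairs.\<close>
  define \<phi> where "\<phi> xs = (if length xs = 2 then f (p (xs ! 0)) (p (xs ! 1)) else 0)" for xs
  have "multilinear_on s t V \<phi>"
    unfolding multilinear_on_def
  proof (intro ballI)
    fix xs ys assume *: "xs \<in> lists V" "ys \<in> lists V"
    consider y where "xs = []" "ys = [y]" | x where "xs = [x]"
        "ys = []" | "length xs + length ys \<noteq> 1"
    proof -
      have "(\<exists>y. xs = [] \<and> ys = [y]) \<or> (\<exists>x. xs = [x] \<and> ys = []) \<or> length xs + length ys \<noteq> 1"
        by (cases xs; cases ys; cases "tl xs"; cases "tl ys") simp_all
      then show ?thesis using that by (elim disjE exE conjE)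
    qed
    then show "linear_on s t V (\<lambda>x. \<phi> (xs @ x # ys))"
    proof cases
      case 1
      then have "linear_on s t V (\<lambda>x. f (p x) (p y))"
        using f p(2) * unfolding bilinear_on_def by (intro linear_on_compose[OF p(1)]) auto
      then show ?thesis by (simp add: 1 \<phi>_def)
    next
      case 2
      then have "linear_on s t V (\<lambda>y. f (p x) (p y))"
        using f p(2) * unfolding bilinear_on_def by (intro linear_on_compose[OF p(1)]) auto
      then show ?thesis by (simp add: 2 \<phi>_def)
    next
      case 3
      then show ?thesis by (simp add: \<phi>_def linear_on_zero[OF t])
    qed
  qed
  from ten_universal[OF t this] obtain D where
    D: "linear_on fscale t (talg s V) D" "\<And>xs. xs \<in> lists V \<Longrightarrow> D (ten s V xs) = \<phi> xs" by blast
  show ?thesis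
  proof (rule extendableI[where D = D])
    show "linear_on fscale t (module.span fscale (ten2 s V ` (U \<times> U))) D"
      by (rule linear_on_subset[OF D(1)]) (rule tsquare_subset_talg[OF UV, unfolded tsquare_def])
    fix i assume i: "i \<in> U \<times> U"
    obtain x y where xy: "i = (x, y)" by (cases i)
    then show "D (ten2 s V i) = (case i of (x, y) \<Rightarrow> f x y)"
      using D(2)[of "[x, y]"] i UV p(3) by (auto simp: ten2_def \<phi>_def)
  qed
qed

lemma linear_on_ident: "linear_on s s V (\<lambda>x. x)"
  by (simp add: linear_on_def)

lemmas extendable_ten2_full = extendable_ten2[OF _ _ order_refl linear_on_ident]

lemma tsquare_mult:
  assumes closed: "\<And>x y. x \<in> V \<Longrightarrow> y \<in> V \<Longrightarrow> m x y \<in> V"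
    and left: "\<And>y. y \<in> V \<Longrightarrow> linear_on s s V (\<lambda>x. m x y)"
    and right: "\<And>x. x \<in> V \<Longrightarrow> linear_on s s V (m x)"
  shows "y \<in> tsquare s V V \<Longrightarrow> linear_on fscale fscale (tsquare s V V) (\<lambda>x. tsquare_mult s V m x y)"
    "x \<in> tsquare s V V \<Longrightarrow> linear_on fscale fscale (tsquare s V V) (tsquare_mult s V m x)"
    "a \<in> V \<Longrightarrow> b \<in> V \<Longrightarrow> c \<in> V \<Longrightarrow> d \<in> V \<Longrightarrow>
      tsquare_mult s V m (ten2 s V (a, b)) (ten2 s V (c, d)) = ten2 s V (m a c, m b d)"
proof -
  have t1: "linear_on s fscale V (\<lambda>x. ten2 s V (x, y))" and t2: "linear_on s fscale V (\<lambda>x. ten2 s V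
      (y, x))"
    if "y \<in> V" for y
    using ten2_bilinear[of s V] that unfolding bilinear_on_def by blast+
  let ?f = "\<lambda>(a, b) (c, d). ten2 s V (m a c, m b d)"
  have 1: "extendable fscale fscale (ten2 s V) (V \<times> V) (?f i)" if i: "i \<in> V \<times> V" for i
  proof -
    obtain a b where ab: "i = (a, b)" "a \<in> V" "b \<in> V" using i by (elim SigmaE)
    have "bilinear_on s fscale V (\<lambda>c d. ten2 s V (m a c, m b d))"
      unfolding bilinear_on_def
      by (intro conjI ballI linear_on_compose[OF right t1] linear_on_compose[OF right t2] closed ab)
    from extendable_ten2_full[OF vector_space_fscale this] show ?thesis by (simp add: ab)
  qed
  have 2: "extendable fscale fscale (ten2 s V) (V \<times> V) (\<lambda>i. ?f i j)" if j: "j \<in> V \<times> V" for j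
  proof -
    obtain c d where cd: "j = (c, d)" "c \<in> V" "d \<in> V" using j by (elim SigmaE)
    have "bilinear_on s fscale V (\<lambda>a b. ten2 s V (m a c, m b d))"
      unfolding bilinear_on_def
      by (intro conjI ballI linear_on_compose[OF left t1] linear_on_compose[OF left t2] closed cd)
    from extendable_ten2_full[OF vector_space_fscale this] show ?thesis by (simp add: cd
        case_prod_unfold)
  qed
  note B = bilin_ext[OF vector_space_fscale vector_space_fscale 1 2,
      folded tsquare_def tsquare_mult_def]
  show "y \<in> tsquare s V V \<Longrightarrow> linear_on fscale fscale (tsquare s V V) (\<lambda>x. tsquare_mult s V m x y)"
    by (rule B(1))
  show "x \<in> tsquare s V V \<Longrightarrow> linear_on fscale fscale (tsquare s V V) (tsquare_mult s V m x)"
    by (rule B(2))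
  show "a \<in> V \<Longrightarrow> b \<in> V \<Longrightarrow> c \<in> V \<Longrightarrow> d \<in> V \<Longrightarrow>
      tsquare_mult s V m (ten2 s V (a, b)) (ten2 s V (c, d)) = ten2 s V (m a c, m b d)"
    using B(3)[of "(a, b)" "(c, d)"] by simp
qed

section \<open>Selecting terms by the factor that receives the first point\<close>

lemma filter_bind_image:
  assumes "\<And>x y. Z (f x y) \<longleftrightarrow> P x \<and> Q y"
  shows "filter_mset Z (\<Sum>x\<in>#M. image_mset (f x) (D x)) =
    (\<Sum>x\<in>#filter_mset P M. image_mset (f x) (filter_mset Q (D x)))"
  by (induction M) (auto simp: filter_mset_image assms)

text \<open>Each half-coproduct identity concerns the terms of one threefold tag. Fixing this tag
  means one condition on the outer and one on the inner tag, so filtering reduced coassociativity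
  gives the identity.\<close>

lemma cop_left_filter:
  assumes "\<And>t t'. Z (tag_left t t') \<longleftrightarrow> P t \<and> Q t'"
  shows "cop_left (\<lambda>w. filter_mset (\<lambda>x. Q (fst x)) (D w)) (filter_mset (\<lambda>x. P (fst x)) M) =
    filter_mset (\<lambda>x. Z (fst x)) (cop_left D M)"
  unfolding cop_left_def by (rule filter_bind_image[symmetric]) (simp add: assms)

lemma cop_right_filter:
  assumes "\<And>t t'. Z (tag_right t t') \<longleftrightarrow> P t \<and> Q t'"
  shows "cop_right (\<lambda>w. filter_mset (\<lambda>x. Q (fst x)) (D w)) (filter_mset (\<lambda>x. P (fst x)) M) =
    filter_mset (\<lambda>x. Z (fst x)) (cop_right D M)"
  unfolding cop_right_def by (rule filter_bind_image[symmetric]) (simp add: assms)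

section \<open>Algebras spanned by words and tensors of words\<close>

definition word_ten2 ::
    "('k::field \<Rightarrow> 'b::ab_group_add \<Rightarrow> 'b) \<Rightarrow> 'b set \<Rightarrow> ('g list \<Rightarrow> 'b) \<Rightarrow> 'g tagged_cop \<Rightarrow> ('b list \<Rightarrow>\<^sub>0
        'k)"
  where "word_ten2 s V e M = (\<Sum>x\<in>#M. ten2 s V (e (lft x), e (rgt x)))"

lemma word_ten2_add: "word_ten2 s V e (M + N) = word_ten2 s V e M + word_ten2 s V e N"
  by (simp add: word_ten2_def)

lemma word_ten2_add_mset:
  "word_ten2 s V e (add_mset x M) = ten2 s V (e (lft x), e (rgt x)) + word_ten2 s V e M"
  by (simp add: word_ten2_def)

text \<open>Only spanning by the vectors \<open>e w\<close> is available, not their independence.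
  Identities are therefore proved by checking that both sides are linear and agree on words.\<close>

locale word_algebra = vector_space s
  for s :: "'k::field \<Rightarrow> 'b::ab_group_add \<Rightarrow> 'b" +
  fixes G :: "'g set" and e :: "'g list \<Rightarrow> 'b" and V :: "'b set" and m :: "'b \<Rightarrow> 'b \<Rightarrow> 'b"
  assumes V: "V = span (e ` lists G)"
    and m_left: "y \<in> V \<Longrightarrow> linear_on s s V (\<lambda>x. m x y)"
    and m_right: "x \<in> V \<Longrightarrow> linear_on s s V (m x)"
    and m_e: "a \<in> lists G \<Longrightarrow> b \<in> lists G \<Longrightarrow> m (e a) (e b) = e (a @ b)"
begin

sublocale F: vector_space "fscale :: 'k \<Rightarrow> ('b list \<Rightarrow>\<^sub>0 'k) \<Rightarrow> _" by (rule vector_space_fscale)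

abbreviation "T \<equiv> tsquare s V V"
abbreviation "\<Theta> \<equiv> word_ten2 s V e"
abbreviation "legs_in W M \<equiv> \<forall>x\<in>#M. lft x \<in> W \<and> rgt x \<in> W"

lemma subspace_V: "subspace V" by (simp add: V)

lemma subspace_T: "F.subspace (tsquare s V U)" by (simp add: tsquare_def)

lemma e_V: "w \<in> lists G \<Longrightarrow> e w \<in> V" unfolding V by (intro span_base imageI)

lemma V_eq:
  "linear_on s t V f \<Longrightarrow> linear_on s t V g \<Longrightarrow> (\<And>w. w \<in> lists G \<Longrightarrow> f (e w) = g (e w)) \<Longrightarrow> x \<in> V \<Longrightarrow>
      f x = g x"
  unfolding V by (rule linear_on_span_eq[where S = "e ` lists G" and t = t]) auto

lemma m_closed: "\<And>x y. x \<in> V \<Longrightarrow> y \<in> V \<Longrightarrow> m x y \<in> V"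
proof -
  have 1: "m x (e b) \<in> V" if x: "x \<in> V" and b: "b \<in> lists G" for x b
  proof (rule linear_on_span_into[OF vector_space_axioms m_left[OF e_V[OF b],
      unfolded V] _ subspace_V x[unfolded V]])
    fix v assume "v \<in> e ` lists G"
    then obtain a where "a \<in> lists G" "v = e a" by blast
    then show "m v (e b) \<in> V" using e_V[of "a @ b"] b by (simp add: m_e)
  qed
  fix x y assume x: "x \<in> V" and y: "y \<in> V"
  show "m x y \<in> V"
  proof (rule linear_on_span_into[OF vector_space_axioms m_right[OF x,
      unfolded V] _ subspace_V y[unfolded V]])
    fix v assume "v \<in> e ` lists G"
    then show "m x v \<in> V" using 1[OF x] by blast
  qed
qed

lemma m_assoc:
  assumes x: "x \<in> V" and y: "y \<in> V" and z: "z \<in> V"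
  shows "m (m x y) z = m x (m y z)"
proof -
  \<comment> \<open>Associativity is carried from words to the span one argument at a time: the
    last, then the middle, then the first.\<close>
  have 1: "m (m (e a) (e b)) z = m (e a) (m (e b) z)" if a: "a \<in> lists G" and b: "b \<in> lists G"
      for a b
  proof (rule V_eq[where t = s and f = "\<lambda>z. m (m (e a) (e b)) z", OF _ _ _ z])
    show "linear_on s s V (\<lambda>z. m (m (e a) (e b)) z)" by (intro m_right m_closed e_V a b)
    show "linear_on s s V (\<lambda>z. m (e a) (m (e b) z))"
      by (intro linear_on_compose[OF m_right m_right] m_closed e_V a b)
  qed (use a b in \<open>simp add: m_e\<close>)
  have 2: "m (m (e a) y) z = m (e a) (m y z)" if a: "a \<in> lists G" for a
  proof (rule V_eq[where t = s and f = "\<lambda>y. m (m (e a) y) z", OF _ _ _ y])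
    show "linear_on s s V (\<lambda>y. m (m (e a) y) z)"
      by (intro linear_on_compose[OF m_right m_left] m_closed e_V a z)
    show "linear_on s s V (\<lambda>y. m (e a) (m y z))"
      by (intro linear_on_compose[OF m_left m_right] m_closed e_V a z)
  qed (rule 1[OF a])
  show ?thesis
  proof (rule V_eq[where t = s and f = "\<lambda>x. m (m x y) z", OF _ _ _ x])
    show "linear_on s s V (\<lambda>x. m (m x y) z)"
      by (intro linear_on_compose[OF m_left m_left] m_closed y z)
    show "linear_on s s V (\<lambda>x. m x (m y z))" by (intro m_left m_closed y z)
  qed (rule 2)
qed

lemma unit_left: "x \<in> V \<Longrightarrow> m (e []) x = x"
  by (rule V_eq[where t = s, OF m_right linear_on_ident]) (simp_all add: m_e e_V)

lemma unit_right: "x \<in> V \<Longrightarrow> m x (e []) = x"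
  by (rule V_eq[where t = s, OF m_left linear_on_ident]) (simp_all add: m_e e_V)

lemmas tm = tsquare_mult[where V = V and m = m and s = s, OF m_closed m_left m_right]

lemma ten2_left: "y \<in> V \<Longrightarrow> linear_on s fscale V (\<lambda>x. ten2 s V (x, y))"
  and ten2_right: "x \<in> V \<Longrightarrow> linear_on s fscale V (\<lambda>y. ten2 s V (x, y))"
  using ten2_bilinear[of s V] unfolding bilinear_on_def by blast+

lemma ten2_T: "x \<in> U \<Longrightarrow> y \<in> U \<Longrightarrow> ten2 s V (x, y) \<in> tsquare s V U"
  unfolding tsquare_def by (intro F.span_base imageI) simp

lemma \<Theta>_T: "legs_in (lists G) M \<Longrightarrow> \<Theta> M \<in> T"
  unfolding word_ten2_def by (intro F.subspace_sum_mset subspace_T ten2_T e_V) simp_all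

text \<open>The tags \<open>t\<close> are arbitrary because \<open>\<Theta>\<close> forgets them, so
  the result fits both the recursion of \<open>word_cop\<close> and the case distinction of
  \<open>word_cop_append\<close>.\<close>

lemma tm_\<Theta>:
  assumes M: "legs_in (lists G) M" and N: "legs_in (lists G) N"
  shows "tsquare_mult s V m (\<Theta> M) (\<Theta> N) =
    \<Theta> (\<Sum>x\<in>#M. image_mset (\<lambda>y. (t x y, lft x @ lft y, rgt x @ rgt y)) N)"
proof -
  have "tsquare_mult s V m (\<Theta> M) (\<Theta> N) =
    (\<Sum>x\<in>#M. tsquare_mult s V m (ten2 s V (e (lft x), e (rgt x))) (\<Theta> N))"
    unfolding word_ten2_def[of s V e M]
    by (rule F.linear_on_sum_mset[OF tm(1)]) (use M in \<open>simp_all add: \<Theta>_T[OF N] subspace_T ten2_T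
        e_V\<close>)
  also have "\<dots> = (\<Sum>x\<in>#M. \<Sum>y\<in>#N. tsquare_mult s V m (ten2 s V (e (lft x), e (rgt x)))
    (ten2 s V (e (lft y), e (rgt y))))"
    unfolding word_ten2_def
  proof (rule sum_mset_cong)
    fix x assume "x \<in># M"
    then show "tsquare_mult s V m (ten2 s V (e (lft x), e (rgt x)))
        (\<Sum>y\<in>#N. ten2 s V (e (lft y), e (rgt y))) =
      (\<Sum>y\<in>#N. tsquare_mult s V m (ten2 s V (e (lft x), e (rgt x)))
        (ten2 s V (e (lft y), e (rgt y))))"
      by (intro F.linear_on_sum_mset[OF tm(2)]) (use M N in \<open>simp_all add: subspace_T ten2_T e_V\<close>)
  qed
  also have "\<dots> = (\<Sum>x\<in>#M. \<Sum>y\<in>#N. ten2 s V (e (lft x @ lft y), e (rgt x @ rgt y)))"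
    using M N by (intro sum_mset_cong) (simp add: tm(3) e_V m_e)
  finally show ?thesis by (simp add: word_ten2_def bind_simps)
qed

end

definition word_ten3 ::
    "('k::field \<Rightarrow> 'b::ab_group_add \<Rightarrow> 'b) \<Rightarrow> 'b set \<Rightarrow> ('g list \<Rightarrow> 'b) \<Rightarrow>
     (nat \<times> 'g list \<times> 'g list \<times> 'g list) multiset \<Rightarrow> ('b list \<Rightarrow>\<^sub>0 'k)"
  where "word_ten3 s V e N =
    (\<Sum>x\<in>#N. ten s V [e (lft x), e (fst (rgt x)), e (snd (rgt x))])"

context word_algebra
begin

lemma subspace_talg: "F.subspace (talg s V)" by (simp add: talg_def)

lemma ten_talg: "xs \<in> lists V \<Longrightarrow> ten s V xs \<in> talg s V"
  unfolding talg_def by (intro F.span_base imageI)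

lemma ten1_linear: "linear_on s fscale V (\<lambda>y. ten s V [y])"
proof -
  have "linear_on s fscale V (\<lambda>y. ten s V ([] @ y # []))"
    by (rule bspec[OF bspec[OF ten_multilinear[of s V, unfolded multilinear_on_def]]]) simp_all
  then show ?thesis by simp
qed

lemma \<Theta>_talg: "legs_in (lists G) M \<Longrightarrow> \<Theta> M \<in> talg s V"
  using \<Theta>_T tsquare_subset_talg[OF order_refl] by blast

text \<open>The dictionary between f \<otimes> I, I \<otimes> f and the iterated multisets. It
  serves all words with \<open>U = V\<close>, where \<open>p\<close> is the identity, and the
  nonempty words with the augmentation ideal, where \<open>p\<close> is a proper projection.\<close>

lemma tmap:
  assumes W: "W \<subseteq> lists G" and U: "U = span (e ` W)"
    and p: "linear_on s s V p" "\<forall>x\<in>V. p x \<in> U" "\<forall>x\<in>U. p x = x"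
    and f_lin: "linear_on s fscale U f" and f_e: "\<forall>w\<in>W. f (e w) = \<Theta> (D w)"
    and D_legs: "\<forall>w\<in>W. legs_in (lists G) (D w)"
  shows "linear_on fscale fscale (tsquare s V U) (tmap_left s V U f)"
    "linear_on fscale fscale (tsquare s V U) (tmap_right s V U f)"
    "legs_in W M \<Longrightarrow> tmap_left s V U f (\<Theta> M) = word_ten3 s V e (cop_left D M)"
    "legs_in W M \<Longrightarrow> tmap_right s V U f (\<Theta> M) = word_ten3 s V e (cop_right D M)"
proof -
  note f = f_lin bspec[OF f_e] and D = bspec[OF D_legs]
  have UV: "U \<subseteq> V" unfolding U V by (intro span_mono image_mono W)
  have eU: "e w \<in> U" if "w \<in> W" for w unfolding U using that by (intro span_base imageI)
  have ft: "f x \<in> talg s V" if x: "x \<in> U" for x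
  proof (rule linear_on_span_into[OF F.vector_space_axioms f(1)[unfolded U] _ subspace_talg
      x[unfolded U]])
    fix v assume "v \<in> e ` W"
    then obtain w where "w \<in> W" "v = e w" by blast
    then show "f v \<in> talg s V" using \<Theta>_talg[OF D] by (simp add: f(2))
  qed
  have t1: "ten s V [y] \<in> talg s V" if "y \<in> U" for y using that UV by (intro ten_talg) auto
  have t1l: "linear_on s fscale U (\<lambda>y. ten s V [y])" by (rule linear_on_subset[OF ten1_linear UV])
  have bl: "bilinear_on s fscale U (\<lambda>x y. tconc s V (f x) (ten s V [y]))"
    unfolding bilinear_on_def
    by (intro conjI ballI linear_on_compose[OF f(1) tconc(1)] linear_on_compose[OF t1l tconc(2)] ft
        t1)
  have br: "bilinear_on s fscale U (\<lambda>x y. tconc s V (ten s V [x]) (f y))"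
    unfolding bilinear_on_def
    by (intro conjI ballI linear_on_compose[OF t1l tconc(1)] linear_on_compose[OF f(1) tconc(2)] ft
        t1)
  note extl = extendable_ten2[OF F.vector_space_axioms bl UV p(1) bspec[OF p(2)] bspec[OF p(3)]]
  note extr = extendable_ten2[OF F.vector_space_axioms br UV p(1) bspec[OF p(2)] bspec[OF p(3)]]
  show linl: "linear_on fscale fscale (tsquare s V U) (tmap_left s V U f)"
    using lin_ext(1)[OF extl] unfolding tsquare_def tmap_left_def .
  show linr: "linear_on fscale fscale (tsquare s V U) (tmap_right s V U f)"
    using lin_ext(1)[OF extr] unfolding tsquare_def tmap_right_def .
  have vall: "tmap_left s V U f (ten2 s V (x, y)) = tconc s V (f x) (ten s V [y])" if "x \<in> U"
      "y \<in> U" for x y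
    using lin_ext(2)[OF extl, of "(x, y)"] that unfolding tmap_left_def by simp
  have valr: "tmap_right s V U f (ten2 s V (x, y)) = tconc s V (ten s V [x]) (f y)" if "x \<in> U"
      "y \<in> U" for x y
    using lin_ext(2)[OF extr, of "(x, y)"] that unfolding tmap_right_def by simp
  have tl: "tconc s V (\<Theta> N) (ten s V [e r]) =
      (\<Sum>y\<in>#N. ten s V [e (lft y), e (rgt y), e r])" if N: "legs_in (lists G) N"
          and r: "r \<in> lists G" for N r
  proof -
    have "tconc s V (\<Theta> N) (ten s V [e r]) =
        (\<Sum>y\<in>#N. tconc s V (ten2 s V (e (lft y), e (rgt y))) (ten s V [e r]))"
      unfolding word_ten2_def
      by (rule F.linear_on_sum_mset[OF tconc(1)[OF ten_talg] subspace_talg ten2_in_talg])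
        (use N r in \<open>simp_all add: e_V\<close>)
    also have "\<dots> = (\<Sum>y\<in>#N. ten s V [e (lft y), e (rgt y), e r])"
      using N r by (intro sum_mset_cong) (simp add: ten2_def tconc(3) e_V)
    finally show ?thesis .
  qed
  have tr: "tconc s V (ten s V [e l]) (\<Theta> N) =
      (\<Sum>y\<in>#N. ten s V [e l, e (lft y), e (rgt y)])" if N: "legs_in (lists G) N"
          and l: "l \<in> lists G" for N l
  proof -
    have "tconc s V (ten s V [e l]) (\<Theta> N) =
        (\<Sum>y\<in>#N. tconc s V (ten s V [e l]) (ten2 s V (e (lft y), e (rgt y))))"
      unfolding word_ten2_def
      by (rule F.linear_on_sum_mset[OF tconc(2)[OF ten_talg] subspace_talg ten2_in_talg])
        (use N l in \<open>simp_all add: e_V\<close>)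
    also have "\<dots> = (\<Sum>y\<in>#N. ten s V [e l, e (lft y), e (rgt y)])"
      using N l by (intro sum_mset_cong) (simp add: ten2_def tconc(3) e_V)
    finally show ?thesis .
  qed
  show "tmap_left s V U f (\<Theta> M) = word_ten3 s V e (cop_left D M)" if M: "legs_in W M"
  proof -
    have "tmap_left s V U f (\<Theta> M) = (\<Sum>x\<in>#M. tmap_left s V U f (ten2 s V (e (lft x), e (rgt x))))"
      unfolding word_ten2_def
      by (rule F.linear_on_sum_mset[OF linl subspace_T ten2_T]) (use M in \<open>simp_all add: eU\<close>)
    also have "\<dots> = (\<Sum>x\<in>#M. \<Sum>y\<in>#D (lft x). ten s V [e (lft y), e (rgt y), e (rgt x)])"
    proof (rule sum_mset_cong)
      fix x assume "x \<in># M"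
      then have x: "lft x \<in> W" "rgt x \<in> W" using M by blast+
      then show "tmap_left s V U f (ten2 s V (e (lft x), e (rgt x))) =
          (\<Sum>y\<in>#D (lft x). ten s V [e (lft y), e (rgt y), e (rgt x)])"
        using tl[OF D[OF x(1)] subsetD[OF W x(2)]] by (simp only: vall eU f(2))
    qed
    finally show ?thesis by (simp add: word_ten3_def cop_left_def bind_simps)
  qed
  show "tmap_right s V U f (\<Theta> M) = word_ten3 s V e (cop_right D M)" if M: "legs_in W M"
  proof -
    have "tmap_right s V U f (\<Theta> M) = (\<Sum>x\<in>#M. tmap_right s V U f (ten2 s V (e (lft x), e (rgt x))))"
      unfolding word_ten2_def
      by (rule F.linear_on_sum_mset[OF linr subspace_T ten2_T]) (use M in \<open>simp_all add: eU\<close>)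
    also have "\<dots> = (\<Sum>x\<in>#M. \<Sum>y\<in>#D (rgt x). ten s V [e (lft x), e (lft y), e (rgt y)])"
    proof (rule sum_mset_cong)
      fix x assume "x \<in># M"
      then have x: "lft x \<in> W" "rgt x \<in> W" using M by blast+
      then show "tmap_right s V U f (ten2 s V (e (lft x), e (rgt x))) =
          (\<Sum>y\<in>#D (rgt x). ten s V [e (lft x), e (lft y), e (rgt y)])"
        using tr[OF D[OF x(2)] subsetD[OF W x(1)]] by (simp only: valr eU f(2))
    qed
    finally show ?thesis by (simp add: word_ten3_def cop_right_def bind_simps)
  qed
qed

end

section \<open>The bialgebra and its half-coproducts on an algebra spanned by words\<close>

locale word_bialgebra = word_algebra s G e V m + letter_coproduct G C
  for s :: "'k::field \<Rightarrow> 'b::ab_group_add \<Rightarrow> 'b" and G :: "'g set" and e V m C +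
  fixes \<epsilon> :: "'b \<Rightarrow> 'k" and B :: "'b set" and \<Delta> \<Delta>\<^sub>p \<Delta>\<^sub>s :: "'b \<Rightarrow> ('b list \<Rightarrow>\<^sub>0 'k)"
  assumes B: "B = span (e ` (lists G - {[]}))"
    and eps_linear: "linear_on s (*) V \<epsilon>"
    and eps_e: "w \<in> lists G \<Longrightarrow> \<epsilon> (e w) = (if w = [] then 1 else 0)"
    and cop_linear: "linear_on s fscale V \<Delta>"
    and cop_e: "w \<in> lists G \<Longrightarrow> \<Delta> (e w) = word_ten2 s V e (word_cop C w)"
    and prec_linear: "linear_on s fscale B \<Delta>\<^sub>p"
    and prec_e: "w \<in> lists G \<Longrightarrow> w \<noteq> [] \<Longrightarrow>
      \<Delta>\<^sub>p (e w) = word_ten2 s V e (filter_mset (\<lambda>x. fst x) (reduced (word_cop C w)))"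
    and succ_linear: "linear_on s fscale B \<Delta>\<^sub>s"
    and succ_e: "w \<in> lists G \<Longrightarrow> w \<noteq> [] \<Longrightarrow>
      \<Delta>\<^sub>s (e w) = word_ten2 s V e (filter_mset (\<lambda>x. \<not> fst x) (reduced (word_cop C w)))"
begin

abbreviation "R \<equiv> \<lambda>w. reduced (word_cop C w)"
abbreviation "W \<equiv> lists G - {[]}"

lemma legs_cop: "w \<in> lists G \<Longrightarrow> legs_in (lists G) (word_cop C w)"
  using word_legs_closed by blast

lemma legs_R: "w \<in> lists G \<Longrightarrow> legs_in W (filter_mset P (R w))"
  using word_legs_closed[of w] by (auto simp: reduced_def)

lemma legs_R': "w \<in> lists G \<Longrightarrow> legs_in W (R w)"
  using legs_R[of w "\<lambda>x. True"] by simp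

lemma BV: "B \<subseteq> V" unfolding B V by (intro span_mono) auto

lemma subspace_B: "subspace B" by (simp add: B)

lemma e_B: "w \<in> W \<Longrightarrow> e w \<in> B" unfolding B by (intro span_base imageI)

lemma B_eq:
  "linear_on s t B f \<Longrightarrow> linear_on s t B g \<Longrightarrow> (\<And>w. w \<in> W \<Longrightarrow> f (e w) = g (e w)) \<Longrightarrow> x \<in> B \<Longrightarrow> f x = g x"
  unfolding B by (rule linear_on_span_eq[where S = "e ` W" and t = t]) auto

lemma one_V: "e [] \<in> V" by (rule e_V) simp

lemma vs_mult: "vector_space ((*) :: 'k \<Rightarrow> 'k \<Rightarrow> 'k)"
  by unfold_locales (auto simp: algebra_simps)

lemma eps_B: "b \<in> B \<Longrightarrow> \<epsilon> b = 0"
  by (rule B_eq[where t = "(*)", OF linear_on_subset[OF eps_linear BV] linear_on_zero[OF vs_mult]])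
    (auto simp: eps_e)

text \<open>The projection onto the augmentation ideal \<open>B\<close> along the unit; it takes the
  role of \<open>p\<close> in \<open>tmap\<close>.\<close>

definition proj :: "'b \<Rightarrow> 'b" where "proj x = x - s (\<epsilon> x) (e [])"

lemma proj: "linear_on s s V proj" "x \<in> V \<Longrightarrow> proj x \<in> B" "x \<in> B \<Longrightarrow> proj x = x"
proof -
  show lin: "linear_on s s V proj"
    unfolding proj_def
    by (intro linear_on_minus[OF vector_space_axioms] linear_on_ident linear_onI)
      (simp_all add: linear_on_addD[OF eps_linear] linear_on_scaleD[OF eps_linear]
          scale_left_distrib)
  show "proj x \<in> B" if x: "x \<in> V"
  proof (rule linear_on_span_into[OF vector_space_axioms lin[unfolded V] _ subspace_B x[unfolded
      V]])
    fix v assume "v \<in> e ` lists G"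
    then obtain w where w: "w \<in> lists G" "v = e w" by blast
    show "proj v \<in> B"
      by (cases "w = []") (use w e_B[of w] subspace_0[OF subspace_B] in \<open>simp_all add: proj_def
          eps_e\<close>)
  qed
  show "x \<in> B \<Longrightarrow> proj x = x" by (simp add: proj_def eps_B)
qed

lemmas tmap_V = tmap[where p = "\<lambda>x. x" and W = "lists G" and U = V, OF order_refl V linear_on_ident]
lemmas tmap_B = tmap[where p = proj and W = W and U = B, OF Diff_subset B proj(1)]

lemma cop_T: "x \<in> V \<Longrightarrow> \<Delta> x \<in> T"
proof (rule linear_on_span_into[OF F.vector_space_axioms cop_linear[unfolded V] _ subspace_T,
    folded V])
  fix v assume "v \<in> e ` lists G"
  then obtain w where "w \<in> lists G" "v = e w" by blast
  then show "\<Delta> v \<in> T" using \<Theta>_T[OF legs_cop] by (simp only: cop_e)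
qed

lemma cop_coassoc:
  assumes x: "x \<in> V"
  shows "tmap_left s V V \<Delta> (\<Delta> x) = tmap_right s V V \<Delta> (\<Delta> x)"
proof -
  have e: "\<forall>w\<in>lists G. \<Delta> (e w) = \<Theta> (word_cop C w)" "\<forall>w\<in>lists G. legs_in (lists G) (word_cop C w)"
    using cop_e legs_cop by blast+
  note tm3 = tmap_V[OF _ _ cop_linear e, simplified]
  show ?thesis
  proof (rule V_eq[where t = fscale, OF _ _ _ x])
    show "linear_on s fscale V (\<lambda>x. tmap_left s V V \<Delta> (\<Delta> x))"
      by (rule linear_on_compose[OF cop_linear tm3(1) cop_T])
    show "linear_on s fscale V (\<lambda>x. tmap_right s V V \<Delta> (\<Delta> x))"
      by (rule linear_on_compose[OF cop_linear tm3(2) cop_T])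
    fix w assume w: "w \<in> lists G"
    then show "tmap_left s V V \<Delta> (\<Delta> (e w)) = tmap_right s V V \<Delta> (\<Delta> (e w))"
      using tmap_V(3,4)[OF _ _ cop_linear e legs_cop[OF w]] by (simp add: cop_e word_coassoc)
  qed
qed

lemma reduced_T:
  assumes lin: "linear_on s fscale B f" and f: "\<forall>w\<in>W. f (e w) = \<Theta> (D w)"
    and D: "\<forall>w\<in>W. legs_in W (D w)" and x: "x \<in> B"
  shows "f x \<in> tsquare s V B"
proof (rule linear_on_span_into[OF F.vector_space_axioms lin[unfolded B] _ subspace_T x[unfolded
    B]])
  fix v assume "v \<in> e ` W"
  then obtain w where w: "w \<in> W" "v = e w" by blast
  then have "legs_in W (D w)" using D by blast
  then have "\<Theta> (D w) \<in> tsquare s V B"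
    unfolding word_ten2_def by (intro F.subspace_sum_mset subspace_T ten2_T e_B) blast+
  then show "f v \<in> tsquare s V B" using w f by simp
qed

text \<open>Common pattern of the three half-coproduct identities: an equality of multisets for
  every nonempty word gives the identity on \<open>B\<close>. That all legs are nonempty words keeps
  the outer values in the tensor square of \<open>B\<close>, where the inner maps act.\<close>

lemma reduced_identity:
  assumes f: "linear_on s fscale B f" "\<forall>w\<in>W. f (e w) = \<Theta> (D w)" "\<forall>w\<in>W. legs_in W (D w)"
    and f': "linear_on s fscale B f'" "\<forall>w\<in>W. f' (e w) = \<Theta> (D' w)" "\<forall>w\<in>W. legs_in W (D' w)"
    and h: "linear_on s fscale B h" "\<forall>w\<in>W. h (e w) = \<Theta> (E w)" "\<forall>w\<in>W. legs_in W (E w)"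
    and h': "linear_on s fscale B h'" "\<forall>w\<in>W. h' (e w) = \<Theta> (E' w)" "\<forall>w\<in>W. legs_in W (E' w)"
    and eq: "\<And>w. w \<in> W \<Longrightarrow> cop_left E (D w) = cop_right E' (D' w)"
    and b: "b \<in> B"
  shows "tmap_left s V B h (f b) = tmap_right s V B h' (f' b)"
proof -
  have p: "\<forall>x\<in>V. proj x \<in> B" "\<forall>x\<in>B. proj x = x" using proj by blast+
  have E: "\<forall>w\<in>W. legs_in (lists G) (E w)" "\<forall>w\<in>W. legs_in (lists G)
      (E' w)" using h(3) h'(3) by blast+
  note L = tmap_B[OF p h(1,2) E(1)] and R = tmap_B[OF p h'(1,2) E(2)]
  show ?thesis
  proof (rule B_eq[where t = fscale, OF _ _ _ b])
    show "linear_on s fscale B (\<lambda>b. tmap_left s V B h (f b))"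
      by (rule linear_on_compose[OF f(1) L(1) reduced_T[OF f]])
    show "linear_on s fscale B (\<lambda>b. tmap_right s V B h' (f' b))"
      by (rule linear_on_compose[OF f'(1) R(2) reduced_T[OF f']])
    fix w assume w: "w \<in> W"
    have "tmap_left s V B h (\<Theta> (D w)) = tmap_right s V B h' (\<Theta> (D' w))"
      using L(3)[OF bspec[OF f(3) w]] R(4)[OF bspec[OF f'(3) w]] eq[OF w] by simp
    then show "tmap_left s V B h (f (e w)) = tmap_right s V B h' (f' (e w))"
      using w f(2) f'(2) by simp
  qed
qed

lemma prec_all:
  "linear_on s fscale B \<Delta>\<^sub>p" "\<forall>w\<in>W. \<Delta>\<^sub>p (e w) = \<Theta> (filter_mset (\<lambda>x. fst x) (R w))"
  "\<forall>w\<in>W. legs_in W (filter_mset (\<lambda>x. fst x) (R w))"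
  using prec_linear prec_e legs_R by blast+

lemma succ_all:
  "linear_on s fscale B \<Delta>\<^sub>s" "\<forall>w\<in>W. \<Delta>\<^sub>s (e w) = \<Theta> (filter_mset (\<lambda>x. \<not> fst x) (R w))"
  "\<forall>w\<in>W. legs_in W (filter_mset (\<lambda>x. \<not> fst x) (R w))"
  using succ_linear succ_e legs_R by blast+

lemma sum_all:
  "linear_on s fscale B (\<lambda>x. \<Delta>\<^sub>p x + \<Delta>\<^sub>s x)" "\<forall>w\<in>W. \<Delta>\<^sub>p (e w) + \<Delta>\<^sub>s (e w) = \<Theta> (R w)"
  "\<forall>w\<in>W. legs_in W (R w)"
proof -
  show "\<forall>w\<in>W. \<Delta>\<^sub>p (e w) + \<Delta>\<^sub>s (e w) = \<Theta> (R w)"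
    using prec_all(2) succ_all(2) by (simp add: word_ten2_add[symmetric])
qed (use linear_on_plus[OF F.vector_space_axioms prec_linear succ_linear] legs_R' in blast)+

text \<open>Tag \<open>0\<close>: the first point is in the leftmost factor. From the left both tags
  must be \<open>True\<close>; from the right the outer tag decides and the inner coproduct is
  unrestricted.\<close>

lemma prec_prec:
  "b \<in> B \<Longrightarrow> tmap_left s V B \<Delta>\<^sub>p (\<Delta>\<^sub>p b) = tmap_right s V B (\<lambda>x. \<Delta>\<^sub>p x + \<Delta>\<^sub>s x) (\<Delta>\<^sub>p b)"
proof (rule reduced_identity[OF prec_all prec_all prec_all sum_all])
  fix w assume "w \<in> W"
  then show "cop_left (\<lambda>w. filter_mset (\<lambda>x. fst x) (R w)) (filter_mset (\<lambda>x. fst x) (R w)) =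
    cop_right R (filter_mset (\<lambda>x. fst x) (R w))"
    using cop_left_filter[where Z = "\<lambda>k. k = 0" and P = "\<lambda>t. t" and Q = "\<lambda>t. t"
        and D = R and M = "R w"]
      cop_right_filter[where Z = "\<lambda>k. k = 0" and P = "\<lambda>t. t" and Q = "\<lambda>t. True"
          and D = R and M = "R w"]
    by (simp add: tag_left_def tag_right_def reduced_coassoc)
qed

text \<open>Tag \<open>1\<close>: the first point is in the middle factor, so the outer and the
  inner tag differ on either side.\<close>

lemma succ_prec:
  "b \<in> B \<Longrightarrow> tmap_left s V B \<Delta>\<^sub>s (\<Delta>\<^sub>p b) = tmap_right s V B \<Delta>\<^sub>p (\<Delta>\<^sub>s b)"
proof (rule reduced_identity[OF prec_all succ_all succ_all prec_all])
  fix w assume "w \<in> W"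
  then show "cop_left (\<lambda>w. filter_mset (\<lambda>x. \<not> fst x) (R w)) (filter_mset (\<lambda>x. fst x) (R w)) =
    cop_right (\<lambda>w. filter_mset (\<lambda>x. fst x) (R w)) (filter_mset (\<lambda>x. \<not> fst x) (R w))"
    using cop_left_filter[where Z = "\<lambda>k. k = 1" and P = "\<lambda>t. t" and Q = "\<lambda>t. \<not> t"
        and D = R and M = "R w"]
      cop_right_filter[where Z = "\<lambda>k. k = 1" and P = "\<lambda>t. \<not> t" and Q = "\<lambda>t. t"
          and D = R and M = "R w"]
    by (simp add: tag_left_def tag_right_def reduced_coassoc)
qed

text \<open>Tag \<open>2\<close>: the first point is in the rightmost factor. From the left the
  outer tag decides; from the right both tags must be \<open>False\<close>.\<close>

lemma succ_succ:
  "b \<in> B \<Longrightarrow> tmap_left s V B (\<lambda>x. \<Delta>\<^sub>p x + \<Delta>\<^sub>s x) (\<Delta>\<^sub>s b) = tmap_right s V B \<Delta>\<^sub>s (\<Delta>\<^sub>s b)"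
proof (rule reduced_identity[OF succ_all succ_all sum_all succ_all])
  fix w assume "w \<in> W"
  then show "cop_left R (filter_mset (\<lambda>x. \<not> fst x) (R w)) =
    cop_right (\<lambda>w. filter_mset (\<lambda>x. \<not> fst x) (R w)) (filter_mset (\<lambda>x. \<not> fst x) (R w))"
    using cop_left_filter[where Z = "\<lambda>k. k = 2" and P = "\<lambda>t. \<not> t" and Q = "\<lambda>t. True"
        and D = R and M = "R w"]
      cop_right_filter[where Z = "\<lambda>k. k = 2" and P = "\<lambda>t. \<not> t" and Q = "\<lambda>t. \<not> t"
          and D = R and M = "R w"]
    by (simp add: tag_left_def tag_right_def reduced_coassoc)
qed

end

section \<open>Counit laws, multiplicativity and the remaining axioms\<close>

context word_bialgebra
begin

text \<open>A general bilinear \<open>h\<close> lets the two counit laws share the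
  computation.\<close>

lemma counit_collapse:
  assumes h: "bilinear_on s s V h" and w: "w \<in> lists G"
  shows "lin_ext fscale s (ten2 s V) (V \<times> V) (\<lambda>(y, z). h y z) (\<Delta> (e w)) =
    (\<Sum>x\<in>#word_cop C w. h (e (lft x)) (e (rgt x)))"
proof -
  let ?h = "lin_ext fscale s (ten2 s V) (V \<times> V) (\<lambda>(y, z). h y z)"
  note ext = extendable_ten2_full[OF vector_space_axioms h]
  have lin: "linear_on fscale s T (?h)"
    using lin_ext(1)[OF ext] unfolding tsquare_def by simp
  have val: "?h (ten2 s V (x, y)) = h x y"
    if "x \<in> V" "y \<in> V" for x y
    using lin_ext(2)[OF ext, of "(x, y)"] that by simp
  have "?h (\<Delta> (e w)) = (\<Sum>x\<in>#word_cop C w.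
    ?h (ten2 s V (e (lft x), e (rgt x))))"
    unfolding cop_e[OF w] word_ten2_def
    by (rule F.linear_on_sum_mset[OF lin subspace_T ten2_T])
        (use legs_cop[OF w] in \<open>simp_all add: e_V\<close>)
  also have "\<dots> = (\<Sum>x\<in>#word_cop C w. h (e (lft x)) (e (rgt x)))"
    using legs_cop[OF w] by (intro sum_mset_cong) (simp add: val e_V)
  finally show ?thesis .
qed

lemma scaled_linear:
  assumes "linear_on s (*) V f"
  shows "linear_on s s V (\<lambda>x. s (f x) y)"
  using assms by (simp add: linear_on_def scale_left_distrib)

lemma counit_linear_ext:
  assumes h: "bilinear_on s s V h"
  shows "linear_on s s V (\<lambda>x. lin_ext fscale s (ten2 s V) (V \<times> V) (\<lambda>(y, z). h y z) (\<Delta> x))"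
proof (rule linear_on_compose[OF cop_linear _ cop_T])
  show "linear_on fscale s T (lin_ext fscale s (ten2 s V) (V \<times> V) (\<lambda>(y, z). h y z))"
    using lin_ext(1)[OF extendable_ten2_full[OF vector_space_axioms h]] unfolding tsquare_def by
        simp
qed

lemma counit_left:
  assumes x: "x \<in> V"
  shows "lin_ext fscale s (ten2 s V) (V \<times> V) (\<lambda>(y, z). s (\<epsilon> y) z) (\<Delta> x) = x"
proof (rule V_eq[where t = s, OF _ linear_on_ident _ x])
  have h: "bilinear_on s s V (\<lambda>y z. s (\<epsilon> y) z)"
    unfolding bilinear_on_def
    by (intro conjI ballI scaled_linear eps_linear linear_on_scaled[OF vector_space_axioms
        linear_on_ident])
  show "linear_on s s V (\<lambda>x. lin_ext fscale s (ten2 s V) (V \<times> V) (\<lambda>(y, z). s (\<epsilon> y) z) (\<Delta> x))"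
    by (rule counit_linear_ext[OF h])
  fix w assume w: "w \<in> lists G"
  \<comment> \<open>The counit kills every term with a nonempty left leg, so a single term
    remains.\<close>
  have "(\<Sum>x\<in>#word_cop C w. s (\<epsilon> (e (lft x))) (e (rgt x))) =
    (\<Sum>x\<in>#filter_mset (\<lambda>x. lft x = []) (word_cop C w). s (\<epsilon> (e (lft x))) (e (rgt x)))"
    by (rule sum_mset_filter[symmetric]) (use legs_cop[OF w] in \<open>simp add: eps_e\<close>)
  also have "\<dots> = e w" by (simp add: word_left_trivial[OF w] eps_e)
  finally show "lin_ext fscale s (ten2 s V) (V \<times> V) (\<lambda>(y, z). s (\<epsilon> y) z) (\<Delta> (e w)) = e w"
    by (simp only: counit_collapse[OF h w])
qed

lemma counit_right:
  assumes x: "x \<in> V"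
  shows "lin_ext fscale s (ten2 s V) (V \<times> V) (\<lambda>(y, z). s (\<epsilon> z) y) (\<Delta> x) = x"
proof (rule V_eq[where t = s, OF _ linear_on_ident _ x])
  have h: "bilinear_on s s V (\<lambda>y z. s (\<epsilon> z) y)"
    unfolding bilinear_on_def
    by (intro conjI ballI scaled_linear eps_linear linear_on_scaled[OF vector_space_axioms
        linear_on_ident])
  show "linear_on s s V (\<lambda>x. lin_ext fscale s (ten2 s V) (V \<times> V) (\<lambda>(y, z). s (\<epsilon> z) y) (\<Delta> x))"
    by (rule counit_linear_ext[OF h])
  fix w assume w: "w \<in> lists G"
  have "(\<Sum>x\<in>#word_cop C w. s (\<epsilon> (e (rgt x))) (e (lft x))) =
    (\<Sum>x\<in>#filter_mset (\<lambda>x. rgt x = []) (word_cop C w). s (\<epsilon> (e (rgt x))) (e (lft x)))"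
    by (rule sum_mset_filter[symmetric]) (use legs_cop[OF w] in \<open>simp add: eps_e\<close>)
  also have "\<dots> = e w" by (simp add: word_right_trivial[OF w] eps_e)
  finally show "lin_ext fscale s (ten2 s V) (V \<times> V) (\<lambda>(y, z). s (\<epsilon> z) y) (\<Delta> (e w)) = e w"
    by (simp only: counit_collapse[OF h w])
qed

lemma eps_mult:
  assumes x: "x \<in> V" and y: "y \<in> V"
  shows "\<epsilon> (m x y) = \<epsilon> x * \<epsilon> y"
proof -
  have 1: "\<epsilon> (m (e a) y) = \<epsilon> (e a) * \<epsilon> y" if a: "a \<in> lists G" for a
  proof (rule V_eq[where t = "(*)", OF _ _ _ y])
    show "linear_on s (*) V (\<lambda>y. \<epsilon> (m (e a) y))"
      by (intro linear_on_compose[OF m_right eps_linear] m_closed e_V a)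
    show "linear_on s (*) V (\<lambda>y. \<epsilon> (e a) * \<epsilon> y)"
      by (rule linear_on_scaled[OF vs_mult eps_linear])
  qed (use a in \<open>simp add: m_e eps_e\<close>)
  show ?thesis
  proof (rule V_eq[where t = "(*)", OF _ _ _ x])
    show "linear_on s (*) V (\<lambda>x. \<epsilon> (m x y))"
      by (intro linear_on_compose[OF m_left eps_linear] m_closed y)
    show "linear_on s (*) V (\<lambda>x. \<epsilon> x * \<epsilon> y)"
      using linear_on_scaled[OF vs_mult eps_linear, of "\<epsilon> y"] by (simp add: mult.commute)
  qed (rule 1)
qed

lemma \<Theta>_append:
  assumes a: "a \<in> lists G" and b: "b \<in> lists G"
  shows "\<Theta> (word_cop C (a @ b)) = tsquare_mult s V m (\<Theta> (word_cop C a)) (\<Theta> (word_cop C b))"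
  unfolding word_cop_append by (rule tm_\<Theta>[OF legs_cop[OF a] legs_cop[OF b], symmetric])

text \<open>Since \<open>a\<close> is nonempty, the tag of a product term is that of its first
  factor. So only the first factor is filtered, while the second keeps its full coproduct.\<close>

lemma \<Theta>_append_filter:
  assumes a: "a \<in> W" and b: "b \<in> lists G"
  shows "\<Theta> (filter_mset (\<lambda>x. P (fst x)) (word_cop C (a @ b))) =
    tsquare_mult s V m (\<Theta> (filter_mset (\<lambda>x. P (fst x)) (word_cop C a))) (\<Theta> (word_cop C b))"
proof -
  have "a \<in> lists G" using a by blast
  then have *: "legs_in (lists G) (filter_mset (\<lambda>x. P (fst x))
      (word_cop C a))" using legs_cop[of a] by simp
  have "filter_mset (\<lambda>x. P (fst x)) (word_cop C (a @ b)) =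
    (\<Sum>x\<in>#filter_mset (\<lambda>x. P (fst x)) (word_cop C a). image_mset
      (\<lambda>y. (if a = [] then fst y else fst x, lft x @ lft y, rgt x @ rgt y))
      (filter_mset (\<lambda>x. True) (word_cop C b)))"
    unfolding word_cop_append by (rule filter_bind_image) (use a in simp)
  then show ?thesis using tm_\<Theta>[OF * legs_cop[OF b]] by simp
qed

lemma cop_mult:
  assumes x: "x \<in> V" and y: "y \<in> V"
  shows "\<Delta> (m x y) = tsquare_mult s V m (\<Delta> x) (\<Delta> y)"
proof -
  have 1: "\<Delta> (m (e a) y) = tsquare_mult s V m (\<Delta> (e a)) (\<Delta> y)" if a: "a \<in> lists G" for a
  proof (rule V_eq[where t = fscale, OF _ _ _ y])
    show "linear_on s fscale V (\<lambda>y. \<Delta> (m (e a) y))"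
      by (intro linear_on_compose[OF m_right cop_linear] m_closed e_V a)
    show "linear_on s fscale V (\<lambda>y. tsquare_mult s V m (\<Delta> (e a)) (\<Delta> y))"
      by (intro linear_on_compose[OF cop_linear tm(2)] cop_T e_V a)
  qed (use a in \<open>simp add: m_e cop_e \<Theta>_append\<close>)
  show ?thesis
  proof (rule V_eq[where t = fscale, OF _ _ _ x])
    show "linear_on s fscale V (\<lambda>x. \<Delta> (m x y))"
      by (intro linear_on_compose[OF m_left cop_linear] m_closed y)
    show "linear_on s fscale V (\<lambda>x. tsquare_mult s V m (\<Delta> x) (\<Delta> y))"
      by (intro linear_on_compose[OF cop_linear tm(1)] cop_T y)
  qed (rule 1)
qed

lemma plus_e:
  assumes "w \<in> W"
  shows "\<Delta>\<^sub>p (e w) + ten2 s V (e w, e []) = \<Theta> (filter_mset (\<lambda>x. fst x) (word_cop C w))"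
    "\<Delta>\<^sub>s (e w) + ten2 s V (e [], e w) = \<Theta> (filter_mset (\<lambda>x. \<not> fst x) (word_cop C w))"
proof -
  have w: "w \<in> lists G" "w \<noteq> []" using assms by auto
  show "\<Delta>\<^sub>p (e w) + ten2 s V (e w, e []) = \<Theta> (filter_mset (\<lambda>x. fst x) (word_cop C w))"
    using word_cop_prec[OF w] by (simp add: prec_e[OF w] word_ten2_add_mset add.commute)
  show "\<Delta>\<^sub>s (e w) + ten2 s V (e [], e w) = \<Theta> (filter_mset (\<lambda>x. \<not> fst x) (word_cop C w))"
    using word_cop_succ[OF w] by (simp add: succ_e[OF w] word_ten2_add_mset add.commute)
qed

text \<open>Here \<open>b\<close> ranges over all of \<open>V\<close>, so that linearity in
  \<open>b\<close> can be tested on all words, including the empty one.\<close>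

lemma m_B:
  assumes a: "a \<in> B" and b: "b \<in> V"
  shows "m a b \<in> B"
proof -
  have 1: "m a (e w) \<in> B" if w: "w \<in> lists G" for w
  proof (rule linear_on_span_into[OF vector_space_axioms _ _ subspace_B a[unfolded B]])
    show "linear_on s s (span (e ` W)) (\<lambda>a. m a (e w))"
      using linear_on_subset[OF m_left BV] e_V[OF w] unfolding B by blast
    fix v assume "v \<in> e ` W"
    then obtain u where "u \<in> lists G" "u \<noteq> []" "v = e u" by blast
    then show "m v (e w) \<in> B" using w e_B[of "u @ w"] by (simp add: m_e)
  qed
  have aV: "a \<in> V" using a BV by blast
  show ?thesis
  proof (rule linear_on_span_into[OF vector_space_axioms m_right[OF aV,
      unfolded V] _ subspace_B b[unfolded V]])
    fix v assume "v \<in> e ` lists G"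
    then show "m a v \<in> B" using 1 by blast
  qed
qed

text \<open>\<open>f\<close> and \<open>j\<close> stand for a half-coproduct and the unit term that completes it.\<close>

lemma half_mult:
  assumes f: "linear_on s fscale B f" and j: "linear_on s fscale V j" "\<And>x. x \<in> V \<Longrightarrow> j x \<in> T"
    and plus: "\<And>w. w \<in> W \<Longrightarrow> f (e w) + j (e w) = \<Theta> (filter_mset (\<lambda>x. P (fst x)) (word_cop C w))"
    and a: "a \<in> B" and b: "b \<in> V"
  shows "f (m a b) + j (m a b) = tsquare_mult s V m (f a + j a) (\<Delta> b)"
proof -
  have fj: "linear_on s fscale B (\<lambda>x. f x + j x)"
    by (rule linear_on_plus[OF F.vector_space_axioms f linear_on_subset[OF j(1) BV]])
  have fjT: "f x + j x \<in> T" if x: "x \<in> B" for x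
  proof (rule linear_on_span_into[OF F.vector_space_axioms fj[unfolded B] _ subspace_T x[unfolded
      B]])
    fix v assume "v \<in> e ` W"
    then obtain w where w: "w \<in> W" "v = e w" by blast
    then have "w \<in> lists G" by blast
    then have "\<Theta> (filter_mset (\<lambda>x. P (fst x)) (word_cop C w)) \<in> T"
      using legs_cop[of w] by (intro \<Theta>_T) simp
    then show "f v + j v \<in> T" using plus[OF w(1)] w(2) by simp
  qed
  have 1: "f (m (e w) b) + j (m (e w) b) = tsquare_mult s V m (f (e w) + j (e w)) (\<Delta> b)"
      if w: "w \<in> W" for w
  proof (rule V_eq[where t = fscale, OF _ _ _ b])
    have wG: "w \<in> lists G" using w by blast
    show "linear_on s fscale V (\<lambda>b. f (m (e w) b) + j (m (e w) b))"
      by (rule linear_on_compose[OF m_right[OF e_V[OF wG]] fj]) (rule m_B[OF e_B[OF w]])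
    show "linear_on s fscale V (\<lambda>b. tsquare_mult s V m (f (e w) + j (e w)) (\<Delta> b))"
      by (intro linear_on_compose[OF cop_linear tm(2)] cop_T fjT e_B w)
    fix u assume u: "u \<in> lists G"
    then have "w @ u \<in> W" using w by auto
    then show "f (m (e w) (e u)) + j (m (e w) (e u)) = tsquare_mult s V m (f (e w) + j (e w))
        (\<Delta> (e u))"
      by (simp only: m_e[OF wG u] plus w cop_e[OF u] \<Theta>_append_filter[OF w u])
  qed
  show ?thesis
  proof (rule B_eq[where t = fscale, OF _ _ _ a])
    show "linear_on s fscale B (\<lambda>a. f (m a b) + j (m a b))"
      by (rule linear_on_compose[OF linear_on_subset[OF m_left[OF b] BV] fj]) (rule m_B[OF _ b])
    show "linear_on s fscale B (\<lambda>a. tsquare_mult s V m (f a + j a) (\<Delta> b))"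
      by (intro linear_on_compose[OF fj tm(1)] cop_T b fjT)
  qed (rule 1)
qed

lemma cop_split:
  assumes b: "b \<in> B"
  shows "\<Delta> b = (\<Delta>\<^sub>p b + \<Delta>\<^sub>s b) + ten2 s V (b, e []) + ten2 s V (e [], b)"
proof (rule B_eq[where t = fscale, OF _ _ _ b])
  show "linear_on s fscale B \<Delta>" by (rule linear_on_subset[OF cop_linear BV])
  show "linear_on s fscale B (\<lambda>b. (\<Delta>\<^sub>p b + \<Delta>\<^sub>s b) + ten2 s V (b, e []) + ten2 s V (e [], b))"
    by (intro linear_on_plus[OF F.vector_space_axioms] prec_linear succ_linear
        linear_on_subset[OF ten2_left BV] linear_on_subset[OF ten2_right BV] one_V)
  fix w assume w: "w \<in> W"
  \<comment> \<open>Each term has exactly one tag, so the two filtered parts exhaust the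
    coproduct.\<close>
  have "\<Delta> (e w) = \<Theta> (filter_mset (\<lambda>x. fst x) (word_cop C w)) + \<Theta> (filter_mset (\<lambda>x. \<not> fst x)
      (word_cop C w))"
    using w by (simp add: cop_e word_ten2_add[symmetric])
  then show "\<Delta> (e w) = (\<Delta>\<^sub>p (e w) + \<Delta>\<^sub>s (e w)) + ten2 s V (e w, e []) + ten2 s V (e [], e w)"
    by (simp add: plus_e[OF w, symmetric] algebra_simps)
qed

lemma carrier_sum: "V = {b + s c (e []) | b c. b \<in> B}"
proof (intro set_eqI iffI)
  fix x assume x: "x \<in> V"
  have "x = proj x + s (\<epsilon> x) (e [])" by (simp add: proj_def)
  with proj(2)[OF x] show "x \<in> {b + s c (e []) | b c. b \<in> B}" by blast
next
  fix x assume "x \<in> {b + s c (e []) | b c. b \<in> B}"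
  then obtain b c where "x = b + s c (e [])" "b \<in> B" by blast
  then show "x \<in> V" using BV one_V subspace_V by (auto intro: subspace_add subspace_scale)
qed

text \<open>The counit separates the summands: it vanishes on \<open>B\<close> and reads off the
  coefficient of the unit.\<close>

lemma carrier_direct: "B \<inter> span {e []} = {0}"
proof -
  have "x = 0" if x: "x \<in> B" "x \<in> span {e []}" for x
  proof -
    obtain c where c: "x = s c (e [])" using x(2) by (auto simp: span_singleton)
    have "\<epsilon> x = c" unfolding c using linear_on_scaleD[OF eps_linear one_V,
        of c] by (simp add: eps_e)
    then show ?thesis using eps_B[OF x(1)] c by simp
  qed
  then show ?thesis using subspace_0[OF subspace_B] span_zero by auto
qed

lemma prec_closed: "b \<in> B \<Longrightarrow> \<Delta>\<^sub>p b \<in> tsquare s V B"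
  by (rule reduced_T[OF prec_all])

lemma succ_closed: "b \<in> B \<Longrightarrow> \<Delta>\<^sub>s b \<in> tsquare s V B"
  by (rule reduced_T[OF succ_all])

lemma cop_unit: "\<Delta> (e []) = ten2 s V (e [], e [])"
  using cop_e[of "[]"] by (simp add: word_ten2_def)

lemma eps_unit: "\<epsilon> (e []) = 1"
  by (simp add: eps_e)

lemma prec_mult:
  "a \<in> B \<Longrightarrow> b \<in> B \<Longrightarrow> \<Delta>\<^sub>p (m a b) + ten2 s V (m a b, e []) =
    tsquare_mult s V m (\<Delta>\<^sub>p a + ten2 s V (a, e [])) (\<Delta> b)"
  by (rule half_mult[where P = "\<lambda>t. t",
        OF prec_linear ten2_left[OF one_V] ten2_T[OF _ one_V] plus_e(1)]) (use BV in auto)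

lemma succ_mult:
  "a \<in> B \<Longrightarrow> b \<in> B \<Longrightarrow> \<Delta>\<^sub>s (m a b) + ten2 s V (e [], m a b) =
    tsquare_mult s V m (\<Delta>\<^sub>s a + ten2 s V (e [], a)) (\<Delta> b)"
  by (rule half_mult[where P = "\<lambda>t. \<not> t",
        OF succ_linear ten2_right[OF one_V] ten2_T[OF one_V] plus_e(2)]) (use BV in auto)

theorem unshuffle: "unshuffle_bialgebra s V m (e []) \<epsilon> \<Delta> B \<Delta>\<^sub>p \<Delta>\<^sub>s"
  by unfold_locales (fact subspace_V m_closed m_left m_right m_assoc one_V unit_left unit_right
      cop_T cop_linear cop_coassoc eps_linear counit_left counit_right cop_mult cop_unit eps_mult
      eps_unit subspace_B carrier_sum carrier_direct eps_B prec_closed prec_linear succ_closed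
      succ_linear cop_split prec_prec succ_prec succ_succ prec_mult succ_mult)+

end

section \<open>The tensor algebra over decorated non-crossing partitions\<close>

text \<open>Entries are expanded in generators from left to right, and the prefix \<open>ys\<close>
  of the induction holds those already expanded. Recording the length ensures that nonempty tensors
  need nonempty words only.\<close>

lemma span_ten_lists:
  fixes s :: "'k::field \<Rightarrow> 'v::ab_group_add \<Rightarrow> 'v" and S :: "'v set"
  assumes s: "vector_space s"
  defines "V \<equiv> module.span s S"
  assumes "xs \<in> lists V"
  shows "ten s V xs \<in> module.span fscale (ten s V ` {ys \<in> lists S. length ys = length xs})"
proof -
  interpret vector_space s by fact
  interpret F: vector_space "fscale :: 'k \<Rightarrow> ('v list \<Rightarrow>\<^sub>0 'k) \<Rightarrow> _" by (rule vector_space_fscale)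
  have SV: "lists S \<subseteq> lists V" unfolding V_def by (intro lists_mono span_superset)
  have "ten s V (ys @ xs) \<in> F.span (ten s V ` {zs \<in> lists S. length zs = length (ys @ xs)})"
    if "ys \<in> lists S" for ys
    using assms(3) that
  proof (induction xs arbitrary: ys rule: list.induct)
    case Nil
    then show ?case by (intro F.span_base imageI) simp
  next
    case (Cons x xs)
    have lin: "linear_on s fscale V (\<lambda>x. ten s V (ys @ x # xs))"
    proof -
      have "ys \<in> lists V" "xs \<in> lists V" using Cons.prems SV by auto
      then show ?thesis using ten_multilinear[of s V] unfolding multilinear_on_def by blast
    qed
    have x: "x \<in> V" using Cons.prems by simp
    show ?case
    proof (rule linear_on_span_into[OF F.vector_space_axioms lin[unfolded V_def], folded V_def,
        OF _ _ x])
      fix v assume "v \<in> S"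
      then show "ten s V (ys @ v # xs) \<in> F.span (ten s V ` {zs \<in> lists S. length zs =
          length (ys @ x # xs)})"
        using Cons.IH[of "ys @ [v]"] Cons.prems by simp
    qed simp
  qed
  from this[of "[]"] show ?thesis by simp
qed

text \<open>The letter \<open>x\<close> occurs at most once in a subword and the other letters do
  not depend on it. This is the source of multilinearity in the decorations.\<close>

lemma subword_split:
  "subword (xs @ x # ys) S = subword xs S @ (if Suc (length xs) \<in> S then [x] else []) @
    nths ys {j. Suc (Suc (length xs + j)) \<in> S}"
  unfolding subword_def by (simp add: nths_append nths_Cons add.commute)

lemma lookup_pscale: "Poly_Mapping.lookup (pscale s c f) i = s c (Poly_Mapping.lookup f i)"
  if "s c 0 = 0"
  using that by (simp add: pscale_def Poly_Mapping.map.rep_eq when_def)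

abbreviation coeff :: "('i \<Rightarrow>\<^sub>0 'v::zero) \<Rightarrow> 'i \<Rightarrow> 'v" where "coeff \<equiv> Poly_Mapping.lookup"
abbreviation supp :: "('i \<Rightarrow>\<^sub>0 'v::zero) \<Rightarrow> 'i set" where "supp \<equiv> Poly_Mapping.keys"

context
  fixes sc :: "'k::field \<Rightarrow> 'a::ab_group_add \<Rightarrow> 'a"
begin

interpretation N: vector_space "nscale :: 'k \<Rightarrow> ('k, 'a) nca \<Rightarrow> _"
  by (rule vector_space_pscale[OF vector_space_fscale])

interpretation A: vector_space "fscale :: 'k \<Rightarrow> ('a list \<Rightarrow>\<^sub>0 'k) \<Rightarrow> _"
  by (rule vector_space_fscale)

interpretation W: vector_space "fscale :: 'k \<Rightarrow> ('k, 'a) tnc \<Rightarrow> _"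
  by (rule vector_space_fscale)

interpretation W2: vector_space "fscale :: 'k \<Rightarrow> (('k, 'a) tnc list \<Rightarrow>\<^sub>0 'k) \<Rightarrow> _"
  by (rule vector_space_fscale)

section \<open>Spanning sets of decorated partitions and of bar words\<close>

lemma lookup_nscale: "coeff (nscale c f) L = fscale c (coeff (f :: ('k, 'a) nca) L)"
  by (rule lookup_pscale) simp

text \<open>Consequently the coefficients of two elements of \<open>NCA\<close> at one partition lie
  in the same tensor power, which gives closure under addition.\<close>

lemma NC_unique: "L \<in> NC n \<Longrightarrow> L \<in> NC n' \<Longrightarrow> n = n'"
proof -
  assume "L \<in> NC n" "L \<in> NC n'"
  then have "{1..n} = {1..n'}"
    unfolding NC_def noncrossing_def using partition_onD1 by (metis (no_types,
        lifting) mem_Collect_eq)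
  then show "n = n'" by (metis card_atLeastAtMost diff_Suc_1)
qed

lemma subspace_tpower: "A.subspace (tpower sc UNIV n)" by (simp add: tpower_def)

lemma NCA_iff: "f \<in> NCA sc \<longleftrightarrow>
  (\<forall>L. coeff f L = 0 \<or> (\<exists>n\<ge>1. L \<in> NC n \<and> coeff f L \<in> tpower sc UNIV n))"
  unfolding NCA_def by (auto simp: in_keys_iff)

lemma subspace_NCA: "N.subspace (NCA sc)"
proof (rule N.subspaceI)
  show "0 \<in> NCA sc" by (simp add: NCA_iff)
next
  fix f g assume f: "f \<in> NCA sc" and g: "g \<in> NCA sc"
  show "f + g \<in> NCA sc"
    unfolding NCA_iff
  proof
    fix L
    show "coeff (f + g) L = 0 \<or> (\<exists>n\<ge>1. L \<in> NC n \<and> coeff (f + g) L \<in> tpower sc UNIV n)"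
    proof (cases "coeff f L = 0 \<or> coeff g L = 0")
      case True
      then show ?thesis using f g unfolding NCA_iff by (auto simp: lookup_add)
    next
      case False
      then obtain n n' where n: "n \<ge> 1" "L \<in> NC n" "coeff f L \<in> tpower sc UNIV n"
        and n': "L \<in> NC n'" "coeff g L \<in> tpower sc UNIV n'"
        using f g unfolding NCA_iff by blast
      have "n' = n" by (rule NC_unique[OF n'(1) n(2)])
      then have "coeff (f + g) L \<in> tpower sc UNIV n"
        unfolding lookup_add using n n' by (intro A.subspace_add[OF subspace_tpower]) simp_all
      then show ?thesis using n by blast
    qed
  qed
next
  fix c f assume f: "f \<in> NCA sc"
  show "nscale c f \<in> NCA sc"
    unfolding NCA_iff lookup_nscale
  proof
    fix L
    show "fscale c (coeff f L) = 0 \<or>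
        (\<exists>n\<ge>1. L \<in> NC n \<and> fscale c (coeff f L) \<in> tpower sc UNIV n)"
    proof (cases "coeff f L = 0")
      case False
      then obtain n where "n \<ge> 1" "L \<in> NC n" "coeff f L \<in> tpower sc UNIV n"
        using f unfolding NCA_iff by blast
      then show ?thesis using A.subspace_scale[OF subspace_tpower] by blast
    qed simp
  qed
qed

lemma dec_NCA: "g \<in> dec_index \<Longrightarrow> dec sc g \<in> NCA sc"
proof -
  assume g: "g \<in> dec_index"
  obtain L as where gL: "g = (L, as)" by (cases g)
  have "ten sc UNIV as \<in> tpower sc UNIV (length as)"
    unfolding tpower_def by (intro A.span_base imageI) simp
  with g show "dec sc g \<in> NCA sc"
    unfolding NCA_iff gL by (auto simp: dec_def dec_index_def lookup_single when_def)
qed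

lemma single_linear: "linear_on fscale nscale V (\<lambda>t :: 'a list \<Rightarrow>\<^sub>0 'k. Poly_Mapping.single L t)"
  by (rule linear_onI) (auto intro!: poly_mapping_eqI simp: single_add lookup_nscale lookup_single
      when_def)

lemma single_in_span:
  assumes n: "n \<ge> 1" "L \<in> NC n" "t \<in> tpower sc UNIV n"
  shows "Poly_Mapping.single L t \<in> N.span (dec sc ` dec_index)"
proof (rule A.linear_on_span_into[OF N.vector_space_axioms single_linear _ N.subspace_span
    n(3)[unfolded tpower_def]])
  fix t assume "t \<in> ten sc UNIV ` {xs \<in> lists UNIV. length xs = n}"
  then obtain xs where xs: "length xs = n" "t = ten sc UNIV xs" by (elim imageE CollectE conjE)
  have "(L, xs) \<in> dec_index" using n(1,2) xs(1) by (simp add: dec_index_def)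
  then have "dec sc (L, xs) \<in> N.span (dec sc ` dec_index)" by (intro N.span_base imageI)
  then show "Poly_Mapping.single L t \<in> N.span (dec sc ` dec_index)"
    by (simp add: xs(2) dec_def)
qed

lemma sum_single_lookup:
  fixes f :: "'i \<Rightarrow>\<^sub>0 'v::comm_monoid_add"
  shows "(\<Sum>i\<in>supp f. Poly_Mapping.single i (coeff f i)) = f"
  by (rule poly_mapping_eqI) (simp add: lookup_sum lookup_single when_def sum.delta in_keys_iff)

lemma NCA_eq_span: "NCA sc = N.span (dec sc ` dec_index)"
proof
  show "N.span (dec sc ` dec_index) \<subseteq> NCA sc"
    by (rule N.span_minimal[OF image_subsetI subspace_NCA]) (rule dec_NCA)
  show "NCA sc \<subseteq> N.span (dec sc ` dec_index)"
  proof
    fix f assume f: "f \<in> NCA sc"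
    have "Poly_Mapping.single L (coeff f L) \<in> N.span (dec sc ` dec_index)"
      if "L \<in> supp f" for L
      using f that single_in_span unfolding NCA_def by blast
    then have "(\<Sum>L\<in>supp f. Poly_Mapping.single L (coeff f L)) \<in> N.span (dec sc ` dec_index)"
      by (rule N.span_sum)
    then show "f \<in> N.span (dec sc ` dec_index)" by (simp only: sum_single_lookup)
  qed
qed

definition bar_word :: "(nat set set \<times> 'a list) list \<Rightarrow> ('k, 'a) tnc"
  where "bar_word w = bar sc (map (dec sc) w)"

lemma map_dec_NCA: "w \<in> lists dec_index \<Longrightarrow> map (dec sc) w \<in> lists (NCA sc)"
  by (induction w) (simp_all add: dec_NCA)

lemma lists_dec:
  assumes "ws \<in> lists (dec sc ` dec_index)"
  shows "\<exists>w\<in>lists dec_index. ws = map (dec sc) w"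
  using assms unfolding lists_image by (rule imageE) (rule bexI)

lemma bar_in_span:
  assumes "ws \<in> lists (NCA sc)"
  shows "bar sc ws \<in> W.span (bar_word ` {w \<in> lists dec_index. length w = length ws})"
proof -
  have "bar sc ws \<in> W.span (bar sc ` {ys \<in> lists (dec sc ` dec_index). length ys = length ws})"
    by (rule span_ten_lists[OF N.vector_space_axioms, of ws "dec sc ` dec_index",
        folded NCA_eq_span, OF assms])
  also have "\<dots> \<subseteq> W.span (bar_word ` {w \<in> lists dec_index. length w = length ws})"
  proof (rule W.span_mono)
    show "bar sc ` {ys \<in> lists (dec sc ` dec_index). length ys = length ws}
      \<subseteq> bar_word ` {w \<in> lists dec_index. length w = length ws}"
    proof (rule image_subsetI)
      fix ys assume "ys \<in> {ys \<in> lists (dec sc ` dec_index). length ys = length ws}"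
      then have ys: "ys \<in> lists (dec sc ` dec_index)" "length ys = length ws" by blast+
      from lists_dec[OF ys(1)] obtain w where w: "w \<in> lists dec_index"
          "ys = map (dec sc) w" by blast
      then show "bar sc ys \<in> bar_word ` {w \<in> lists dec_index. length w = length ws}"
        using ys(2) by (auto simp: bar_word_def)
    qed
  qed
  finally show ?thesis .
qed

lemma TNC_eq_span: "TNC sc = W.span (bar_word ` lists dec_index)"
proof
  show "TNC sc \<subseteq> W.span (bar_word ` lists dec_index)"
    unfolding TNC_def talg_def
  proof (rule W.span_minimal)
    show "bar sc ` lists (NCA sc) \<subseteq> W.span (bar_word ` lists dec_index)"
    proof (rule image_subsetI)
      fix ws assume "ws \<in> lists (NCA sc)"
      from bar_in_span[OF this] show "bar sc ws \<in> W.span (bar_word ` lists dec_index)"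
        by (rule subsetD[OF W.span_mono[OF image_mono[OF Collect_restrict]]])
    qed
  qed simp
  show "W.span (bar_word ` lists dec_index) \<subseteq> TNC sc"
    unfolding TNC_def talg_def
    by (rule W.span_mono, rule image_subsetI, unfold bar_word_def, rule imageI, rule map_dec_NCA)
qed

lemma TNC_plus_eq_span: "TNC_plus sc = W.span (bar_word ` (lists dec_index - {[]}))"
proof
  show "TNC_plus sc \<subseteq> W.span (bar_word ` (lists dec_index - {[]}))"
    unfolding TNC_plus_def talg_plus_def
  proof (rule W.span_minimal)
    show "bar sc ` (lists (NCA sc) - {[]}) \<subseteq> W.span (bar_word ` (lists dec_index - {[]}))"
    proof (rule image_subsetI)
      fix ws assume "ws \<in> lists (NCA sc) - {[]}"
      then have ws: "ws \<in> lists (NCA sc)" "ws \<noteq> []" by blast+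
      \<comment> \<open>Expansion preserves the length, so a nonempty bar word never produces the
        empty one.\<close>
      have "{w \<in> lists dec_index. length w = length ws} \<subseteq> lists dec_index - {[]}" using ws(2) by
          auto
      then show "bar sc ws \<in> W.span (bar_word ` (lists dec_index - {[]}))"
        by (rule subsetD[OF W.span_mono[OF image_mono] bar_in_span[OF ws(1)]])
    qed
  qed simp
  show "W.span (bar_word ` (lists dec_index - {[]})) \<subseteq> TNC_plus sc"
    unfolding TNC_plus_def talg_plus_def
  proof (rule W.span_mono, rule image_subsetI)
    fix w :: "(nat set set \<times> 'a list) list" assume "w \<in> lists dec_index - {[]}"
    then have w: "w \<in> lists dec_index" "w \<noteq> []" by blast+
    then have "map (dec sc) w \<in> lists (NCA sc) - {[]}" using map_dec_NCA by simp
    then show "bar_word w \<in> bar sc ` (lists (NCA sc) - {[]})" unfolding bar_word_def by (rule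
        imageI)
  qed
qed

lemma word_algebra_TNC: "word_algebra fscale dec_index bar_word (TNC sc) (TNC_mult sc)"
proof
  show "TNC sc = W.span (bar_word ` lists dec_index)" by (rule TNC_eq_span)
  show "linear_on fscale fscale (TNC sc) (\<lambda>x. TNC_mult sc x y)" if "y \<in> TNC sc" for y
    using tconc(1) that unfolding TNC_def TNC_mult_def by blast
  show "linear_on fscale fscale (TNC sc) (TNC_mult sc x)" if "x \<in> TNC sc" for x
    using tconc(2) that unfolding TNC_def TNC_mult_def by blast
  show "TNC_mult sc (bar_word a) (bar_word b) = bar_word (a @ b)"
    if "a \<in> lists dec_index" "b \<in> lists dec_index" for a b
    unfolding bar_word_def TNC_mult_def using tconc(3)[OF map_dec_NCA map_dec_NCA] that by simp
qed

interpretation WA: word_algebra fscale dec_index bar_word "TNC sc" "TNC_mult sc"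
  by (rule word_algebra_TNC)

interpretation LC: letter_coproduct "dec_index :: (nat set set \<times> 'a list) set" nc_cop
  by (rule nc_letter_coproduct)

section \<open>Multilinearity of the coproduct in the decorations\<close>

lemma coprod_term_eq:
  "coprod_term sc L as Q = TNC_ten2 sc (bar_word (nc_left as Q), bar_word (nc_right L as Q))"
  by (simp add: coprod_term_def bar_word_def nc_left_def nc_right_def TNC_one_def comp_def)

lemma finite_admissible:
  assumes "(L, as) \<in> dec_index"
  shows "finite (admissible L)"
proof -
  have "partition_on {1..length as} L" using assms by (simp add: dec_index_def NC_def
      noncrossing_def)
  then have "finite L" by (rule finite_elements[OF finite_atLeastAtMost])
  moreover have "admissible L \<subseteq> Pow L" by (auto simp: admissible_def)
  ultimately show ?thesis by (simp add: finite_subset)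
qed

lemma legs_dec_index:
  fixes as :: "'a list"
  assumes "(L, as) \<in> dec_index" "Q \<in> admissible L"
  shows "nc_left as Q \<in> lists dec_index" "nc_right L as Q \<in> lists dec_index"
proof -
  have "(1 \<in> \<Union>Q, nc_left as Q, nc_right L as Q) \<in># nc_cop (L, as)"
    using assms finite_admissible[OF assms(1)] by (auto simp: nc_cop_def set_mset_sum)
  from LC.legs_closed[OF assms(1) this]
  show "nc_left as Q \<in> lists dec_index" "nc_right L as Q \<in> lists dec_index" by blast+
qed

lemma TNC_one: "TNC_one sc = bar_word []" by (simp add: TNC_one_def bar_word_def)

lemma dec_slot: "linear_on sc nscale UNIV (\<lambda>x. dec sc (L, us @ x # vs))"
proof -
  have "linear_on sc fscale UNIV (\<lambda>x. ten sc UNIV (us @ x # vs))"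
    using ten_multilinear[of sc UNIV] unfolding multilinear_on_def by simp
  from linear_on_compose[OF this single_linear[of UNIV L] UNIV_I] show ?thesis by (simp add:
      dec_def)
qed

lemma dec_subword_linear:
  assumes "Suc (length xs) \<in> S"
  shows "linear_on sc nscale UNIV (\<lambda>x. dec sc (L, subword (xs @ x # ys) S))"
  using dec_slot[of L "subword xs S" "nths ys {j. Suc (Suc (length xs + j)) \<in> S}"] assms
  by (simp add: subword_split)

lemma subword_other:
  "Suc (length xs) \<notin> S \<Longrightarrow> subword (xs @ x # ys) S = subword (xs @ x' # ys) S"
  by (simp add: subword_split)

lemma bar_slot:
  "us \<in> lists (NCA sc) \<Longrightarrow> vs \<in> lists (NCA sc) \<Longrightarrow>
    linear_on nscale fscale (NCA sc) (\<lambda>w. bar sc (us @ w # vs))"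
  using ten_multilinear[of nscale "NCA sc"] unfolding multilinear_on_def by blast

text \<open>Position \<open>p\<close> of the free decoration belongs either to \<open>Q\<close>, and
  then it is read in the single letter of the left factor, or to exactly one interval, and then in
  one letter of the right factor. All other letters are constant, and \<open>dec\<close>,
  \<open>bar\<close> and the tensor product are linear in one slot.\<close>

lemma coprod_term_linear:
  assumes ind: "\<And>x. (L, xs @ x # ys) \<in> dec_index" and Q: "Q \<in> admissible L"
  shows "linear_on sc fscale UNIV (\<lambda>x. coprod_term sc L (xs @ x # ys) Q)"
proof -
  define n where "n = length xs + Suc (length ys)"
  define p where "p = Suc (length xs)"
  define Ks where "Ks = runs (\<lambda>i. i \<notin> \<Union>Q) [1..<Suc n]"
  define d where "d x J = (st {B \<in> L - Q. B \<subseteq> J}, subword (xs @ x # ys) J)" for x J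
  have pn: "p \<in> {1..n}" by (simp add: p_def n_def)
  have "{1..n} - \<Union>Q = {i \<in> {1..n}. i \<notin> \<Union>Q}" by auto
  then have int: "intervals ({1..n} - \<Union>Q) = map set Ks"
    by (simp only: intervals_eq_runs Ks_def)
  have right: "nc_right L (xs @ x # ys) Q = map (\<lambda>K. d x (set K)) Ks" for x
    unfolding nc_right_def d_def using int by (simp add: n_def comp_def)
  note legs = legs_dec_index[OF ind Q]
  have leftV: "bar_word (nc_left (xs @ x # ys) Q) \<in> TNC sc" for x by (rule WA.e_V[OF legs(1)])
  have rightV: "bar_word (nc_right L (xs @ x # ys) Q) \<in> TNC sc" for x by (rule WA.e_V[OF legs(2)])
  show ?thesis
  proof (cases "p \<in> \<Union>Q")
    case True
    then have Qne: "Q \<noteq> {}" by blast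
    have "p \<notin> set K" if "K \<in> set Ks" for K
      using in_runs[OF that[unfolded Ks_def]] True by blast
    \<comment> \<open>The decoration \<open>0\<close> is a placeholder, since position
      \<open>p\<close> is not read inside these intervals.\<close>
    then have "d x (set K) = d 0 (set K)" if "K \<in> set Ks" for x K
      unfolding d_def using that subword_other[of xs "set K" x ys 0] by (simp add: p_def)
    then have const: "nc_right L (xs @ x # ys) Q = nc_right L (xs @ 0 # ys) Q" for x
      unfolding right by (intro map_cong refl)
    have left: "bar_word (nc_left (xs @ x # ys) Q) = bar sc ([] @ dec sc (st Q,
        subword (xs @ x # ys) (\<Union>Q)) # [])" for x
      by (simp add: bar_word_def nc_left_def Qne)
    have "dec sc (st Q, subword (xs @ x # ys) (\<Union>Q)) \<in> NCA sc" for x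
      using legs(1)[of x] Qne by (intro dec_NCA) (simp add: nc_left_def)
    then have "linear_on sc fscale UNIV (\<lambda>x. bar_word (nc_left (xs @ x # ys) Q))"
      unfolding left
      by (intro linear_on_compose[OF dec_subword_linear[OF True[unfolded p_def]] bar_slot]) simp_all
    then have "linear_on sc fscale UNIV (\<lambda>x. TNC_ten2 sc (bar_word (nc_left (xs @ x # ys) Q),
        bar_word (nc_right L (xs @ 0 # ys) Q)))"
      by (rule linear_on_compose[OF _ WA.ten2_left[OF rightV] leftV])
    moreover have "coprod_term sc L (xs @ x # ys) Q =
        TNC_ten2 sc (bar_word (nc_left (xs @ x # ys) Q), bar_word (nc_right L (xs @ 0 # ys) Q))"
            for x
      by (simp only: coprod_term_eq const[of x])
    ultimately show ?thesis by (simp only:)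
  next
    case False
    have "p \<in> set (concat Ks)" unfolding Ks_def concat_runs using False pn by (auto simp del:
        upt_Suc)
    then obtain K where K: "K \<in> set Ks" "p \<in> set K" by auto
    \<comment> \<open>The list is split at the one interval containing \<open>p\<close>, which
      becomes the free slot of the bar word.\<close>
    then obtain Ks1 Ks2 where split: "Ks = Ks1 @ K # Ks2" by (meson split_list)
    have "p \<notin> set K'" if "K' \<in> set Ks1 \<union> set Ks2" for K'
      using runs_disjoint[OF distinct_upt split[unfolded Ks_def] that] K(2) by blast
    then have other: "d x (set K') = d 0 (set K')" if "K' \<in> set Ks1 \<union> set Ks2" for x K'
      unfolding d_def using that subword_other[of xs "set K'" x ys 0] by (simp add: p_def)
    define us vs where "us = map (\<lambda>K. d 0 (set K)) Ks1" and "vs = map (\<lambda>K. d 0 (set K)) Ks2"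
    have ex: "nc_right L (xs @ x # ys) Q = us @ d x (set K) # vs" for x
    proof -
      have "map (\<lambda>K. d x (set K)) Ks1 = us" "map (\<lambda>K. d x (set K)) Ks2 = vs"
        unfolding us_def vs_def by (rule map_cong[OF refl], rule other, simp)+
      then show ?thesis by (simp add: right split)
    qed
    have mem: "us \<in> lists dec_index" "vs \<in> lists dec_index" "d x (set K) \<in> dec_index" for x
      using legs(2)[of x] unfolding ex by simp_all
    have right': "bar_word (nc_right L (xs @ x # ys) Q) =
        bar sc (map (dec sc) us @ dec sc (d x (set K)) # map (dec sc) vs)" for x
      unfolding ex bar_word_def by simp
    have "linear_on sc nscale UNIV (\<lambda>x. dec sc (d x (set K)))"
      unfolding d_def using K(2) by (intro dec_subword_linear) (simp add: p_def)
    then have "linear_on sc fscale UNIV (\<lambda>x. bar_word (nc_right L (xs @ x # ys) Q))"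
      unfolding right'
      by (rule linear_on_compose[OF _ bar_slot[OF map_dec_NCA[OF mem(1)] map_dec_NCA[OF mem(2)]]
          dec_NCA[OF mem(3)]])
    then have "linear_on sc fscale UNIV (\<lambda>x. TNC_ten2 sc (bar_word (nc_left (xs @ 0 # ys) Q),
        bar_word (nc_right L (xs @ x # ys) Q)))"
      by (rule linear_on_compose[OF _ WA.ten2_right[OF leftV] rightV])
    moreover have const: "nc_left (xs @ x # ys) Q = nc_left (xs @ 0 # ys) Q" for x
      unfolding nc_left_def using subword_other[of xs "\<Union>Q" x ys 0] False by (simp add: p_def del:
          Union_iff)
    moreover have "coprod_term sc L (xs @ x # ys) Q =
        TNC_ten2 sc (bar_word (nc_left (xs @ 0 # ys) Q), bar_word (nc_right L (xs @ x # ys) Q))"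
            for x
      by (simp only: coprod_term_eq const[of x])
    ultimately show ?thesis by (simp only:)
  qed
qed

lemma linear_on_sum:
  assumes "vector_space t" "\<And>i. i \<in> I \<Longrightarrow> linear_on s t V (f i)"
  shows "linear_on s t V (\<lambda>x. \<Sum>i\<in>I. f i x)"
  using assms(2)
proof (induction I rule: infinite_finite_induct)
  case (insert i I)
  then have "linear_on s t V (\<lambda>x. f i x + (\<Sum>i\<in>I. f i x))"
    by (intro linear_on_plus[OF assms(1)]) simp_all
  then show ?case using insert.hyps by simp
qed (simp_all add: linear_on_zero[OF assms(1)])

lemma dec_index_length:
  "(L, xs @ x # ys) \<in> dec_index \<longleftrightarrow> (L, xs @ x' # ys) \<in> dec_index"
  by (simp add: dec_index_def)

text \<open>For a fixed partition \<open>L\<close>, multilinearity in the decorations gives a linear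
  map \<open>D L\<close> on tensors. As \<open>NCA\<close> is a direct sum over partitions, summing
  \<open>D L\<close> over the support yields the required map \<open>E\<close>.\<close>

lemma extendable_dec:
  assumes Ad: "\<And>L. Ad L \<subseteq> admissible L"
  shows "extendable nscale fscale (dec sc) dec_index (\<lambda>(L, as). \<Sum>Q\<in>Ad L. coprod_term sc L as Q)"
proof -
  \<comment> \<open>Multilinearity is required on lists of every length, so lists whose length does
    not fit \<open>L\<close> are sent to \<open>0\<close>.\<close>
  define \<phi> where "\<phi> L as = (if (L, as) \<in> dec_index then \<Sum>Q\<in>Ad L. coprod_term sc L as Q else 0)"
      for L as
  have ml: "multilinear_on sc fscale UNIV (\<phi> L)" for L
    unfolding multilinear_on_def
  proof (intro ballI)
    fix xs ys :: "'a list"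
    show "linear_on sc fscale UNIV (\<lambda>x. \<phi> L (xs @ x # ys))"
    proof (cases "(L, xs @ 0 # ys) \<in> dec_index")
      case True
      then have ind: "(L, xs @ x # ys) \<in> dec_index" for x using dec_index_length[of L xs x ys 0] by
          blast
      have "linear_on sc fscale UNIV (\<lambda>x. \<Sum>Q\<in>Ad L. coprod_term sc L (xs @ x # ys) Q)"
        by (rule linear_on_sum[OF W2.vector_space_axioms])
            (rule coprod_term_linear[OF ind subsetD[OF Ad]])
      then show ?thesis by (simp add: \<phi>_def ind)
    next
      case False
      then have "(L, xs @ x # ys) \<notin> dec_index" for x using dec_index_length[of L xs x ys 0] by blast
      then show ?thesis by (simp add: \<phi>_def linear_on_zero[OF W2.vector_space_axioms])
    qed
  qed
  define D where "D L = lin_ext fscale fscale (ten sc UNIV) (lists UNIV) (\<phi> L)" for L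
  have D: "linear_on fscale fscale (talg sc UNIV) (D L)" "D L (ten sc UNIV as) = \<phi> L as" for L as
    using ten_universal[OF W2.vector_space_axioms ml] unfolding D_def by simp_all
  have sub: "A.subspace (talg sc UNIV)" by (simp add: talg_def)
  have D0: "D L 0 = 0" for L by (rule A.linear_on_0[OF D(1) sub])
  define E where "E f = (\<Sum>L\<in>supp f. D L (coeff f L))" for f
  have E: "E f = (\<Sum>L\<in>K. D L (coeff f L))" if "finite K" "supp f \<subseteq> K" for f K
    unfolding E_def by (rule sum.mono_neutral_left) (use that D0 in \<open>auto simp: in_keys_iff\<close>)
  have lk: "coeff f L \<in> talg sc UNIV" if f: "f \<in> NCA sc" for f L
  proof (cases "coeff f L = 0")
    case False
    then obtain n where "coeff f L \<in> tpower sc UNIV n" using f unfolding NCA_iff by blast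
    moreover have "tpower sc UNIV n \<subseteq> talg sc UNIV"
      unfolding tpower_def talg_def by (intro A.span_mono image_mono) simp
    ultimately show ?thesis by blast
  qed (simp add: A.subspace_0[OF sub])
  show ?thesis
  proof (rule extendableI[where D = E])
    show "linear_on nscale fscale (N.span (dec sc ` dec_index)) E"
      unfolding NCA_eq_span[symmetric]
    proof (rule linear_onI)
      fix f g assume f: "f \<in> NCA sc" and g: "g \<in> NCA sc"
      let ?K = "supp f \<union> supp g"
      have "supp (f + g) \<subseteq> ?K" by (rule Poly_Mapping.keys_add)
      then show "E (f + g) = E f + E g"
        using linear_on_addD[OF D(1) lk[OF f] lk[OF g]]
        by (simp add: E[of ?K] lookup_add sum.distrib)
    next
      fix c f assume f: "f \<in> NCA sc"
      have "supp (nscale c f) \<subseteq> supp f"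
        by (auto simp: in_keys_iff lookup_nscale)
      then show "E (nscale c f) = fscale c (E f)"
        using linear_on_scaleD[OF D(1) lk[OF f]]
        by (simp add: E[of "supp f"] lookup_nscale W2.scale_sum_right)
    qed
    fix i :: "nat set set \<times> 'a list" assume i: "i \<in> dec_index"
    obtain L as where Las: "i = (L, as)" by (cases i)
    have "E (dec sc (L, as)) = D L (ten sc UNIV as)"
      unfolding dec_def prod.case by (subst E[of "{L}"]) (simp_all add: keys_single)
    then show "E (dec sc i) = (case i of (L, as) \<Rightarrow> \<Sum>Q\<in>Ad L. coprod_term sc L as Q)"
      using i by (simp add: Las D(2) \<phi>_def)
  qed
qed

text \<open>The predicate \<open>P\<close> on the tag treats the full coproduct and its two halves
  at once.\<close>

lemma restricted_coprod_gen:
  fixes Ad :: "nat set set \<Rightarrow> nat set set set"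
  assumes Ad: "\<forall>L as. (L, as :: 'a list) \<in> dec_index \<longrightarrow> Ad L = {Q \<in> admissible L. P (1 \<in> \<Union>Q)}"
    and sub: "\<And>L. Ad L \<subseteq> admissible L"
  defines "D \<equiv> lin_ext nscale fscale (dec sc) dec_index (\<lambda>(L, as). \<Sum>Q\<in>Ad L. coprod_term sc L as Q)"
  shows "linear_on nscale fscale (NCA sc) D"
    "g \<in> dec_index \<Longrightarrow> D (dec sc g) = WA.\<Theta> (filter_mset (\<lambda>x. P (fst x)) (nc_cop g))"
proof -
  note ext = lin_ext[OF extendable_dec[of Ad, OF sub], folded D_def]
  show "linear_on nscale fscale (NCA sc) D" using ext(1) unfolding NCA_eq_span .
  assume g: "g \<in> dec_index"
  obtain L as where gL: "g = (L, as)" by (cases g)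
  have "WA.\<Theta> (filter_mset (\<lambda>x. P (fst x)) (nc_cop g)) =
    (\<Sum>Q | Q \<in> admissible L \<and> P (1 \<in> \<Union>Q). coprod_term sc L as Q)"
    unfolding nc_cop_def gL fst_conv snd_conv
      filter_mset_sum_single[OF finite_admissible[OF g[unfolded gL]]] word_ten2_def
          sum_mset_sum_single
      coprod_term_eq ..
  moreover have "D (dec sc g) = (\<Sum>Q\<in>Ad L. coprod_term sc L as Q)"
    using ext(2)[OF g] by (simp only: gL prod.case)
  ultimately show "D (dec sc g) = WA.\<Theta> (filter_mset (\<lambda>x. P (fst x)) (nc_cop g))"
    by (simp only: Ad[rule_format, OF g[unfolded gL]])
qed

lemma coprod_gen:
  "linear_on nscale fscale (NCA sc) (coprod_gen sc)"
  "g \<in> dec_index \<Longrightarrow> coprod_gen sc (dec sc g) = WA.\<Theta> (nc_cop g)"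
  using restricted_coprod_gen[of admissible "\<lambda>t. True", folded coprod_gen_def] by simp_all

lemma prec_plus_gen:
  "linear_on nscale fscale (NCA sc) (prec_plus_gen sc)"
  "g \<in> dec_index \<Longrightarrow> prec_plus_gen sc (dec sc g) = WA.\<Theta> (filter_mset (\<lambda>x. fst x) (nc_cop g))"
  using restricted_coprod_gen[of "\<lambda>L. {Q. Q \<in> admissible L \<and> 1 \<in> \<Union>Q}"
      "\<lambda>t. t", folded prec_plus_gen_def]
  by (simp_all del: Union_iff)

lemma succ_plus_gen:
  "linear_on nscale fscale (NCA sc) (succ_plus_gen sc)"
  "g \<in> dec_index \<Longrightarrow> succ_plus_gen sc (dec sc g) = WA.\<Theta> (filter_mset (\<lambda>x. \<not> fst x) (nc_cop g))"
proof -
  \<comment> \<open>An index pair has at least one point, so exactly one block contains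
    \<open>1\<close>. Therefore a block outside \<open>Q\<close> contains \<open>1\<close> if and
    only if none in \<open>Q\<close> does.\<close>
  have "{Q. Q \<in> admissible L \<and> 1 \<in> \<Union>(L - Q)} = {Q \<in> admissible L. \<not> 1 \<in> \<Union>Q}"
    if Las: "(L, as :: 'a list) \<in> dec_index" for L as
  proof -
    have part: "partition_on {1..length as} L" "1 \<le> length as"
      using Las by (auto simp: dec_index_def NC_def noncrossing_def)
    then have "1 \<in> \<Union>L" using partition_onD1[OF part(1)] by auto
    then obtain B where B: "B \<in> L" "1 \<in> B" by blast
    have unique: "C = B" if "C \<in> L" "1 \<in> C" for C
      using disjointD[OF partition_onD2[OF part(1)] that(1) B(1)] that(2) B(2) by blast
    have key: "1 \<in> \<Union>(L - Q) \<longleftrightarrow> \<not> 1 \<in> \<Union>Q" if Q: "Q \<in> admissible L" for Q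
    proof
      have QL: "Q \<subseteq> L" using Q by (simp add: admissible_def)
      assume "1 \<in> \<Union>(L - Q)"
      then obtain C where "C \<in> L" "C \<notin> Q" "1 \<in> C" by (elim UnionE DiffE)
      then have "B \<notin> Q" using unique[of C] by simp
      show "\<not> 1 \<in> \<Union>Q"
      proof
        assume "1 \<in> \<Union>Q"
        then obtain C' where "C' \<in> Q" "1 \<in> C'" by (elim UnionE)
        with QL unique[of C'] \<open>B \<notin> Q\<close> show False by auto
      qed
    next
      assume "\<not> 1 \<in> \<Union>Q"
      then have "B \<in> L - Q" using B by auto
      with B(2) show "1 \<in> \<Union>(L - Q)" by (rule UnionI[rotated])
    qed
    show ?thesis by (rule Collect_cong) (use key in \<open>simp only: cong: conj_cong\<close>)
  qed
  then have eq: "\<forall>L as. (L, as :: 'a list) \<in> dec_index \<longrightarrow>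
      {Q. Q \<in> admissible L \<and> 1 \<in> \<Union>(L - Q)} = {Q \<in> admissible L. \<not> 1 \<in> \<Union>Q}"
    by (intro allI impI)
  have sub: "{Q. Q \<in> admissible L \<and> 1 \<in> \<Union>(L - Q)} \<subseteq> admissible L" for L by blast
  note G = restricted_coprod_gen[of "\<lambda>L. {Q. Q \<in> admissible L \<and> 1 \<in> \<Union>(L - Q)}"
      "\<lambda>t. \<not> t", OF eq sub, folded succ_plus_gen_def]
  show "linear_on nscale fscale (NCA sc) (succ_plus_gen sc)" by (rule G(1))
  show "g \<in> dec_index \<Longrightarrow> succ_plus_gen sc (dec sc g) = WA.\<Theta> (filter_mset (\<lambda>x. \<not> fst x) (nc_cop g))"
    by (rule G(2))
qed

section \<open>Coproducts of bar words\<close>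

abbreviation "T2 \<equiv> tsquare fscale (TNC sc) (TNC sc)"

lemma gen_T:
  assumes lin: "linear_on nscale fscale (NCA sc) D"
    and val: "\<And>g. g \<in> dec_index \<Longrightarrow> D (dec sc g) = WA.\<Theta> (filter_mset P (nc_cop g))"
    and w: "w \<in> NCA sc"
  shows "D w \<in> T2"
proof (rule N.linear_on_span_into[OF W2.vector_space_axioms lin[unfolded NCA_eq_span] _
    WA.subspace_T w[unfolded NCA_eq_span]])
  fix v assume "v \<in> dec sc ` dec_index"
  then obtain g where g: "g \<in> dec_index" "v = dec sc g" by (rule imageE)
  have "\<forall>x\<in>#nc_cop g. lft x \<in> lists dec_index \<and> rgt x \<in> lists dec_index"
    using LC.word_legs_closed[of "[g]"] g(1) by (simp add: word_cop_single)
  then have "WA.\<Theta> (filter_mset P (nc_cop g)) \<in> T2" by (intro WA.\<Theta>_T) simp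
  then show "D v \<in> T2" using val[OF g(1)] g(2) by simp
qed

lemma coprod_gen_T: "w \<in> NCA sc \<Longrightarrow> coprod_gen sc w \<in> T2"
  by (rule gen_T[OF coprod_gen(1), of "\<lambda>x. True"]) (simp_all add: coprod_gen(2))

lemma TNC_mult2_closed:
  assumes x: "x \<in> T2" and y: "y \<in> T2"
  shows "TNC_mult2 sc x y \<in> T2"
proof -
  have 1: "TNC_mult2 sc x (TNC_ten2 sc (c, d)) \<in> T2" if cd: "c \<in> TNC sc" "d \<in> TNC sc" for c d
  proof (rule W2.linear_on_span_into[OF W2.vector_space_axioms _ _ WA.subspace_T x[unfolded
      tsquare_def]])
    show "linear_on fscale fscale (W2.span (TNC_ten2 sc ` (TNC sc \<times> TNC sc)))
        (\<lambda>x. TNC_mult2 sc x (TNC_ten2 sc (c, d)))"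
      unfolding tsquare_def[symmetric] by (intro WA.tm(1) WA.ten2_T cd)
    fix v assume "v \<in> TNC_ten2 sc ` (TNC sc \<times> TNC sc)"
    then obtain a b where "a \<in> TNC sc" "b \<in> TNC sc" "v = TNC_ten2 sc (a,
        b)" by (elim imageE SigmaE) simp
    then show "TNC_mult2 sc v (TNC_ten2 sc (c, d)) \<in> T2"
      using cd by (simp add: WA.tm(3) WA.ten2_T WA.m_closed)
  qed
  show ?thesis
  proof (rule W2.linear_on_span_into[OF W2.vector_space_axioms _ _ WA.subspace_T y[unfolded
      tsquare_def]])
    show "linear_on fscale fscale (W2.span (TNC_ten2 sc ` (TNC sc \<times> TNC sc))) (TNC_mult2 sc x)"
      unfolding tsquare_def[symmetric] by (intro WA.tm(2) x)
    fix v assume "v \<in> TNC_ten2 sc ` (TNC sc \<times> TNC sc)"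
    then obtain c d where "c \<in> TNC sc" "d \<in> TNC sc" "v = TNC_ten2 sc (c,
        d)" by (elim imageE SigmaE) simp
    then show "TNC_mult2 sc x v \<in> T2" using 1 by simp
  qed
qed

lemma coprod_word_T: "ws \<in> lists (NCA sc) \<Longrightarrow> coprod_word sc ws \<in> T2"
proof (induction ws rule: list.induct)
  case Nil
  have "TNC_one sc \<in> TNC sc" unfolding TNC_one by (rule WA.e_V) simp
  then show ?case by (simp add: coprod_word_def WA.ten2_T)
next
  case (Cons w ws)
  then have "TNC_mult2 sc (coprod_gen sc w) (coprod_word sc ws) \<in> T2"
    by (intro TNC_mult2_closed coprod_gen_T) simp_all
  then show ?case by (simp add: coprod_word_def)
qed

lemma coprod_word_Cons: "coprod_word sc (w # ws) = TNC_mult2 sc (coprod_gen sc w)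
    (coprod_word sc ws)"
  by (simp add: coprod_word_def)

text \<open>At the free slot itself, linearity comes from \<open>coprod_gen\<close> and the left
  argument of the product. Each earlier letter only adds multiplication by a fixed left
  factor.\<close>

lemma coprod_word_multilinear: "multilinear_on nscale fscale (NCA sc) (coprod_word sc)"
  unfolding multilinear_on_def
proof (intro ballI)
  fix xs ys assume "xs \<in> lists (NCA sc)" and ys: "ys \<in> lists (NCA sc)"
  then show "linear_on nscale fscale (NCA sc) (\<lambda>x. coprod_word sc (xs @ x # ys))"
  proof (induction xs rule: list.induct)
    case Nil
    show ?case
      unfolding append_Nil coprod_word_Cons
      by (intro linear_on_compose[OF coprod_gen(1) WA.tm(1)] coprod_gen_T coprod_word_T ys)
  next
    case (Cons a xs)
    then have a: "a \<in> NCA sc" "xs \<in> lists (NCA sc)" by simp_all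
    have lin: "linear_on fscale fscale T2 (TNC_mult2 sc (coprod_gen sc a))"
      by (intro WA.tm(2) coprod_gen_T a)
    show ?case
      unfolding append_Cons coprod_word_Cons
      by (rule linear_on_compose[OF Cons.IH[OF a(2) ys] lin]) (rule coprod_word_T, use a ys in simp)
  qed
qed

lemma coprod:
  "linear_on fscale fscale (TNC sc) (coprod sc)"
  "ws \<in> lists (NCA sc) \<Longrightarrow> coprod sc (bar sc ws) = coprod_word sc ws"
  using ten_universal[OF W2.vector_space_axioms coprod_word_multilinear]
  unfolding coprod_def TNC_def by blast+

lemma coprod_word_dec: "w \<in> lists dec_index \<Longrightarrow> coprod_word sc (map (dec sc) w) =
    WA.\<Theta> (word_cop nc_cop w)"
proof (induction w rule: list.induct)
  case Nil
  then show ?case by (simp add: coprod_word_def TNC_one word_ten2_def)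
next
  case (Cons g w)
  then have g: "g \<in> dec_index" "w \<in> lists dec_index" by simp_all
  have legs: "WA.legs_in (lists dec_index) (nc_cop g)" "WA.legs_in (lists dec_index)
      (word_cop nc_cop w)"
    using LC.word_legs_closed[of "[g]"] LC.word_legs_closed[of w] g by (simp_all add:
        word_cop_single)
  show ?case
    unfolding list.map coprod_word_Cons Cons.IH[OF g(2)] coprod_gen(2)[OF g(1)] word_cop.simps
    by (rule WA.tm_\<Theta>[OF legs])
qed

lemma restricted_coprod:
  fixes D :: "('k, 'a) nca \<Rightarrow> (('k, 'a) tnc list \<Rightarrow>\<^sub>0 'k)" and P :: "bool \<Rightarrow> bool"
  assumes lin: "linear_on nscale fscale (NCA sc) D"
    and val: "\<And>g. g \<in> dec_index \<Longrightarrow> D (dec sc g) = WA.\<Theta> (filter_mset (\<lambda>x. P (fst x)) (nc_cop g))"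
  defines "E \<equiv> lin_ext fscale fscale (bar sc) (lists (NCA sc) - {[]})
    (\<lambda>ws. TNC_mult2 sc (D (hd ws)) (coprod_word sc (tl ws)))"
  shows "linear_on fscale fscale (TNC_plus sc) E"
    "w \<in> lists dec_index \<Longrightarrow> w \<noteq> [] \<Longrightarrow> E (bar_word w) = WA.\<Theta> (filter_mset (\<lambda>x. P (fst x))
        (word_cop nc_cop w))"
proof -
  let ?\<psi> = "\<lambda>ws. TNC_mult2 sc (D (hd ws)) (coprod_word sc (tl ws))"
  have DT: "w \<in> NCA sc \<Longrightarrow> D w \<in> T2" for w by (rule gen_T[OF lin val])
  \<comment> \<open>Multilinearity tests only lists with a slot, which are nonempty, so the
    unspecified \<open>hd []\<close> does no harm. The resulting map \<open>F\<close> on the whole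
    tensor algebra is then restricted to the span of the nonempty words.\<close>
  have "multilinear_on nscale fscale (NCA sc) ?\<psi>"
    unfolding multilinear_on_def
  proof (intro ballI)
    fix xs ys assume xs: "xs \<in> lists (NCA sc)" and ys: "ys \<in> lists (NCA sc)"
    show "linear_on nscale fscale (NCA sc) (\<lambda>x. ?\<psi> (xs @ x # ys))"
    proof (cases xs)
      case Nil
      show ?thesis
        unfolding Nil append_Nil list.sel
        by (intro linear_on_compose[OF lin WA.tm(1)] DT coprod_word_T ys)
    next
      case (Cons a zs)
      then have a: "a \<in> NCA sc" "zs \<in> lists (NCA sc)" using xs by simp_all
      have word: "linear_on nscale fscale (NCA sc) (\<lambda>x. coprod_word sc (zs @ x # ys))"
        using coprod_word_multilinear a(2) ys unfolding multilinear_on_def by blast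
      have mult: "linear_on fscale fscale T2 (TNC_mult2 sc (D a))" by (intro WA.tm(2) DT a)
      show ?thesis
        unfolding Cons append_Cons list.sel
        by (rule linear_on_compose[OF word mult]) (rule coprod_word_T, use a ys in simp)
    qed
  qed
  from ten_universal[OF W2.vector_space_axioms this] obtain F where
    F: "linear_on fscale fscale (talg nscale (NCA sc)) F" "\<And>ws. ws \<in> lists (NCA sc) \<Longrightarrow>
        F (bar sc ws) = ?\<psi> ws" by blast
  have "extendable fscale fscale (bar sc) (lists (NCA sc) - {[]}) ?\<psi>"
  proof (rule extendableI[where D = F])
    show "linear_on fscale fscale (W.span (bar sc ` (lists (NCA sc) - {[]}))) F"
      by (rule linear_on_subset[OF F(1)[unfolded talg_def]])
          (intro W.span_mono image_mono Diff_subset)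
  qed (use F(2) in blast)
  note ext = lin_ext[OF this, folded E_def]
  show "linear_on fscale fscale (TNC_plus sc) E" using ext(1) unfolding TNC_plus_def talg_plus_def .
  assume w: "w \<in> lists dec_index" "w \<noteq> []"
  then obtain g v where gv: "w = g # v" "g \<in> dec_index" "v \<in> lists dec_index" by (cases w) simp_all
  have legs: "WA.legs_in (lists dec_index) (filter_mset (\<lambda>x. P (fst x)) (nc_cop g))"
    "WA.legs_in (lists dec_index) (word_cop nc_cop v)"
    using LC.word_legs_closed[of "[g]"] LC.word_legs_closed[of v] gv by (simp_all add:
        word_cop_single)
  have "map (dec sc) w \<in> lists (NCA sc) - {[]}" using map_dec_NCA[OF w(1)] w(2) by simp
  from ext(2)[OF this] have "E (bar_word w) =
      TNC_mult2 sc (WA.\<Theta> (filter_mset (\<lambda>x. P (fst x)) (nc_cop g))) (WA.\<Theta> (word_cop nc_cop v))"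
    unfolding bar_word_def gv list.map list.sel val[OF gv(2)] coprod_word_dec[OF gv(3)] .
  also have "\<dots> = WA.\<Theta> (\<Sum>x\<in>#filter_mset (\<lambda>x. P (fst x)) (nc_cop g). image_mset
      (\<lambda>y. (fst x, lft x @ lft y, rgt x @ rgt y)) (filter_mset (\<lambda>y. True) (word_cop nc_cop v)))"
    using WA.tm_\<Theta>[OF legs] by simp
  also have "(\<Sum>x\<in>#filter_mset (\<lambda>x. P (fst x)) (nc_cop g). image_mset
      (\<lambda>y. (fst x, lft x @ lft y, rgt x @ rgt y)) (filter_mset (\<lambda>y. True) (word_cop nc_cop v)))
      = filter_mset (\<lambda>x. P (fst x)) (word_cop nc_cop w)"
    unfolding gv(1) word_cop.simps by (rule filter_bind_image[symmetric]) simp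
  finally show "E (bar_word w) = WA.\<Theta> (filter_mset (\<lambda>x. P (fst x)) (word_cop nc_cop w))" .
qed

section \<open>The unshuffle bialgebra of decorated non-crossing partitions\<close>

lemma TNC_plus_subset: "TNC_plus sc \<subseteq> TNC sc"
  unfolding TNC_eq_span TNC_plus_eq_span by (intro W.span_mono image_mono Diff_subset)

lemma TNC_counit:
  "linear_on fscale (*) (TNC sc) (TNC_counit sc)"
  "w \<in> lists dec_index \<Longrightarrow> TNC_counit sc (bar_word w) = (if w = [] then 1 else 0)"
proof -
  have vs: "vector_space ((*) :: 'k \<Rightarrow> 'k \<Rightarrow> 'k)" by unfold_locales (auto simp: algebra_simps)
  \<comment> \<open>A list with a slot is nonempty, so the family vanishes wherever multilinearity
    is tested.\<close>
  have "multilinear_on nscale (*) (NCA sc) (\<lambda>ws. if ws = [] then 1 else 0)"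
    unfolding multilinear_on_def by (simp add: linear_on_zero[OF vs])
  note U = ten_universal[OF vs this, folded tcounit_def, folded TNC_def TNC_counit_def]
  show "linear_on fscale (*) (TNC sc) (TNC_counit sc)" by (rule U(1))
  show "w \<in> lists dec_index \<Longrightarrow> TNC_counit sc (bar_word w) = (if w = [] then 1 else 0)"
    using U(2)[OF map_dec_NCA] by (simp add: bar_word_def)
qed

lemma word_bialgebra_TNC:
  "word_bialgebra fscale dec_index bar_word (TNC sc) (TNC_mult sc) nc_cop (TNC_counit sc)
    (TNC_plus sc) (coprod sc) (half_prec sc) (half_succ sc)"
proof
  show "TNC_plus sc = W.span (bar_word ` (lists dec_index - {[]}))" by (rule TNC_plus_eq_span)
  show "linear_on fscale (*) (TNC sc) (TNC_counit sc)" by (rule TNC_counit(1))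
  show "w \<in> lists dec_index \<Longrightarrow> TNC_counit sc (bar_word w) = (if w = [] then 1 else 0)"
      for w by (rule TNC_counit(2))
  show "linear_on fscale fscale (TNC sc) (coprod sc)" by (rule coprod(1))
  show "coprod sc (bar_word w) = WA.\<Theta> (word_cop nc_cop w)" if "w \<in> lists dec_index" for w
    using coprod(2)[OF map_dec_NCA[OF that]] coprod_word_dec[OF that] by (simp add: bar_word_def)
  have one: "TNC_one sc \<in> TNC sc" unfolding TNC_one by (rule WA.e_V) simp
  note prec = restricted_coprod[of "prec_plus_gen sc" "\<lambda>t. t", OF prec_plus_gen,
      folded prec_plus_def]
  note succ = restricted_coprod[of "succ_plus_gen sc" "\<lambda>t. \<not> t", OF succ_plus_gen,
      folded succ_plus_def]
  show "linear_on fscale fscale (TNC_plus sc) (half_prec sc)"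
    unfolding half_prec_def
    by (intro linear_on_minus[OF W2.vector_space_axioms] prec(1) linear_on_subset[OF WA.ten2_left
        TNC_plus_subset] one)
  show "linear_on fscale fscale (TNC_plus sc) (half_succ sc)"
    unfolding half_succ_def
    by (intro linear_on_minus[OF W2.vector_space_axioms] succ(1) linear_on_subset[OF WA.ten2_right
        TNC_plus_subset] one)
  show "half_prec sc (bar_word w) = WA.\<Theta> (filter_mset (\<lambda>x. fst x) (reduced (word_cop nc_cop w)))"
    if w: "w \<in> lists dec_index" "w \<noteq> []" for w
    \<comment> \<open>The term subtracted in \<open>half_prec\<close> is the one that
      \<open>word_cop_prec\<close> splits off.\<close>
    using prec(2)[OF _ w] LC.word_cop_prec[OF w] by (simp add: half_prec_def TNC_one
        word_ten2_add_mset)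
  show "half_succ sc (bar_word w) = WA.\<Theta> (filter_mset (\<lambda>x. \<not> fst x) (reduced (word_cop nc_cop w)))"
    if w: "w \<in> lists dec_index" "w \<noteq> []" for w
    using succ(2)[OF _ w] LC.word_cop_succ[OF w] by (simp add: half_succ_def TNC_one
        word_ten2_add_mset)
qed

end

theorem mainTheorem3:
  fixes sc :: "'k::field_char_0 \<Rightarrow> 'a::{ring, monoid_mult} \<Rightarrow> 'a"
  assumes "assoc_unital_algebra sc"
  shows "unshuffle_bialgebra fscale (TNC sc) (TNC_mult sc) (TNC_one sc) (TNC_counit sc)
    (coprod sc) (TNC_plus sc) (half_prec sc) (half_succ sc)"
  unfolding TNC_one by (rule word_bialgebra.unshuffle[OF word_bialgebra_TNC])

end
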